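(* Suppose that $k=2$. Then the finite adaptability problem $(\mathrm{Adapt}_k(\Omega))$ with $A(\cdot)$ and $B(\cdot)$ deterministic (i.e. $A(\omega)$ and $B(\omega)$ do not depend on $\omega$) can be solved by at most $3^{|V(\Omega)|}$ resolutions of a linear program of polynomial size (or a mixed linear program in case of integral variables), where $V(\Omega)$ is the set of vertices of $\Omega$.
   Context: The uncertainty set $\Omega$ is a polytope of $\mathbb{R}^n$. $A(\omega)$, $B(\omega)$ are input matrices and $\boldsymbol{b}(\omega)$ is an input vector, all depending affinely on $\omega\in\Omega$; $\boldsymbol{c}$ and $\boldsymbol{d}$ are deterministic vectors. For a positive integer $k$, with $[k]=\{1,\dots,k\}$, the finite adaptability problem $(\mathrm{Adapt}_k(\Omega))$ is $$\min_{\Omega_1,\dots,\Omega_k,\ \boldsymbol{x},\boldsymbol{y}_1,\ldots,\boldsymbol{y}_k}\ \boldsymbol{c}^\top\boldsymbol{x}+\max_{i\in[k]}\boldsymbol{d}^\top\boldsymbol{y}_i\quad\text{s.t.}\quad A(\omega)\boldsymbol{x}+B(\omega)\boldsymbol{y}_i\leq\boldsymbol{b}(\omega)\quad\forall i\in[k]\ \forall\omega\in\Omega_i,$$ where the $\Omega_i$ are constrained to form a cover of $\Omega$. The variables $\boldsymbol{x}$ and $\boldsymbol{y}_i$ are continuous, or can moreover be constrained to be integer, depending on the context. From a computational perspective, only $\boldsymbol{x},\boldsymbol{y}_1,\ldots,\boldsymbol{y}_k$ are expected to be output, and not the $\Omega_i$'s. *)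

theory Defs
  imports
    "HOL-Analysis.Analysis"
    "HOL-Analysis.Finite_Function_Topology"
    "HOL-Library.Log_Nat"
    "HOL-Computational_Algebra.Polynomial"
begin

section \<open>The finite adaptability problem\<close>

text \<open>
  The dimensions are data of an instance, so that a single algorithm can be stated for all of them.
  Accordingly \<open>\<real>\<^sup>n\<close> is the subspace of the real vector space \<^typ>\<open>nat \<Rightarrow>\<^sub>0 real\<close> of vectors
  supported in \<^term>\<open>{..<n::nat}\<close>; convex hulls and extreme points are those of the library. The
  other vectors and matrices are functions of which only the entries in range are used.

  Input numbers are rational, and a polytope is given by its vertices. An affine map of \<open>\<omega>\<close> is
  given by its constant term (index \<open>0\<close>) and the coefficients of the coordinate \<open>l\<close> of \<open>\<omega>\<close>
  (index \<^term>\<open>Suc l\<close>).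
\<close>

record adapt_instance =
  n_unc :: nat                                   \<comment> \<open>dimension of the space of \<open>\<omega>\<close>\<close>
  n_x :: nat
  n_y :: nat
  n_con :: nat                                   \<comment> \<open>number of rows of \<open>A\<close>, \<open>B\<close>, \<open>b\<close>\<close>
  n_vert :: nat
  A_coef :: "nat \<Rightarrow> nat \<Rightarrow> nat \<Rightarrow> rat"           \<comment> \<open>affine index, row, column\<close>
  B_coef :: "nat \<Rightarrow> nat \<Rightarrow> nat \<Rightarrow> rat"           \<comment> \<open>affine index, row, column\<close>
  b_coef :: "nat \<Rightarrow> nat \<Rightarrow> rat"                  \<comment> \<open>affine index, row\<close>
  c_coef :: "nat \<Rightarrow> rat"
  d_coef :: "nat \<Rightarrow> rat"
  vert :: "nat \<Rightarrow> nat \<Rightarrow> rat"                    \<comment> \<open>vertex, coordinate\<close>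
  int_x :: "nat \<Rightarrow> bool"                         \<comment> \<open>which components of \<open>x\<close> must be integers\<close>
  int_y :: "nat \<Rightarrow> bool"                         \<comment> \<open>which components of each \<open>y\<^sub>i\<close> must be integers\<close>

definition vertex_point :: "adapt_instance \<Rightarrow> nat \<Rightarrow> (nat \<Rightarrow>\<^sub>0 real)" where
  "vertex_point I v =
     Abs_poly_mapping (\<lambda>l. if l < n_unc I then real_of_rat (vert I v l) else 0)"

definition Omega :: "adapt_instance \<Rightarrow> (nat \<Rightarrow>\<^sub>0 real) set" where
  "Omega I = convex hull (vertex_point I ` {..<n_vert I})"

definition vertices :: "(nat \<Rightarrow>\<^sub>0 real) set \<Rightarrow> (nat \<Rightarrow>\<^sub>0 real) set" where
  "vertices S = {v. v extreme_point_of S}"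

text \<open>The given points are exactly the vertices of the polytope, without repetition.\<close>

definition well_formed :: "adapt_instance \<Rightarrow> bool" where
  "well_formed I \<longleftrightarrow> bij_betw (vertex_point I) {..<n_vert I} (vertices (Omega I))"

definition affine_eval :: "nat \<Rightarrow> (nat \<Rightarrow> rat) \<Rightarrow> (nat \<Rightarrow>\<^sub>0 real) \<Rightarrow> real" where
  "affine_eval n a \<omega> =
     real_of_rat (a 0) + (\<Sum>l<n. real_of_rat (a (Suc l)) * Poly_Mapping.lookup \<omega> l)"

definition A_at :: "adapt_instance \<Rightarrow> (nat \<Rightarrow>\<^sub>0 real) \<Rightarrow> nat \<Rightarrow> nat \<Rightarrow> real" where
  "A_at I \<omega> r j = affine_eval (n_unc I) (\<lambda>l. A_coef I l r j) \<omega>"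

definition B_at :: "adapt_instance \<Rightarrow> (nat \<Rightarrow>\<^sub>0 real) \<Rightarrow> nat \<Rightarrow> nat \<Rightarrow> real" where
  "B_at I \<omega> r j = affine_eval (n_unc I) (\<lambda>l. B_coef I l r j) \<omega>"

definition b_at :: "adapt_instance \<Rightarrow> (nat \<Rightarrow>\<^sub>0 real) \<Rightarrow> nat \<Rightarrow> real" where
  "b_at I \<omega> r = affine_eval (n_unc I) (\<lambda>l. b_coef I l r) \<omega>"

definition deterministic_A :: "adapt_instance \<Rightarrow> bool" where
  "deterministic_A I \<longleftrightarrow>
     (\<forall>\<omega>\<in>Omega I. \<forall>\<omega>'\<in>Omega I. \<forall>r<n_con I. \<forall>j<n_x I. A_at I \<omega> r j = A_at I \<omega>' r j)"

definition deterministic_B :: "adapt_instance \<Rightarrow> bool" where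
  "deterministic_B I \<longleftrightarrow>
     (\<forall>\<omega>\<in>Omega I. \<forall>\<omega>'\<in>Omega I. \<forall>r<n_con I. \<forall>j<n_y I. B_at I \<omega> r j = B_at I \<omega>' r j)"

definition continuous_variables :: "adapt_instance \<Rightarrow> bool" where
  "continuous_variables I \<longleftrightarrow> (\<forall>j<n_x I. \<not> int_x I j) \<and> (\<forall>j<n_y I. \<not> int_y I j)"

text \<open>Feasibility of \<open>(\<Omega>\<^sub>1, \<dots>, \<Omega>\<^sub>k, x, y\<^sub>1, \<dots>, y\<^sub>k)\<close>, the indices \<open>i\<close> running over \<^term>\<open>{..<k::nat}\<close>.\<close>

definition adapt_feasible ::
  "adapt_instance \<Rightarrow> nat \<Rightarrow> (nat \<Rightarrow> (nat \<Rightarrow>\<^sub>0 real) set) \<Rightarrow> (nat \<Rightarrow> real) \<Rightarrow> (nat \<Rightarrow> nat \<Rightarrow> real) \<Rightarrow> bool"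
where
  "adapt_feasible I k Om x y \<longleftrightarrow>
     (\<Union>i<k. Om i) = Omega I \<and>
     (\<forall>j<n_x I. int_x I j \<longrightarrow> x j \<in> \<int>) \<and>
     (\<forall>i<k. \<forall>j<n_y I. int_y I j \<longrightarrow> y i j \<in> \<int>) \<and>
     (\<forall>i<k. \<forall>\<omega>\<in>Om i. \<forall>r<n_con I.
        (\<Sum>j<n_x I. A_at I \<omega> r j * x j) + (\<Sum>j<n_y I. B_at I \<omega> r j * y i j) \<le> b_at I \<omega> r)"

definition adapt_objective ::
  "adapt_instance \<Rightarrow> nat \<Rightarrow> (nat \<Rightarrow> real) \<Rightarrow> (nat \<Rightarrow> nat \<Rightarrow> real) \<Rightarrow> real" where
  "adapt_objective I k x y =
     (\<Sum>j<n_x I. real_of_rat (c_coef I j) * x j) +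
     Max ((\<lambda>i. \<Sum>j<n_y I. real_of_rat (d_coef I j) * y i j) ` {..<k})"

definition adapt_infeasible :: "adapt_instance \<Rightarrow> nat \<Rightarrow> bool" where
  "adapt_infeasible I k \<longleftrightarrow> \<not> (\<exists>Om x y. adapt_feasible I k Om x y)"

definition adapt_unbounded :: "adapt_instance \<Rightarrow> nat \<Rightarrow> bool" where
  "adapt_unbounded I k \<longleftrightarrow>
     (\<forall>M. \<exists>Om x y. adapt_feasible I k Om x y \<and> adapt_objective I k x y < M)"

definition adapt_optimal ::
  "adapt_instance \<Rightarrow> nat \<Rightarrow> (nat \<Rightarrow> real) \<Rightarrow> (nat \<Rightarrow> nat \<Rightarrow> real) \<Rightarrow> bool" where
  "adapt_optimal I k x y \<longleftrightarrow>
     (\<exists>Om. adapt_feasible I k Om x y) \<and>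
     (\<forall>Om' x' y'. adapt_feasible I k Om' x' y' \<longrightarrow>
        adapt_objective I k x y \<le> adapt_objective I k x' y')"


section \<open>Linear and mixed linear programs\<close>

text \<open>
  Minimize \<open>obj \<cdot> z\<close> subject to \<open>lhs z \<le> rhs\<close>, with \<open>z\<close> real and the components flagged
  in \<open>integral\<close> integer.
\<close>

record lin_prog =
  rows :: nat
  cols :: nat
  lhs :: "nat \<Rightarrow> nat \<Rightarrow> rat"
  rhs :: "nat \<Rightarrow> rat"
  obj :: "nat \<Rightarrow> rat"
  integral :: "nat \<Rightarrow> bool"

definition is_pure_lp :: "lin_prog \<Rightarrow> bool" where
  "is_pure_lp P \<longleftrightarrow> (\<forall>j<cols P. \<not> integral P j)"

definition lp_feasible :: "lin_prog \<Rightarrow> (nat \<Rightarrow> real) \<Rightarrow> bool" where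
  "lp_feasible P z \<longleftrightarrow>
     (\<forall>i<rows P. (\<Sum>j<cols P. real_of_rat (lhs P i j) * z j) \<le> real_of_rat (rhs P i)) \<and>
     (\<forall>j<cols P. integral P j \<longrightarrow> z j \<in> \<int>)"

definition lp_objective :: "lin_prog \<Rightarrow> (nat \<Rightarrow> real) \<Rightarrow> real" where
  "lp_objective P z = (\<Sum>j<cols P. real_of_rat (obj P j) * z j)"

datatype lp_answer = Infeasible | Unbounded | Optimal "nat \<Rightarrow> rat"

fun valid_answer :: "lin_prog \<Rightarrow> lp_answer \<Rightarrow> bool" where
  "valid_answer P Infeasible \<longleftrightarrow> \<not> (\<exists>z. lp_feasible P z)"
| "valid_answer P Unbounded \<longleftrightarrow> (\<forall>M. \<exists>z. lp_feasible P z \<and> lp_objective P z < M)"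
| "valid_answer P (Optimal z) \<longleftrightarrow>
     lp_feasible P (\<lambda>j. real_of_rat (z j)) \<and>
     (\<forall>z'. lp_feasible P z' \<longrightarrow> lp_objective P (\<lambda>j. real_of_rat (z j)) \<le> lp_objective P z')"

text \<open>
  Every mixed linear program with rational data is infeasible, unbounded, or has a rational optimal
  solution (Meyer's theorem), so solvers exist.
\<close>

definition lp_solver :: "(lin_prog \<Rightarrow> lp_answer) \<Rightarrow> bool" where
  "lp_solver solver \<longleftrightarrow> (\<forall>P. valid_answer P (solver P))"


section \<open>Encoding sizes\<close>

text \<open>Sign, numerator and denominator in binary.\<close>

definition rat_size :: "rat \<Rightarrow> nat" where
  "rat_size r = (case quotient_of r of (a, b) \<Rightarrow> 1 + floorlog 2 (nat \<bar>a\<bar>) + floorlog 2 (nat b))"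

definition instance_size :: "adapt_instance \<Rightarrow> nat" where
  "instance_size I =
     n_unc I + n_x I + n_y I + n_con I + n_vert I
   + (\<Sum>l\<le>n_unc I. \<Sum>r<n_con I. \<Sum>j<n_x I. rat_size (A_coef I l r j))
   + (\<Sum>l\<le>n_unc I. \<Sum>r<n_con I. \<Sum>j<n_y I. rat_size (B_coef I l r j))
   + (\<Sum>l\<le>n_unc I. \<Sum>r<n_con I. rat_size (b_coef I l r))
   + (\<Sum>j<n_x I. rat_size (c_coef I j))
   + (\<Sum>j<n_y I. rat_size (d_coef I j))
   + (\<Sum>v<n_vert I. \<Sum>l<n_unc I. rat_size (vert I v l))"

definition lp_size :: "lin_prog \<Rightarrow> nat" where
  "lp_size P =
     rows P + cols P
   + (\<Sum>i<rows P. \<Sum>j<cols P. rat_size (lhs P i j))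
   + (\<Sum>i<rows P. rat_size (rhs P i))
   + (\<Sum>j<cols P. rat_size (obj P j))"

fun answer_size :: "lin_prog \<Rightarrow> lp_answer \<Rightarrow> nat" where
  "answer_size P (Optimal z) = (\<Sum>j<cols P. rat_size (z j))"
| "answer_size P _ = 0"


section \<open>Algorithms calling a linear programming solver\<close>

text \<open>
  Imperative programs over named arrays of rationals; a scalar is the cell with the empty index
  list. Testing a condition is testing whether the expression is nonzero.
\<close>

type_synonym store = "string \<Rightarrow> nat list \<Rightarrow> rat"

datatype expr =
    Num rat
  | Cell string "expr list"
  | Plus expr expr
  | Minus expr expr
  | Times expr expr
  | Divide expr expr
  | Leq expr expr

fun eval :: "expr \<Rightarrow> store \<Rightarrow> rat" where
  "eval (Num r) s = r"
| "eval (Cell a es) s = s a (map (\<lambda>e. nat \<lfloor>eval e s\<rfloor>) es)"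
| "eval (Plus e f) s = eval e s + eval f s"
| "eval (Minus e f) s = eval e s - eval f s"
| "eval (Times e f) s = eval e s * eval f s"
| "eval (Divide e f) s = eval e s / eval f s"
| "eval (Leq e f) s = of_bool (eval e s \<le> eval f s)"

datatype com =
    Skip
  | Assign string "expr list" expr
  | Seq com com
  | Cond expr com com
  | While expr com
  | Solve

fun scalar :: "rat \<Rightarrow> nat list \<Rightarrow> rat" where
  "scalar a [] = a"
| "scalar a _ = 0"

fun array1 :: "(nat \<Rightarrow> rat) \<Rightarrow> nat list \<Rightarrow> rat" where
  "array1 a [i] = a i"
| "array1 a _ = 0"

fun array2 :: "(nat \<Rightarrow> nat \<Rightarrow> rat) \<Rightarrow> nat list \<Rightarrow> rat" where
  "array2 a [i, j] = a i j"
| "array2 a _ = 0"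

fun array3 :: "(nat \<Rightarrow> nat \<Rightarrow> nat \<Rightarrow> rat) \<Rightarrow> nat list \<Rightarrow> rat" where
  "array3 a [i, j, l] = a i j l"
| "array3 a _ = 0"

text \<open>The command \<^const>\<open>Solve\<close> takes its program from the following arrays.\<close>

definition read_lp :: "store \<Rightarrow> lin_prog" where
  "read_lp s =
     \<lparr> rows = nat \<lfloor>s ''rows'' []\<rfloor>,
       cols = nat \<lfloor>s ''cols'' []\<rfloor>,
       lhs = (\<lambda>i j. s ''lhs'' [i, j]),
       rhs = (\<lambda>i. s ''rhs'' [i]),
       obj = (\<lambda>j. s ''obj'' [j]),
       integral = (\<lambda>j. s ''integral'' [j] \<noteq> 0) \<rparr>"

fun write_answer :: "lin_prog \<Rightarrow> lp_answer \<Rightarrow> store \<Rightarrow> store" where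
  "write_answer P Infeasible s = s(''status'' := scalar 0)"
| "write_answer P Unbounded s = s(''status'' := scalar 1)"
| "write_answer P (Optimal z) s =
     s(''status'' := scalar 2, ''sol'' := array1 (\<lambda>j. if j < cols P then z j else 0))"

text \<open>
  \<open>exec solver c s t Q s'\<close>: started in \<open>s\<close>, the program \<open>c\<close> terminates in \<open>s'\<close>, in time \<open>t\<close> and
  having called the solver successively on the programs in \<open>Q\<close>. Time is charged at logarithmic
  cost: an assignment costs the length of the number written. (Expressions have a size depending on
  the program only, and the numbers they involve are part of the input, of an answer of the
  solver, or have been paid for, so that their evaluation need not be charged.)
\<close>

inductive exec ::
  "(lin_prog \<Rightarrow> lp_answer) \<Rightarrow> com \<Rightarrow> store \<Rightarrow> nat \<Rightarrow> lin_prog list \<Rightarrow> store \<Rightarrow> bool"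
  for solver where
  exec_Skip: "exec solver Skip s 1 [] s"
| exec_Assign:
    "exec solver (Assign a es e) s (1 + rat_size (eval e s)) []
       (s(a := (s a)(map (\<lambda>e. nat \<lfloor>eval e s\<rfloor>) es := eval e s)))"
| exec_Seq:
    "exec solver c1 s1 t1 Q1 s2 \<Longrightarrow> exec solver c2 s2 t2 Q2 s3 \<Longrightarrow>
     exec solver (Seq c1 c2) s1 (t1 + t2) (Q1 @ Q2) s3"
| exec_CondTrue:
    "eval e s \<noteq> 0 \<Longrightarrow> exec solver c1 s t Q s' \<Longrightarrow> exec solver (Cond e c1 c2) s (1 + t) Q s'"
| exec_CondFalse:
    "eval e s = 0 \<Longrightarrow> exec solver c2 s t Q s' \<Longrightarrow> exec solver (Cond e c1 c2) s (1 + t) Q s'"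
| exec_WhileFalse:
    "eval e s = 0 \<Longrightarrow> exec solver (While e c) s 1 [] s"
| exec_WhileTrue:
    "eval e s1 \<noteq> 0 \<Longrightarrow> exec solver c s1 t1 Q1 s2 \<Longrightarrow> exec solver (While e c) s2 t2 Q2 s3 \<Longrightarrow>
     exec solver (While e c) s1 (1 + t1 + t2) (Q1 @ Q2) s3"
| exec_Solve:
    "exec solver Solve s 1 [read_lp s] (write_answer (read_lp s) (solver (read_lp s)) s)"

definition load :: "adapt_instance \<Rightarrow> store" where
  "load I = (\<lambda>a ix. 0)
     (''n_unc'' := scalar (of_nat (n_unc I)),
      ''n_x'' := scalar (of_nat (n_x I)),
      ''n_y'' := scalar (of_nat (n_y I)),
      ''n_con'' := scalar (of_nat (n_con I)),
      ''n_vert'' := scalar (of_nat (n_vert I)),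
      ''A'' := array3 (A_coef I),
      ''B'' := array3 (B_coef I),
      ''b'' := array2 (b_coef I),
      ''c'' := array1 (c_coef I),
      ''d'' := array1 (d_coef I),
      ''vert'' := array2 (vert I),
      ''int_x'' := array1 (\<lambda>j. of_bool (int_x I j)),
      ''int_y'' := array1 (\<lambda>j. of_bool (int_y I j)))"

text \<open>The final store says whether the problem has an optimal solution, and contains one if so.\<close>

definition adapt_solved :: "adapt_instance \<Rightarrow> nat \<Rightarrow> store \<Rightarrow> bool" where
  "adapt_solved I k s \<longleftrightarrow>
     s ''result'' [] = 0 \<and> adapt_infeasible I k \<or>
     s ''result'' [] = 1 \<and> adapt_unbounded I k \<or>
     s ''result'' [] = 2 \<and>
       adapt_optimal I k (\<lambda>j. real_of_rat (s ''x'' [j])) (\<lambda>i j. real_of_rat (s ''y'' [i, j]))"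

end

theory Submission
  imports Defs
begin

text \<open>
  With \<open>A\<close> and \<open>B\<close> deterministic, the part of the polytope covered by \<open>y\<^sub>i\<close> is cut out by the inequalities
  \<open>b\<^sub>r(\<omega>) \<ge> (A x + B y\<^sub>i)\<^sub>r\<close>. The two parts cover the polytope iff for all rows \<open>r\<close>, \<open>s\<close> its image under
  \<open>(b\<^sub>r, b\<^sub>s)\<close> avoids the open quadrant below \<open>(\<alpha>, \<beta>) = ((A x + B y\<^sub>1)\<^sub>r, (A x + B y\<^sub>2)\<^sub>s)\<close>. Given
  which \<open>y\<^sub>i\<close> covers each vertex, it suffices to check this on the segments between a vertex \<open>v\<close> covered
  by \<open>y\<^sub>1\<close> and a vertex \<open>u\<close> covered by \<open>y\<^sub>2\<close>: then a single halfspace contains all vertices and misses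
  the quadrant. The condition for one segment is a comparison of the slopes from \<open>(\<alpha>, \<beta>)\<close> to its ends,
  in which the product \<open>\<alpha> \<beta>\<close> cancels, so it is linear in \<open>x\<close>, \<open>y\<^sub>1\<close>, \<open>y\<^sub>2\<close>. Hence one (mixed) linear
  program for each of the \<open>2\<^sup>n \<le> 3\<^sup>n\<close> labellings of the \<open>n\<close> vertices suffices.
\<close>

section \<open>Covering the polytope by two convex pieces\<close>

text \<open>What the geometry leaves open is the cost. An assignment is charged by the length of the
  number written, so every intermediate value requires a length bound; since the lengths of reduced
  fractions do not add up under sums, a coarser measure with an unreduced denominator is carried
  through. The solver is arbitrary: the length of its answers is known only after the run, so times
  are bounded in terms of \<open>instance_size I + N\<close> for every \<open>N\<close> that bounds
  the answers. Expressions have neither conditionals nor integer division; the former are simulated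
  by arithmetic with 0 and 1, the latter by a table of floors. That table has at least
  \<open>2 ^ n_vert I\<close> entries, which the budget, exponential in the number of vertices,
  allows. All labellings produce programs of the same shape, pairs without conflict contributing the
  row \<open>0 \<le> 0\<close>, so that between two resolutions only coefficients and right-hand
  sides are rewritten.\<close>

lemma lookup_scaleR_poly_mapping:
  fixes x :: "'a \<Rightarrow>\<^sub>0 'b::real_vector"
  shows "Poly_Mapping.lookup (c *\<^sub>R x) i = c *\<^sub>R Poly_Mapping.lookup x i"
proof -
  have "finite {i. c *\<^sub>R Poly_Mapping.lookup x i \<noteq> 0}"
    by (rule finite_subset[OF _ finite_keys[of x]]) (auto simp: in_keys_iff)
  then show ?thesis
    by (simp add: scaleR_poly_mapping_def)
qed

lemma lookup_vertex_point:
  "Poly_Mapping.lookup (vertex_point I v) l = (if l < n_unc I then real_of_rat (vert I v l) else 0)"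
proof -
  have "finite {l. (if l < n_unc I then real_of_rat (vert I v l) else 0) \<noteq> 0}"
    by (rule finite_subset[of _ "{..<n_unc I}"]) auto
  then show ?thesis
    by (simp add: vertex_point_def)
qed

text \<open>The cut-off \<open>m\<close> lets the partial sums serve as the successive values of a
  cell in the loop that accumulates them; \<open>m = n_unc I\<close> gives the full value.\<close>

definition affine_upto :: "(nat \<Rightarrow> 'a::comm_semiring_1) \<Rightarrow> (nat \<Rightarrow> 'a) \<Rightarrow> nat \<Rightarrow> 'a" where
  "affine_upto a w m = a 0 + (\<Sum>l<m. a (Suc l) * w l)"

text \<open>A deterministic matrix is constant on the polytope only: its affine coefficients need
  not vanish if the polytope is not full-dimensional. Its value is therefore read off at one point,
  the vertex 0.\<close>

definition A_val :: "adapt_instance \<Rightarrow> nat \<Rightarrow> nat \<Rightarrow> rat" where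
  "A_val I r j = affine_upto (\<lambda>l. A_coef I l r j) (vert I 0) (n_unc I)"

definition B_val :: "adapt_instance \<Rightarrow> nat \<Rightarrow> nat \<Rightarrow> rat" where
  "B_val I r j = affine_upto (\<lambda>l. B_coef I l r j) (vert I 0) (n_unc I)"

definition b_val :: "adapt_instance \<Rightarrow> nat \<Rightarrow> nat \<Rightarrow> rat" where
  "b_val I v r = affine_upto (\<lambda>l. b_coef I l r) (vert I v) (n_unc I)"

lemma affine_eval_vertex_point:
  "affine_eval (n_unc I) a (vertex_point I v) = real_of_rat (affine_upto a (vert I v) (n_unc I))"
  by (simp add: affine_eval_def affine_upto_def lookup_vertex_point of_rat_add of_rat_sum of_rat_mult)

lemma b_at_vertex_point: "b_at I (vertex_point I v) r = real_of_rat (b_val I v r)"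
  by (simp add: b_at_def b_val_def affine_eval_vertex_point)

lemma affine_eval_convex_comb:
  assumes "p + q = 1"
  shows "affine_eval n a (p *\<^sub>R \<omega> + q *\<^sub>R \<omega>') = p * affine_eval n a \<omega> + q * affine_eval n a \<omega>'"
proof -
  \<comment> \<open>The weights sum to 1, so the constant term splits like the linear ones.\<close>
  have "real_of_rat (a 0) = p * real_of_rat (a 0) + q * real_of_rat (a 0)"
    using assms by (metis distrib_right mult_1)
  then show ?thesis
    by (simp add: affine_eval_def lookup_add lookup_scaleR_poly_mapping distrib_left sum.distrib
        sum_distrib_left mult.left_commute)
qed

lemma b_at_convex_comb:
  assumes "p + q = 1"
  shows "b_at I (p *\<^sub>R \<omega> + q *\<^sub>R \<omega>') r = p * b_at I \<omega> r + q * b_at I \<omega>' r"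
  using affine_eval_convex_comb[OF assms] by (simp add: b_at_def)

lemma vertex_point_in_Omega: "v < n_vert I \<Longrightarrow> vertex_point I v \<in> Omega I"
  by (auto simp: Omega_def intro: hull_inc)

lemma Omega_empty: "n_vert I = 0 \<Longrightarrow> Omega I = {}"
  by (simp add: Omega_def)

lemma A_at_deterministic:
  assumes "deterministic_A I" "\<omega> \<in> Omega I" "r < n_con I" "j < n_x I"
  shows "A_at I \<omega> r j = real_of_rat (A_val I r j)"
proof -
  have "0 < n_vert I" using assms(2) Omega_empty by (cases "n_vert I = 0") auto
  then have "A_at I \<omega> r j = A_at I (vertex_point I 0) r j"
    using assms vertex_point_in_Omega unfolding deterministic_A_def by blast
  then show ?thesis by (simp add: A_at_def A_val_def affine_eval_vertex_point)
qed

lemma B_at_deterministic: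
  assumes "deterministic_B I" "\<omega> \<in> Omega I" "r < n_con I" "j < n_y I"
  shows "B_at I \<omega> r j = real_of_rat (B_val I r j)"
proof -
  have "0 < n_vert I" using assms(2) Omega_empty by (cases "n_vert I = 0") auto
  then have "B_at I \<omega> r j = B_at I (vertex_point I 0) r j"
    using assms vertex_point_in_Omega unfolding deterministic_B_def by blast
  then show ?thesis by (simp add: B_at_def B_val_def affine_eval_vertex_point)
qed

text \<open>In the plane, the points of \<open>V1\<close> lie weakly to the right of \<alpha> and
  those of \<open>V2\<close> weakly above \<beta>. If one of the half-planes
  \<open>x \<ge> \<alpha>\<close>, \<open>y \<ge> \<beta>\<close> contains all points, its normal
  will do. Otherwise a line through \<open>(\<alpha>, \<beta>)\<close> of slope \<open>-p\<close> is
  made just steep enough for the points of \<open>V1\<close> below \<beta>; by the pairwise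
  condition it does not cut off any point of \<open>V2\<close> left of \<alpha>.\<close>

lemma separating_weights:
  fixes x y :: "'a \<Rightarrow> real"
  assumes "finite V1"
    and V1: "\<And>v. v \<in> V1 \<Longrightarrow> \<alpha> \<le> x v"
    and V2: "\<And>u. u \<in> V2 \<Longrightarrow> \<beta> \<le> y u"
    and pair: "\<And>u v. u \<in> V2 \<Longrightarrow> v \<in> V1 \<Longrightarrow> x u < \<alpha> \<Longrightarrow> y v < \<beta> \<Longrightarrow>
      (\<alpha> - x u) * (\<beta> - y v) \<le> (x v - \<alpha>) * (y u - \<beta>)"
  obtains p q where "0 \<le> p" "0 \<le> q" "0 < p + q"
    "\<And>w. w \<in> V1 \<union> V2 \<Longrightarrow> p * \<alpha> + q * \<beta> \<le> p * x w + q * y w"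
proof (cases "\<exists>u\<in>V2. x u < \<alpha>")
  case False
  then show ?thesis using V1 by (intro that[of 1 0]) (auto simp: not_less)
next
  case True
  then obtain u0 where u0: "u0 \<in> V2" "x u0 < \<alpha>" by blast
  define P where "P = {v \<in> V1. y v < \<beta>}"
  show ?thesis
  proof (cases "P = {}")
    case True
    then show ?thesis using V2 by (intro that[of 0 1]) (auto simp: not_less P_def)
  next
    case False
    \<comment> \<open>The least \<open>p\<close> for which \<open>v\<close> satisfies the inequality
      with weights \<open>p\<close> and 1, provided that \<open>\<alpha> < x v\<close>.\<close>
    define slope where "slope v = (\<beta> - y v) / (x v - \<alpha>)" for v
    have "finite P" using assms(1) by (simp add: P_def)
    define p where "p = Max (slope ` P)"
    have "p \<in> slope ` P" unfolding p_def using \<open>finite P\<close> False by (intro Max_in) auto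
    then obtain v0 where v0: "v0 \<in> P" "p = slope v0" by blast
    have max: "slope v \<le> p" if "v \<in> P" for v
      unfolding p_def using \<open>finite P\<close> that by simp
    \<comment> \<open>A point of \<open>V1\<close> vertically below
      \<open>(\<alpha>, \<beta>)\<close> would require an infinite slope. Together with
      \<open>u0\<close> it violates the pairwise condition.\<close>
    have pos: "\<alpha> < x v" if "v \<in> P" for v
    proof (rule ccontr)
      assume "\<not> \<alpha> < x v"
      with that V1[of v] have "x v = \<alpha>" by (auto simp: P_def)
      with pair[OF u0(1) _ u0(2), of v] that have "(\<alpha> - x u0) * (\<beta> - y v) \<le> 0" by (auto simp: P_def)
      moreover have "(\<alpha> - x u0) * (\<beta> - y v) > 0" using u0 that by (auto simp: P_def)
      ultimately show False by simp
    qed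
    have "0 < p" using v0 pos[OF v0(1)] by (auto simp: slope_def P_def)
    show ?thesis
    proof (rule that[of p 1])
      fix w assume "w \<in> V1 \<union> V2"
      then consider "w \<in> P" | "\<alpha> \<le> x w" "\<beta> \<le> y w" | "w \<in> V2" "x w < \<alpha>"
        using V1 V2 by (force simp: P_def not_less)
      then have "\<beta> - y w \<le> p * (x w - \<alpha>)"
      proof cases
        case 1
        then show ?thesis using max[OF 1] pos[OF 1] by (simp add: slope_def field_simps)
      next
        case 2
        then have "0 \<le> p * (x w - \<alpha>)" using \<open>0 < p\<close> by simp
        then show ?thesis using 2 by linarith
      next
        case 3
        \<comment> \<open>Only the point \<open>v0\<close> attaining the maximal slope has to be
          compared with \<open>w\<close>.\<close>
        have "(\<alpha> - x w) * (\<beta> - y v0) \<le> (x v0 - \<alpha>) * (y w - \<beta>)"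
          using pair[OF 3(1) _ 3(2), of v0] v0 by (auto simp: P_def)
        then have "(\<alpha> - x w) * (\<beta> - y v0) / (x v0 - \<alpha>) \<le> y w - \<beta>"
          using pos[OF v0(1)] by (simp add: pos_divide_le_eq mult.commute)
        then have "(\<alpha> - x w) * p \<le> y w - \<beta>" by (simp add: v0(2) slope_def)
        then show ?thesis by (simp add: algebra_simps)
      qed
      then show "p * \<alpha> + 1 * \<beta> \<le> p * x w + 1 * y w" by (simp add: algebra_simps)
    qed (use \<open>0 < p\<close> in auto)
  qed
qed

text \<open>Moving from \<open>u\<close> to \<open>v\<close>, the second coordinate is below \<beta>
  exactly after the parameter \<open>lo\<close>, the first is below \<alpha> exactly before
  \<open>hi\<close>. The assumption \<open>line\<close> is \<open>lo < hi\<close> with the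
  denominators cleared, so the midpoint of \<open>lo\<close> and \<open>hi\<close> works.\<close>

lemma segment_meets_quadrant:
  fixes xu xv yu yv \<alpha> \<beta> :: real
  assumes "\<alpha> \<le> xv" "\<beta> \<le> yu" "xu < xv" "yv < yu"
    and line: "\<alpha> * (yu - yv) + \<beta> * (xv - xu) > xv * yu - xu * yv"
  obtains q where "0 \<le> q" "q \<le> 1" "(1 - q) * xu + q * xv < \<alpha>" "(1 - q) * yu + q * yv < \<beta>"
proof -
  define lo hi where "lo = (yu - \<beta>) / (yu - yv)" and "hi = (\<alpha> - xu) / (xv - xu)"
  have "lo < hi"
    unfolding lo_def hi_def using assms by (simp add: divide_simps) (simp add: algebra_simps)
  have "0 \<le> lo" using assms by (simp add: lo_def)
  have "hi \<le> 1" using assms by (simp add: hi_def)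
  define q where "q = (lo + hi) / 2"
  have q: "lo < q" "q < hi" using \<open>lo < hi\<close> by (auto simp: q_def)
  have "yu - \<beta> < q * (yu - yv)" using q(1) assms by (simp add: lo_def divide_simps)
  moreover have "q * (xv - xu) < \<alpha> - xu" using q(2) assms by (simp add: hi_def divide_simps)
  ultimately show ?thesis
    using q \<open>0 \<le> lo\<close> \<open>hi \<le> 1\<close> by (intro that[of q]) (auto simp: algebra_simps)
qed

text \<open>
  The rows of the linear program of a labelling \<open>lab\<close> of the vertices (false: the vertex is covered
  by \<open>y\<^sub>1\<close>, true: by \<open>y\<^sub>2\<close>) are indexed by two vertices \<open>u\<close>, \<open>v\<close> and two constraints \<open>r\<close>, \<open>s\<close>. Writing
  \<open>\<alpha>\<close>, \<open>\<beta>\<close> for the left-hand sides of the constraint \<open>r\<close> for \<open>y\<^sub>1\<close> and of the constraint \<open>s\<close> for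
  \<open>y\<^sub>2\<close>, the row is \<open>row_p * \<alpha> + row_q * \<beta> \<le> row_rhs\<close>. For \<open>u = v\<close> it says that the vertex is
  covered as prescribed; for a pair in conflict, that \<open>(\<alpha>, \<beta>)\<close> is not above the line through the
  images of \<open>u\<close> and \<open>v\<close> under \<open>(b\<^sub>r, b\<^sub>s)\<close>; otherwise it is void.
\<close>

definition conflict :: "adapt_instance \<Rightarrow> (nat \<Rightarrow> bool) \<Rightarrow> nat \<Rightarrow> nat \<Rightarrow> nat \<Rightarrow> nat \<Rightarrow> bool" where
  "conflict I lab u v r s \<longleftrightarrow>
     lab u \<and> \<not> lab v \<and> b_val I u r < b_val I v r \<and> b_val I v s < b_val I u s"

definition row_p :: "adapt_instance \<Rightarrow> (nat \<Rightarrow> bool) \<Rightarrow> nat \<Rightarrow> nat \<Rightarrow> nat \<Rightarrow> nat \<Rightarrow> rat" where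
  "row_p I lab u v r s =
     (if u = v then if lab u then 0 else 1
      else if conflict I lab u v r s then b_val I u s - b_val I v s else 0)"

definition row_q :: "adapt_instance \<Rightarrow> (nat \<Rightarrow> bool) \<Rightarrow> nat \<Rightarrow> nat \<Rightarrow> nat \<Rightarrow> nat \<Rightarrow> rat" where
  "row_q I lab u v r s =
     (if u = v then if lab u then 1 else 0
      else if conflict I lab u v r s then b_val I v r - b_val I u r else 0)"

definition row_rhs :: "adapt_instance \<Rightarrow> (nat \<Rightarrow> bool) \<Rightarrow> nat \<Rightarrow> nat \<Rightarrow> nat \<Rightarrow> nat \<Rightarrow> rat" where
  "row_rhs I lab u v r s =
     (if u = v then if lab u then b_val I u s else b_val I u r
      else if conflict I lab u v r s
      then b_val I v r * b_val I u s - b_val I u r * b_val I v s else 0)"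

definition left_side :: "adapt_instance \<Rightarrow> (nat \<Rightarrow> real) \<Rightarrow> (nat \<Rightarrow> real) \<Rightarrow> nat \<Rightarrow> real" where
  "left_side I x y r =
     (\<Sum>j<n_x I. real_of_rat (A_val I r j) * x j) + (\<Sum>j<n_y I. real_of_rat (B_val I r j) * y j)"

definition label_feasible ::
  "adapt_instance \<Rightarrow> (nat \<Rightarrow> bool) \<Rightarrow> (nat \<Rightarrow> real) \<Rightarrow> (nat \<Rightarrow> nat \<Rightarrow> real) \<Rightarrow> bool" where
  "label_feasible I lab x y \<longleftrightarrow>
     (\<forall>j<n_x I. int_x I j \<longrightarrow> x j \<in> \<int>) \<and>
     (\<forall>i<2. \<forall>j<n_y I. int_y I j \<longrightarrow> y i j \<in> \<int>) \<and>
     (\<forall>u<n_vert I. \<forall>v<n_vert I. \<forall>r<n_con I. \<forall>s<n_con I.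
        real_of_rat (row_p I lab u v r s) * left_side I x (y 0) r
        + real_of_rat (row_q I lab u v r s) * left_side I x (y 1) s
        \<le> real_of_rat (row_rhs I lab u v r s))"

section \<open>Feasible covers and labelled row conditions\<close>

lemma left_side_at:
  assumes "deterministic_A I" "deterministic_B I" "\<omega> \<in> Omega I" "r < n_con I"
  shows "(\<Sum>j<n_x I. A_at I \<omega> r j * x j) + (\<Sum>j<n_y I. B_at I \<omega> r j * y j) = left_side I x y r"
  using A_at_deterministic[OF assms(1,3,4)] B_at_deterministic[OF assms(2,3,4)]
  by (simp add: left_side_def)

text \<open>The cover has to be constructed from \<open>x\<close> and \<open>y\<close> alone, so
  each piece is taken as large as its inequalities permit. A point in neither piece violates some
  row \<open>r\<close> with \<open>y 0\<close> and some row \<open>s\<close> with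
  \<open>y 1\<close>, which puts its image into the quadrant that the halfspace avoids.\<close>

lemma label_feasible_imp_adapt_feasible:
  assumes det: "deterministic_A I" "deterministic_B I" and feas: "label_feasible I lab x y"
  shows "\<exists>Om. adapt_feasible I 2 Om x y"
proof -
  define Om where "Om i = {\<omega> \<in> Omega I. \<forall>r<n_con I. left_side I x (y i) r \<le> b_at I \<omega> r}" for i
  let ?b = "\<lambda>v r. real_of_rat (b_val I v r)"
  have row: "real_of_rat (row_p I lab u v r s) * left_side I x (y 0) r
        + real_of_rat (row_q I lab u v r s) * left_side I x (y 1) s
        \<le> real_of_rat (row_rhs I lab u v r s)"
    if "u < n_vert I" "v < n_vert I" "r < n_con I" "s < n_con I" for u v r s
    using feas that unfolding label_feasible_def by blast
  have "\<omega> \<in> Om 0 \<union> Om 1" if \<omega>: "\<omega> \<in> Omega I" for \<omega>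
  proof (rule ccontr)
    assume "\<omega> \<notin> Om 0 \<union> Om 1"
    with \<omega> obtain r s where rs: "r < n_con I" "s < n_con I"
      "b_at I \<omega> r < left_side I x (y 0) r" "b_at I \<omega> s < left_side I x (y 1) s"
      by (auto simp: Om_def not_le)
    define \<alpha> \<beta> where "\<alpha> = left_side I x (y 0) r" and "\<beta> = left_side I x (y 1) s"
    define V1 V2 where "V1 = {v. v < n_vert I \<and> \<not> lab v}" and "V2 = {v. v < n_vert I \<and> lab v}"
    have 1: "\<alpha> \<le> ?b v r" if "v \<in> V1" for v
      using row[of v v r s] that rs by (simp add: V1_def row_p_def row_q_def row_rhs_def \<alpha>_def)
    have 2: "\<beta> \<le> ?b u s" if "u \<in> V2" for u
      using row[of u u r s] that rs by (simp add: V2_def row_p_def row_q_def row_rhs_def \<beta>_def)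
    have 3: "(\<alpha> - ?b u r) * (\<beta> - ?b v s) \<le> (?b v r - \<alpha>) * (?b u s - \<beta>)"
      if "u \<in> V2" "v \<in> V1" "?b u r < \<alpha>" "?b v s < \<beta>" for u v
    proof -
      \<comment> \<open>The pairs for which the separation requires a condition are in conflict:
        \<open>u\<close> lies left of \<alpha> and \<open>v\<close> does not, \<open>v\<close> lies
        below \<beta> and \<open>u\<close> does not. The void rows of the other pairs thus lose
        nothing.\<close>
      have "?b u r < ?b v r" "?b v s < ?b u s" using 1 2 that by force+
      then have "conflict I lab u v r s"
        using that by (simp add: conflict_def V1_def V2_def of_rat_less)
      moreover have "u \<noteq> v" using that by (auto simp: V1_def V2_def)
      ultimately have "(?b u s - ?b v s) * \<alpha> + (?b v r - ?b u r) * \<beta>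
          \<le> ?b v r * ?b u s - ?b u r * ?b v s"
        using row[of u v r s] that rs
        by (simp add: V1_def V2_def row_p_def row_q_def row_rhs_def \<alpha>_def \<beta>_def of_rat_diff of_rat_mult)
      then show ?thesis by (simp add: algebra_simps)
    qed
    have "finite V1" by (simp add: V1_def)
    obtain p q where pq: "0 \<le> p" "0 \<le> q" "0 < p + q"
      "\<And>w. w \<in> V1 \<union> V2 \<Longrightarrow> p * \<alpha> + q * \<beta> \<le> p * ?b w r + q * ?b w s"
      by (rule separating_weights[of V1 \<alpha> "\<lambda>v. ?b v r" V2 \<beta> "\<lambda>v. ?b v s"])
        (use \<open>finite V1\<close> 1 2 3 in auto)
    \<comment> \<open>The preimage of the half-plane under an affine map; being convex, it contains
      the hull of the vertices as soon as it contains the vertices.\<close>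
    define H where "H = {\<omega>. p * \<alpha> + q * \<beta> \<le> p * b_at I \<omega> r + q * b_at I \<omega> s}"
    have "convex H"
    proof (rule convexI)
      fix \<omega>1 \<omega>2 and c d :: real
      assume "\<omega>1 \<in> H" "\<omega>2 \<in> H" and cd: "0 \<le> c" "0 \<le> d" "c + d = 1"
      then have in_H: "p * \<alpha> + q * \<beta> \<le> p * b_at I \<omega>1 r + q * b_at I \<omega>1 s"
        "p * \<alpha> + q * \<beta> \<le> p * b_at I \<omega>2 r + q * b_at I \<omega>2 s" by (auto simp: H_def)
      have "c * (p * \<alpha> + q * \<beta>) + d * (p * \<alpha> + q * \<beta>)
        \<le> c * (p * b_at I \<omega>1 r + q * b_at I \<omega>1 s) + d * (p * b_at I \<omega>2 r + q * b_at I \<omega>2 s)"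
        by (rule add_mono[OF mult_left_mono[OF in_H(1) cd(1)] mult_left_mono[OF in_H(2) cd(2)]])
      moreover have "c * (p * \<alpha> + q * \<beta>) + d * (p * \<alpha> + q * \<beta>) = p * \<alpha> + q * \<beta>"
        using cd by (metis distrib_right mult_1)
      ultimately show "c *\<^sub>R \<omega>1 + d *\<^sub>R \<omega>2 \<in> H"
        using cd by (simp add: H_def b_at_convex_comb algebra_simps)
    qed
    moreover have "vertex_point I ` {..<n_vert I} \<subseteq> H"
      using pq(4) by (auto simp: H_def V1_def V2_def b_at_vertex_point)
    ultimately have "Omega I \<subseteq> H" unfolding Omega_def by (rule hull_minimal[rotated])
    with \<omega> have "p * \<alpha> + q * \<beta> \<le> p * b_at I \<omega> r + q * b_at I \<omega> s" by (auto simp: H_def)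
    \<comment> \<open>At least one weight is positive, and the strict inequality comes from the
      corresponding coordinate.\<close>
    moreover have "p * b_at I \<omega> r + q * b_at I \<omega> s < p * \<alpha> + q * \<beta>"
    proof (cases "p = 0")
      case True
      then show ?thesis using pq rs by (simp add: \<beta>_def)
    next
      case False
      then have "p * b_at I \<omega> r < p * \<alpha>" using pq rs by (simp add: \<alpha>_def)
      moreover have "q * b_at I \<omega> s \<le> q * \<beta>" using pq rs by (simp add: \<beta>_def mult_left_mono)
      ultimately show ?thesis by simp
    qed
    ultimately show False by simp
  qed
  then have "Om 0 \<union> Om 1 = Omega I" by (auto simp: Om_def)
  then have "(\<Union>i<2. Om i) = Omega I" by (simp add: numeral_2_eq_2 lessThan_Suc Un_commute)
  moreover have "(\<Sum>j<n_x I. A_at I \<omega> r j * x j) + (\<Sum>j<n_y I. B_at I \<omega> r j * y i j) \<le> b_at I \<omega> r"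
    if "\<omega> \<in> Om i" "r < n_con I" for i \<omega> r
    using that left_side_at[OF det, of \<omega> r x "y i"] by (simp add: Om_def)
  ultimately show ?thesis
    using feas unfolding adapt_feasible_def label_feasible_def by blast
qed

text \<open>A vertex lying in both pieces is labelled false, so two labels suffice; a vertex
  labelled true is outside \<open>Om 0\<close> and hence in \<open>Om 1\<close>. If the row of a
  conflicting pair failed, the segment between the two vertices would contain a point in neither
  piece.\<close>

lemma adapt_feasible_imp_label_feasible:
  assumes det: "deterministic_A I" "deterministic_B I" and feas: "adapt_feasible I 2 Om x y"
  shows "label_feasible I (\<lambda>v. vertex_point I v \<notin> Om 0) x y"
proof -
  let ?b = "\<lambda>v r. real_of_rat (b_val I v r)" and ?lab = "\<lambda>v. vertex_point I v \<notin> Om 0"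
  have cover: "Om 0 \<union> Om 1 = Omega I"
    using feas unfolding adapt_feasible_def by (auto simp: numeral_2_eq_2 lessThan_Suc)
  have le: "left_side I x (y i) r \<le> b_at I \<omega> r" if "\<omega> \<in> Om i" "r < n_con I" "i < 2" for \<omega> i r
  proof -
    have "\<omega> \<in> Omega I" using feas that unfolding adapt_feasible_def by blast
    then show ?thesis
      using feas that left_side_at[OF det, of \<omega> r x "y i"] unfolding adapt_feasible_def by metis
  qed
  have row: "real_of_rat (row_p I ?lab u v r s) * left_side I x (y 0) r
        + real_of_rat (row_q I ?lab u v r s) * left_side I x (y 1) s
        \<le> real_of_rat (row_rhs I ?lab u v r s)"
    if uv: "u < n_vert I" "v < n_vert I" and rs: "r < n_con I" "s < n_con I" for u v r s
  proof -
    define \<alpha> \<beta> where "\<alpha> = left_side I x (y 0) r" and "\<beta> = left_side I x (y 1) s"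
    have 0: "\<alpha> \<le> ?b w r" if "w < n_vert I" "\<not> ?lab w" for w
      using le[of "vertex_point I w" 0 r] that rs by (simp add: b_at_vertex_point \<alpha>_def)
    have 1: "\<beta> \<le> ?b w s" if "w < n_vert I" "?lab w" for w
    proof -
      have "vertex_point I w \<in> Om 1" using that vertex_point_in_Omega[of w I] cover by blast
      then show ?thesis using le[of "vertex_point I w" 1 s] rs by (simp add: b_at_vertex_point \<beta>_def)
    qed
    consider "u = v" | "u \<noteq> v" "\<not> conflict I ?lab u v r s" | "u \<noteq> v" "conflict I ?lab u v r s"
      by blast
    then show ?thesis
    proof cases
      case 1
      then show ?thesis using 0[of u] \<open>\<And>w. w < n_vert I \<Longrightarrow> ?lab w \<Longrightarrow> \<beta> \<le> ?b w s\<close>[of u] uv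
        by (simp add: row_p_def row_q_def row_rhs_def \<alpha>_def \<beta>_def)
    next
      case 2
      then show ?thesis by (simp add: row_p_def row_q_def row_rhs_def)
    next
      case 3
      then have c: "?lab u" "\<not> ?lab v" "?b u r < ?b v r" "?b v s < ?b u s"
        by (auto simp: conflict_def of_rat_less)
      have "\<alpha> * (?b u s - ?b v s) + \<beta> * (?b v r - ?b u r) \<le> ?b v r * ?b u s - ?b u r * ?b v s"
      proof (rule ccontr)
        assume "\<not> ?thesis"
        then obtain q where q: "0 \<le> q" "q \<le> 1" "(1 - q) * ?b u r + q * ?b v r < \<alpha>"
          "(1 - q) * ?b u s + q * ?b v s < \<beta>"
          using segment_meets_quadrant[OF 0[OF uv(2) c(2)] 1[OF uv(1) c(1)] c(3,4)] by (metis not_le)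
        define \<omega> where "\<omega> = (1 - q) *\<^sub>R vertex_point I u + q *\<^sub>R vertex_point I v"
        have "\<omega> \<in> Omega I"
          unfolding \<omega>_def using vertex_point_in_Omega uv q
          by (intro convexD) (auto simp: Omega_def convex_convex_hull hull_inc)
        then have "\<omega> \<in> Om 0 \<or> \<omega> \<in> Om 1" using cover by blast
        then have "\<alpha> \<le> b_at I \<omega> r \<or> \<beta> \<le> b_at I \<omega> s"
          using le[of \<omega> 0 r] le[of \<omega> 1 s] rs by (auto simp: \<alpha>_def \<beta>_def)
        then show False
          using q(3,4) by (simp add: \<omega>_def b_at_convex_comb b_at_vertex_point)
      qed
      then show ?thesis
        using 3 by (simp add: row_p_def row_q_def row_rhs_def \<alpha>_def \<beta>_def of_rat_diff of_rat_mult
            mult.commute)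
    qed
  qed
  then show ?thesis using feas unfolding adapt_feasible_def label_feasible_def by blast
qed

section \<open>Sizes of rational numbers\<close>

text \<open>Unlike \<^const>\<open>rat_size\<close>, which does not behave additively on sums, this bound does.\<close>

definition small :: "rat \<Rightarrow> nat \<Rightarrow> bool" where
  "small r k \<longleftrightarrow> (\<exists>d::nat. 0 < d \<and> d \<le> 2 ^ k \<and> r * of_nat d \<in> \<int> \<and> \<bar>r\<bar> \<le> 2 ^ k)"

lemma small_mono: "small r k \<Longrightarrow> k \<le> k' \<Longrightarrow> small r k'"
  unfolding small_def by (meson order_trans power_increasing one_le_numeral)

text \<open>The product of the two denominators clears the sum and may be used unreduced. The extra
  1 in the exponent is for the absolute value, which is at most
  \<open>2 * 2 ^ (k + l)\<close>.\<close>

lemma small_add: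
  assumes "small a k" "small b l" shows "small (a + b) (k + l + 1)"
proof -
  obtain c d where c: "0 < c" "c \<le> 2 ^ k" "a * of_nat c \<in> \<int>" "\<bar>a\<bar> \<le> 2 ^ k"
    and d: "0 < d" "d \<le> 2 ^ l" "b * of_nat d \<in> \<int>" "\<bar>b\<bar> \<le> 2 ^ l"
    using assms unfolding small_def by blast
  have "c * d \<le> 2 ^ k * 2 ^ l" using c d by (intro mult_mono) auto
  also have "\<dots> \<le> 2 ^ (k + l + 1)" by (simp add: power_add)
  finally have "c * d \<le> 2 ^ (k + l + 1)" .
  moreover have "(a + b) * of_nat (c * d) = (a * of_nat c) * of_nat d + (b * of_nat d) * of_nat c"
    by (simp add: algebra_simps)
  then have "(a + b) * of_nat (c * d) \<in> \<int>"
    using c d by (metis Ints_add Ints_mult Ints_of_nat)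
  moreover have "\<bar>a + b\<bar> \<le> 2 ^ (k + l + 1)"
  proof -
    have "(2::rat) ^ k \<le> 2 ^ (k + l)" "(2::rat) ^ l \<le> 2 ^ (k + l)" by (auto intro: power_increasing)
    moreover have "(2::rat) ^ (k + l + 1) = 2 * 2 ^ (k + l)" by simp
    ultimately show ?thesis using c(4) d(4) abs_triangle_ineq[of a b] by linarith
  qed
  ultimately show ?thesis
    unfolding small_def using c d by (intro exI[of _ "c * d"]) auto
qed

lemma small_mult:
  assumes "small a k" "small b l" shows "small (a * b) (k + l)"
proof -
  obtain c d where c: "0 < c" "c \<le> 2 ^ k" "a * of_nat c \<in> \<int>" "\<bar>a\<bar> \<le> 2 ^ k"
    and d: "0 < d" "d \<le> 2 ^ l" "b * of_nat d \<in> \<int>" "\<bar>b\<bar> \<le> 2 ^ l"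
    using assms unfolding small_def by blast
  have "c * d \<le> 2 ^ (k + l)" using c d unfolding power_add by (intro mult_mono) auto
  moreover have "a * b * of_nat (c * d) = (a * of_nat c) * (b * of_nat d)"
    by (simp add: algebra_simps)
  then have "a * b * of_nat (c * d) \<in> \<int>"
    using c d by (metis Ints_mult)
  moreover have "\<bar>a * b\<bar> \<le> 2 ^ (k + l)"
    unfolding abs_mult power_add using c d by (intro mult_mono) auto
  ultimately show ?thesis
    unfolding small_def using c d by (intro exI[of _ "c * d"]) auto
qed

lemma small_uminus: "small a k \<Longrightarrow> small (- a) k"
  by (auto simp: small_def)

lemma small_diff: "small a k \<Longrightarrow> small b l \<Longrightarrow> small (a - b) (k + l + 1)"
  using small_add[of a k "- b" l] by (simp add: small_uminus)

lemma small_0: "small 0 k" and small_1: "small 1 k"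
  by (auto simp: small_def intro!: exI[of _ 1])

lemma small_of_nat: "n \<le> 2 ^ k \<Longrightarrow> small (of_nat n) k"
  unfolding small_def
  by (intro exI[of _ 1]) (metis (no_types, lifting) Ints_of_nat abs_of_nat mult_1_right of_nat_1 of_nat_le_iff
      of_nat_numeral of_nat_power one_le_numeral one_le_power zero_less_one)

text \<open>Each addition costs one bit besides those of the summand, whence \<open>k + 1\<close>
  per term.\<close>

lemma small_sum:
  fixes f :: "nat \<Rightarrow> rat"
  assumes "\<And>i. i < n \<Longrightarrow> small (f i) k"
  shows "small (\<Sum>i<n. f i) (n * (k + 1))"
  using assms
proof (induction n)
  case (Suc n)
  from small_add[OF Suc.IH Suc.prems[of n]] Suc.prems show ?case
    by (simp add: add.commute add.left_commute)
qed (simp add: small_0)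

lemma small_rat_size: "small r (rat_size r)"
proof -
  obtain a b where ab: "quotient_of r = (a, b)" by force
  have "b > 0" using quotient_of_denom_pos[OF ab] .
  have r: "r = of_int a / of_int b" using quotient_of_div[OF ab] .
  have s: "rat_size r = 1 + floorlog 2 (nat \<bar>a\<bar>) + floorlog 2 (nat b)"
    by (simp add: rat_size_def ab)
  have A: "nat \<bar>a\<bar> \<le> 2 ^ rat_size r"
    using floorlog_leD[of 2 "nat \<bar>a\<bar>" "rat_size r"] s by simp
  have B: "nat b \<le> 2 ^ rat_size r"
    using floorlog_leD[of 2 "nat b" "rat_size r"] s by simp
  have "r * of_nat (nat b) = of_int a" using \<open>b > 0\<close> r by simp
  moreover have "\<bar>r\<bar> \<le> 2 ^ rat_size r"
  proof -
    have "\<bar>r\<bar> = \<bar>of_int a\<bar> / of_int b" using r \<open>b > 0\<close> by simp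
    also have "\<dots> \<le> \<bar>of_int a\<bar>" using \<open>b > 0\<close> mult_left_mono[of 1 "of_int b" "\<bar>of_int a\<bar> :: rat"] by (simp add: divide_le_eq)
    also have "\<dots> = of_nat (nat \<bar>a\<bar>)" by simp
    also have "\<dots> \<le> 2 ^ rat_size r" using A by (metis of_nat_le_iff of_nat_numeral of_nat_power)
    finally show ?thesis .
  qed
  ultimately show ?thesis
    unfolding small_def using B \<open>b > 0\<close> by (intro exI[of _ "nat b"]) auto
qed

text \<open>The reduced denominator divides every \<open>d\<close> that clears \<open>r\<close>, so
  it is at most \<open>2 ^ k\<close>; the numerator is, up to sign, \<open>\<bar>r\<bar>\<close>
  times it, hence at most \<open>2 ^ (2 * k)\<close>. The sign and one extra bit for each of the two
  binary lengths make up the constant 3.\<close>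

lemma rat_size_le:
  assumes "small r k" shows "rat_size r \<le> 3 * k + 3"
proof -
  obtain a b where ab: "quotient_of r = (a, b)" by force
  have "b > 0" using quotient_of_denom_pos[OF ab] .
  have r: "r = of_int a / of_int b" using quotient_of_div[OF ab] .
  obtain d where d: "0 < d" "d \<le> 2 ^ k" "r * of_nat d \<in> \<int>" "\<bar>r\<bar> \<le> 2 ^ k"
    using assms unfolding small_def by blast
  obtain m where "r * of_nat d = of_int m" using d(3) Ints_cases by metis
  then have "of_int (a * int d) = (of_int (m * b) :: rat)" using r \<open>b > 0\<close> by (simp add: field_simps)
  then have "a * int d = m * b" by (simp only: of_int_eq_iff)
  then have "b dvd a * int d" by simp
  then have "b dvd int d" using quotient_of_coprime[OF ab]
    by (simp add: coprime_commute coprime_dvd_mult_right_iff)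
  then have "b \<le> int d" using d(1) by (simp add: zdvd_imp_le)
  then have B: "nat b \<le> 2 ^ k" using d(2) by linarith
  have "\<bar>of_int a\<bar> = \<bar>r\<bar> * of_int b" using r \<open>b > 0\<close> by simp
  also have "\<dots> \<le> 2 ^ k * 2 ^ k"
  proof (intro mult_mono d(4))
    have "of_int b = (of_nat (nat b) :: rat)" using \<open>b > 0\<close> by simp
    also have "\<dots> \<le> 2 ^ k" using B by (metis of_nat_le_iff of_nat_numeral of_nat_power)
    finally show "of_int b \<le> (2 ^ k :: rat)" .
  qed (use \<open>b > 0\<close> in auto)
  finally have "of_nat (nat \<bar>a\<bar>) \<le> (of_nat (2 ^ (2 * k)) :: rat)" by (simp add: power_add mult_2)
  then have A: "nat \<bar>a\<bar> \<le> 2 ^ (2 * k)" by (simp only: of_nat_le_iff)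
  have "floorlog 2 (nat \<bar>a\<bar>) \<le> 2 * k + 1"
    using le_less_trans[OF A, of "2 ^ (2 * k + 1)"] by (intro floorlog_leI) auto
  moreover have "floorlog 2 (nat b) \<le> k + 1"
    using le_less_trans[OF B, of "2 ^ (k + 1)"] by (intro floorlog_leI) auto
  ultimately show ?thesis by (simp add: rat_size_def ab)
qed

section \<open>Loops with time bounds\<close>

definition set_cell :: "string \<Rightarrow> nat list \<Rightarrow> rat \<Rightarrow> store \<Rightarrow> store" where
  "set_cell a ix r s = s(a := (s a)(ix := r))"

lemma set_cell_apply: "set_cell a ix r s b = (if b = a then (s a)(ix := r) else s b)"
  by (simp add: set_cell_def)

text \<open>Here \<open>X\<close> plays the part of the modified variables in a frame rule.\<close>

definition agree :: "string set \<Rightarrow> store \<Rightarrow> store \<Rightarrow> bool" where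
  "agree X s s' \<longleftrightarrow> (\<forall>a. a \<notin> X \<longrightarrow> s' a = s a)"

lemma agree_refl: "agree X s s"
  by (simp add: agree_def)

lemma agree_trans: "agree X s s' \<Longrightarrow> agree X s' s'' \<Longrightarrow> agree X s s''"
  by (simp add: agree_def)

lemma agree_mono: "agree X s s' \<Longrightarrow> X \<subseteq> Y \<Longrightarrow> agree Y s s'"
  by (auto simp: agree_def)

lemma agree_set_cell: "agree X s s' \<Longrightarrow> a \<in> X \<Longrightarrow> agree X s (set_cell a ix r s')"
  by (auto simp: agree_def set_cell_apply)

text \<open>Total correctness with a time bound, for commands that make no call of the solver; those
  that do are handled with \<open>exec\<close> itself.\<close>

definition runs ::
  "(lin_prog \<Rightarrow> lp_answer) \<Rightarrow> com \<Rightarrow> store \<Rightarrow> nat \<Rightarrow> (store \<Rightarrow> bool) \<Rightarrow> bool" where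
  "runs solver c s T R \<longleftrightarrow> (\<exists>t s'. exec solver c s t [] s' \<and> t \<le> T \<and> R s')"

lemma runs_weaken: "runs solver c s T R \<Longrightarrow> T \<le> T' \<Longrightarrow> (\<And>s'. R s' \<Longrightarrow> R' s') \<Longrightarrow> runs solver c s T' R'"
  unfolding runs_def by (meson order_trans)

lemma runs_Skip: "R s \<Longrightarrow> runs solver Skip s 1 R"
  unfolding runs_def using exec_Skip by blast

lemma runs_Assign:
  assumes "R (set_cell a (map (\<lambda>e. nat \<lfloor>eval e s\<rfloor>) es) (eval e s) s)"
  shows "runs solver (Assign a es e) s (1 + rat_size (eval e s)) R"
  unfolding runs_def using assms exec_Assign[of solver a es e s] unfolding set_cell_def by blast

lemma runs_Seq:
  assumes "runs solver c1 s T1 R1" and "\<And>s'. R1 s' \<Longrightarrow> runs solver c2 s' T2 R2"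
  shows "runs solver (Seq c1 c2) s (T1 + T2) R2"
proof -
  obtain t1 s1 where 1: "exec solver c1 s t1 [] s1" "t1 \<le> T1" "R1 s1"
    using assms(1) unfolding runs_def by blast
  obtain t2 s2 where 2: "exec solver c2 s1 t2 [] s2" "t2 \<le> T2" "R2 s2"
    using assms(2)[OF 1(3)] unfolding runs_def by blast
  show ?thesis
    unfolding runs_def using exec_Seq[OF 1(1) 2(1)] 1 2 by (intro exI[of _ "t1 + t2"]) auto
qed

lemma runs_Cond:
  assumes "eval e s \<noteq> 0 \<Longrightarrow> runs solver c1 s T R" and "eval e s = 0 \<Longrightarrow> runs solver c2 s T R"
  shows "runs solver (Cond e c1 c2) s (1 + T) R"
  using assms exec_CondTrue[of e s solver c1] exec_CondFalse[of e s solver c2]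
  unfolding runs_def by (cases "eval e s = 0") (meson add_left_mono)+

text \<open>Expressions offer only a weak comparison, so \<open>i < e\<close> is tested as
  \<open>i + 1 \<le> e\<close>. The bound \<open>e\<close> is evaluated anew before each
  round.\<close>

definition For :: "string \<Rightarrow> expr \<Rightarrow> com \<Rightarrow> com" where
  "For i e c =
     Seq (Assign i [] (Num 0))
       (While (Leq (Plus (Cell i []) (Num 1)) e)
         (Seq c (Assign i [] (Plus (Cell i []) (Num 1)))))"

text \<open>The invariant sees the exact time and the list of calls so far, because the time bound
  of a loop that calls the solver depends on the answers received. Besides its body, a round pays
  for the test and the increment, which gives \<open>2 + rat_size (of_nat (Suc k))\<close>; the
  final \<open>+ 1\<close> is the failing test.\<close>

lemma exec_For:
  fixes Inv :: "nat \<Rightarrow> nat \<Rightarrow> lin_prog list \<Rightarrow> store \<Rightarrow> bool"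
  assumes bound: "\<And>k t Q s. k \<le> n \<Longrightarrow> Inv k t Q s \<Longrightarrow> eval e s = of_nat n"
    and counter: "\<And>k t Q s. k \<le> n \<Longrightarrow> Inv k t Q s \<Longrightarrow> s i [] = of_nat k"
    and init: "Inv 0 (1 + rat_size 0) [] (set_cell i [] 0 s)"
    and step: "\<And>k t Q s. k < n \<Longrightarrow> Inv k t Q s \<Longrightarrow>
      \<exists>t' Q' s'. exec solver c s t' Q' s' \<and> s' i [] = of_nat k \<and>
        Inv (Suc k) (t + t' + 2 + rat_size (of_nat (Suc k))) (Q @ Q')
          (set_cell i [] (of_nat (Suc k)) s')"
  shows "\<exists>t Q s'. exec solver (For i e c) s (t + 1) Q s' \<and> Inv n t Q s'"
proof -
  let ?W = "While (Leq (Plus (Cell i []) (Num 1)) e)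
         (Seq c (Assign i [] (Plus (Cell i []) (Num 1))))"
  have loop: "\<exists>t' Q' s'. exec solver ?W s (t' + 1) Q' s' \<and> Inv n (t + t') (Q @ Q') s'"
    if "k \<le> n" "Inv k t Q s" for k t Q s
    using that
  proof (induction "n - k" arbitrary: k t Q s)
    case 0
    then have "k = n" by simp
    have "eval (Leq (Plus (Cell i []) (Num 1)) e) s = 0"
      using bound[OF 0(2,3)] counter[OF 0(2,3)] \<open>k = n\<close> by simp
    then have "exec solver ?W s 1 [] s" by (rule exec_WhileFalse)
    then show ?case using 0 \<open>k = n\<close>
      by (intro exI[of _ 0] exI[of _ "[]"] exI[of _ s]) auto
  next
    case (Suc m)
    then have "k < n" by simp
    have "of_nat k + 1 \<le> (of_nat n :: rat)"
      using \<open>k < n\<close> by (metis Suc_leI add.commute of_nat_Suc of_nat_le_iff)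
    then have cond: "eval (Leq (Plus (Cell i []) (Num 1)) e) s \<noteq> 0"
      using bound[OF Suc(3,4)] counter[OF Suc(3,4)] by simp
    obtain t1 Q1 s1 where 1: "exec solver c s t1 Q1 s1" "s1 i [] = of_nat k"
      "Inv (Suc k) (t + t1 + 2 + rat_size (of_nat (Suc k))) (Q @ Q1)
          (set_cell i [] (of_nat (Suc k)) s1)"
      using step[OF \<open>k < n\<close> Suc(4)] by blast
    have "eval (Plus (Cell i []) (Num 1)) s1 = of_nat (Suc k)" using 1(2) by simp
    then have "exec solver (Assign i [] (Plus (Cell i []) (Num 1))) s1
        (1 + rat_size (of_nat (Suc k))) [] (set_cell i [] (of_nat (Suc k)) s1)"
      using exec_Assign[of solver i "[]" "Plus (Cell i []) (Num 1)" s1]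
      by (simp add: set_cell_def del: eval.simps of_nat_Suc)
    from exec_Seq[OF 1(1) this]
    have body: "exec solver (Seq c (Assign i [] (Plus (Cell i []) (Num 1)))) s
        (t1 + (1 + rat_size (of_nat (Suc k)))) Q1 (set_cell i [] (of_nat (Suc k)) s1)"
      by simp
    obtain t2 Q2 s2 where 2: "exec solver ?W (set_cell i [] (of_nat (Suc k)) s1) (t2 + 1) Q2 s2"
      "Inv n (t + t1 + 2 + rat_size (of_nat (Suc k)) + t2) ((Q @ Q1) @ Q2) s2"
      using Suc.hyps(1)[OF _ _ 1(3)] Suc.hyps(2) \<open>k < n\<close> by force
    from exec_WhileTrue[OF cond body 2(1)]
    have "exec solver ?W s (t1 + 2 + rat_size (of_nat (Suc k)) + t2 + 1) (Q1 @ Q2) s2"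
      by (simp add: algebra_simps del: of_nat_Suc)
    then show ?case using 2(2)
      by (intro exI[of _ "t1 + 2 + rat_size (of_nat (Suc k)) + t2"] exI[of _ "Q1 @ Q2"] exI[of _ s2])
        (simp add: algebra_simps del: of_nat_Suc)
  qed
  obtain t Q s' where *: "exec solver ?W (set_cell i [] 0 s) (t + 1) Q s'"
    "Inv n (1 + rat_size 0 + t) ([] @ Q) s'"
    using loop[OF _ init] by auto
  have "exec solver (Assign i [] (Num 0)) s (1 + rat_size 0) [] (set_cell i [] 0 s)"
    using exec_Assign[of solver i "[]" "Num 0" s] by (simp add: set_cell_def)
  from exec_Seq[OF this *(1)]
  have "exec solver (For i e c) s ((1 + rat_size 0 + t) + 1) Q s'"
    by (simp add: For_def algebra_simps)
  then show ?thesis using *(2) by auto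
qed

text \<open>Each of the \<open>n\<close> rounds costs at most \<open>T + S + 2\<close>; one more
  such term pays for the initialization and the last test.\<close>

lemma runs_For:
  fixes Inv :: "nat \<Rightarrow> store \<Rightarrow> bool"
  assumes bound: "\<And>k s. k \<le> n \<Longrightarrow> Inv k s \<Longrightarrow> eval e s = of_nat n"
    and counter: "\<And>k s. k \<le> n \<Longrightarrow> Inv k s \<Longrightarrow> s i [] = of_nat k"
    and init: "Inv 0 (set_cell i [] 0 s)"
    and size: "\<And>k. k \<le> n \<Longrightarrow> rat_size (of_nat k) \<le> S"
    and step: "\<And>k s. k < n \<Longrightarrow> Inv k s \<Longrightarrow>
      runs solver c s T (\<lambda>s'. s' i [] = of_nat k \<and> Inv (Suc k) (set_cell i [] (of_nat (Suc k)) s'))"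
  shows "runs solver (For i e c) s ((n + 1) * (T + S + 2)) (Inv n)"
proof -
  define Inv' where "Inv' k t Q s \<longleftrightarrow> Q = [] \<and> Inv k s \<and> t \<le> 1 + S + k * (T + S + 2)"
    for k t and Q :: "lin_prog list" and s
  have "\<exists>t Q s'. exec solver (For i e c) s (t + 1) Q s' \<and> Inv' n t Q s'"
  proof (rule exec_For)
    show "eval e s = of_nat n" if "k \<le> n" "Inv' k t Q s" for k t Q s
      using that bound by (auto simp: Inv'_def)
    show "s i [] = of_nat k" if "k \<le> n" "Inv' k t Q s" for k t Q s
      using that counter by (auto simp: Inv'_def)
    show "Inv' 0 (1 + rat_size 0) [] (set_cell i [] 0 s)"
      using init size[of 0] by (simp add: Inv'_def)
    fix k t Q s assume "k < n" and inv: "Inv' k t Q s"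
    then obtain t' s' where *: "exec solver c s t' [] s'" "t' \<le> T" "s' i [] = of_nat k"
      "Inv (Suc k) (set_cell i [] (of_nat (Suc k)) s')"
      using step[of k s] unfolding Inv'_def runs_def by blast
    have "Inv' (Suc k) (t + t' + 2 + rat_size (of_nat (Suc k))) (Q @ [])
          (set_cell i [] (of_nat (Suc k)) s')"
      using inv * size[of "Suc k"] \<open>k < n\<close> by (simp add: Inv'_def del: of_nat_Suc)
    with * show "\<exists>t' Q' s'. exec solver c s t' Q' s' \<and> s' i [] = of_nat k \<and>
        Inv' (Suc k) (t + t' + 2 + rat_size (of_nat (Suc k))) (Q @ Q')
          (set_cell i [] (of_nat (Suc k)) s')" by blast
  qed
  then obtain t s' where "exec solver (For i e c) s (t + 1) [] s'" "Inv n s'"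
    "t \<le> 1 + S + n * (T + S + 2)"
    unfolding Inv'_def by blast
  then show ?thesis
    unfolding runs_def by (intro exI[of _ "t + 1"] exI[of _ s']) simp
qed

text \<open>One pattern serves for all tables. The innermost loop accumulates sums or powers in a
  cell and is switched off by the bound \<open>Num 0\<close>; a one-dimensional table uses a single
  round of one of the outer loops.\<close>

definition fill :: "string \<Rightarrow> expr \<Rightarrow> expr \<Rightarrow> expr \<Rightarrow> expr list \<Rightarrow> expr \<Rightarrow> expr \<Rightarrow> com" where
  "fill a na nb nc ix e0 e1 =
     For ''i'' na (For ''j'' nb (Seq (Assign a ix e0) (For ''l'' nc (Assign a ix e1))))"

definition fill_vars :: "string \<Rightarrow> string set" where
  "fill_vars a = {a, ''i'', ''j'', ''l''}"

text \<open>
  \<open>f i j l\<close> is the value of the cell \<open>(i, j)\<close> after \<open>l\<close> rounds of the innermost loop.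
\<close>

lemma runs_fill:
  fixes f :: "nat \<Rightarrow> nat \<Rightarrow> nat \<Rightarrow> rat" and ix :: "nat \<Rightarrow> nat \<Rightarrow> nat list"
  assumes a: "a \<notin> {''i'', ''j'', ''l''}"
    and na: "\<And>s'. agree (fill_vars a) s s' \<Longrightarrow> eval e1 s' = of_nat na"
    and nb: "\<And>s'. agree (fill_vars a) s s' \<Longrightarrow> eval e2 s' = of_nat nb"
    and nc: "\<And>s' i j. agree (fill_vars a) s s' \<Longrightarrow> i < na \<Longrightarrow> j < nb \<Longrightarrow>
      s' ''i'' [] = of_nat i \<Longrightarrow> s' ''j'' [] = of_nat j \<Longrightarrow> eval e3 s' = of_nat (nc i j)"
    and index: "\<And>s' i j. agree (fill_vars a) s s' \<Longrightarrow> i < na \<Longrightarrow> j < nb \<Longrightarrow>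
      s' ''i'' [] = of_nat i \<Longrightarrow> s' ''j'' [] = of_nat j \<Longrightarrow>
      map (\<lambda>e. nat \<lfloor>eval e s'\<rfloor>) es = ix i j"
    and inj: "\<And>i j i' j'. i < na \<Longrightarrow> i' < na \<Longrightarrow> j < nb \<Longrightarrow> j' < nb \<Longrightarrow> ix i j = ix i' j' \<Longrightarrow>
      i = i' \<and> j = j'"
    and start: "\<And>s' i j. agree (fill_vars a) s s' \<Longrightarrow> i < na \<Longrightarrow> j < nb \<Longrightarrow>
      s' ''i'' [] = of_nat i \<Longrightarrow> s' ''j'' [] = of_nat j \<Longrightarrow> eval d0 s' = f i j 0"
    and step: "\<And>s' i j l. agree (fill_vars a) s s' \<Longrightarrow> i < na \<Longrightarrow> j < nb \<Longrightarrow> l < nc i j \<Longrightarrow>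
      s' ''i'' [] = of_nat i \<Longrightarrow> s' ''j'' [] = of_nat j \<Longrightarrow> s' ''l'' [] = of_nat l \<Longrightarrow>
      s' a (ix i j) = f i j l \<Longrightarrow> eval d1 s' = f i j (Suc l)"
    and size: "\<And>i j l. i < na \<Longrightarrow> j < nb \<Longrightarrow> l \<le> nc i j \<Longrightarrow> rat_size (f i j l) \<le> S"
    and counters: "\<And>k. k \<le> na \<or> k \<le> nb \<or> k \<le> m \<Longrightarrow> rat_size (of_nat k) \<le> S"
    and m: "\<And>i j. i < na \<Longrightarrow> j < nb \<Longrightarrow> nc i j \<le> m"
  shows "runs solver (fill a e1 e2 e3 es d0 d1) s ((na + 1) * ((nb + 1) * ((m + 1) * (5 * S + 8))))
    (\<lambda>s'. agree (fill_vars a) s s' \<and> (\<forall>i<na. \<forall>j<nb. s' a (ix i j) = f i j (nc i j)))"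
proof -
  note [simp] = set_cell_apply
  have vars: "a \<in> fill_vars a" "''i'' \<in> fill_vars a" "''j'' \<in> fill_vars a" "''l'' \<in> fill_vars a"
    by (auto simp: fill_vars_def)
  have neq: "a \<noteq> ''i''" "a \<noteq> ''j''" "a \<noteq> ''l''" using a by auto
  define filled where "filled s' i j \<longleftrightarrow> s' a (ix i j) = f i j (nc i j)" for s' :: store and i j
  define Inv1 where "Inv1 i s' \<longleftrightarrow> agree (fill_vars a) s s' \<and> s' ''i'' [] = of_nat i \<and>
      (\<forall>i'<i. \<forall>j<nb. filled s' i' j)" for i and s' :: store
  define Inv2 where "Inv2 i j s' \<longleftrightarrow> Inv1 i s' \<and> s' ''j'' [] = of_nat j \<and>
      (\<forall>j'<j. filled s' i j')" for i j and s' :: store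
  define Inv3 where "Inv3 i j l s' \<longleftrightarrow> Inv2 i j s' \<and> s' ''l'' [] = of_nat l \<and>
      s' a (ix i j) = f i j l" for i j l and s' :: store
  \<comment> \<open>Injectivity of \<open>ix\<close> protects the cells filled earlier from later
    writes.\<close>
  have filled_write: "filled (set_cell a (ix i j) r s') i' j' = filled s' i' j'"
    if "i < na" "j < nb" "i' < na" "j' < nb" "i' \<noteq> i \<or> j' \<noteq> j" for i j i' j' r s'
    using that inj[of i' i j' j] by (auto simp: filled_def)
  have Inv2_write: "Inv2 i j (set_cell a (ix i j) r s')"
    if "Inv2 i j s'" "i < na" "j < nb" for i j r s'
    using that neq filled_write[OF that(2,3)] vars
    by (auto simp: Inv2_def Inv1_def intro: agree_set_cell)
  have filled_var: "filled (set_cell v [] r s') = filled s'" if "v \<in> {''i'', ''j'', ''l''}" for v r s'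
    using that neq by (auto simp: filled_def fun_eq_iff)
  have inner: "runs solver (Seq (Assign a es d0) (For ''l'' e3 (Assign a es d1))) s'
      ((m + 1) * (3 * S + 4)) (Inv3 i j (nc i j))"
    if "Inv2 i j s'" "i < na" "j < nb" for i j s'
  proof -
    have loop: "runs solver (For ''l'' e3 (Assign a es d1)) s1
        ((nc i j + 1) * ((1 + S) + S + 2)) (Inv3 i j (nc i j))"
      if s1: "Inv2 i j s1" "s1 a (ix i j) = f i j 0" for s1
    proof (rule runs_For)
      show "Inv3 i j 0 (set_cell ''l'' [] 0 s1)"
        using s1 neq vars filled_var[of "''l''"]
        by (auto simp: Inv3_def Inv2_def Inv1_def intro: agree_set_cell)
      show "eval e3 s' = of_nat (nc i j)" if "Inv3 i j k s'" for k s'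
        using nc[of s' i j] that \<open>i < na\<close> \<open>j < nb\<close> by (auto simp: Inv3_def Inv2_def Inv1_def)
      show "s' ''l'' [] = of_nat k" if "Inv3 i j k s'" for k s'
        using that by (simp add: Inv3_def)
      show "rat_size (of_nat k) \<le> S" if "k \<le> nc i j" for k
        using that m[of i j] counters[of k] \<open>i < na\<close> \<open>j < nb\<close> by simp
      fix k s' assume k: "k < nc i j" and inv: "Inv3 i j k s'"
      then have e: "eval d1 s' = f i j (Suc k)" "map (\<lambda>e. nat \<lfloor>eval e s'\<rfloor>) es = ix i j"
        using step[of s' i j k] index[of s' i j] \<open>i < na\<close> \<open>j < nb\<close>
        by (auto simp: Inv3_def Inv2_def Inv1_def)
      have "runs solver (Assign a es d1) s' (1 + rat_size (eval d1 s'))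
         (\<lambda>s'. s' ''l'' [] = of_nat k \<and> Inv3 i j (Suc k) (set_cell ''l'' [] (of_nat (Suc k)) s'))"
      proof (rule runs_Assign, unfold e)
        have "Inv2 i j (set_cell a (ix i j) (f i j (Suc k)) s')"
          using inv \<open>i < na\<close> \<open>j < nb\<close> by (auto simp: Inv3_def intro: Inv2_write)
        then show "set_cell a (ix i j) (f i j (Suc k)) s' ''l'' [] = of_nat k \<and>
          Inv3 i j (Suc k) (set_cell ''l'' [] (of_nat (Suc k))
            (set_cell a (ix i j) (f i j (Suc k)) s'))"
          using inv neq vars filled_var[of "''l''"]
          by (auto simp: Inv3_def Inv2_def Inv1_def simp del: of_nat_Suc intro: agree_set_cell)
      qed
      then show "runs solver (Assign a es d1) s' (1 + S)
         (\<lambda>s'. s' ''l'' [] = of_nat k \<and> Inv3 i j (Suc k) (set_cell ''l'' [] (of_nat (Suc k)) s'))"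
        by (rule runs_weaken) (use size[of i j "Suc k"] k e \<open>i < na\<close> \<open>j < nb\<close> in auto)
    qed
    have e: "eval d0 s' = f i j 0" "map (\<lambda>e. nat \<lfloor>eval e s'\<rfloor>) es = ix i j"
      using that start[of s' i j] index[of s' i j] by (auto simp: Inv2_def Inv1_def)
    have "runs solver (Seq (Assign a es d0) (For ''l'' e3 (Assign a es d1))) s'
      ((1 + rat_size (eval d0 s')) + (nc i j + 1) * ((1 + S) + S + 2)) (Inv3 i j (nc i j))"
    proof (rule runs_Seq[OF runs_Assign])
      show "Inv2 i j (set_cell a (map (\<lambda>e. nat \<lfloor>eval e s'\<rfloor>) es) (eval d0 s') s') \<and>
         set_cell a (map (\<lambda>e. nat \<lfloor>eval e s'\<rfloor>) es) (eval d0 s') s' a (ix i j) = f i j 0"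
        unfolding e using Inv2_write[OF that] by simp
    qed (use loop in blast)
    moreover have "(1 + rat_size (eval d0 s')) + (nc i j + 1) * ((1 + S) + S + 2)
        \<le> (m + 1) * (1 + S) + (m + 1) * ((1 + S) + S + 2)"
    proof (intro add_mono)
      show "(nc i j + 1) * (1 + S + S + 2) \<le> (m + 1) * (1 + S + S + 2)"
        using m[OF that(2,3)] by (intro mult_le_mono1) simp
      show "1 + rat_size (eval d0 s') \<le> (m + 1) * (1 + S)"
        using size[OF that(2,3), of 0] e by simp
    qed
    moreover have "\<dots> = (m + 1) * (3 * S + 4)" by (simp add: algebra_simps)
    ultimately show ?thesis by (elim runs_weaken) auto
  qed
  have middle: "runs solver (For ''j'' e2 (Seq (Assign a es d0) (For ''l'' e3 (Assign a es d1)))) s'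
      ((nb + 1) * ((m + 1) * (3 * S + 4) + S + 2)) (Inv2 i nb)"
    if "Inv1 i s'" "i < na" for i s'
  proof (rule runs_For)
    show "Inv2 i 0 (set_cell ''j'' [] 0 s')"
      using that neq vars filled_var[of "''j''"]
      by (auto simp: Inv2_def Inv1_def intro: agree_set_cell)
    show "eval e2 s' = of_nat nb" if "Inv2 i k s'" for k s'
      using nb[of s'] that by (auto simp: Inv2_def Inv1_def)
    show "s' ''j'' [] = of_nat k" if "Inv2 i k s'" for k s'
      using that by (simp add: Inv2_def)
    show "rat_size (of_nat k) \<le> S" if "k \<le> nb" for k
      using counters[of k] that by simp
    fix k s' assume "k < nb" "Inv2 i k s'"
    from inner[OF this(2) \<open>i < na\<close> this(1)]
    show "runs solver (Seq (Assign a es d0) (For ''l'' e3 (Assign a es d1))) s'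
      ((m + 1) * (3 * S + 4))
      (\<lambda>s'. s' ''j'' [] = of_nat k \<and> Inv2 i (Suc k) (set_cell ''j'' [] (of_nat (Suc k)) s'))"
      by (rule runs_weaken)
        (use neq vars filled_var[of "''j''"] in
          \<open>auto simp: Inv3_def Inv2_def Inv1_def filled_def less_Suc_eq simp del: of_nat_Suc
             intro: agree_set_cell\<close>)
  qed
  have "runs solver (fill a e1 e2 e3 es d0 d1) s
      ((na + 1) * ((nb + 1) * ((m + 1) * (3 * S + 4) + S + 2) + S + 2)) (Inv1 na)"
    unfolding fill_def
  proof (rule runs_For)
    show "Inv1 0 (set_cell ''i'' [] 0 s)"
      using vars by (auto simp: Inv1_def intro: agree_set_cell agree_refl)
    show "eval e1 s' = of_nat na" if "Inv1 k s'" for k s'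
      using na[of s'] that by (auto simp: Inv1_def)
    show "s' ''i'' [] = of_nat k" if "Inv1 k s'" for k s'
      using that by (simp add: Inv1_def)
    show "rat_size (of_nat k) \<le> S" if "k \<le> na" for k
      using counters[of k] that by simp
    fix k s' assume "k < na" "Inv1 k s'"
    from middle[OF this(2,1)]
    show "runs solver (For ''j'' e2 (Seq (Assign a es d0) (For ''l'' e3 (Assign a es d1)))) s'
      ((nb + 1) * ((m + 1) * (3 * S + 4) + S + 2))
      (\<lambda>s'. s' ''i'' [] = of_nat k \<and> Inv1 (Suc k) (set_cell ''i'' [] (of_nat (Suc k)) s'))"
      by (rule runs_weaken)
        (use neq vars filled_var[of "''i''"] in
          \<open>auto simp: Inv2_def Inv1_def filled_def less_Suc_eq simp del: of_nat_Suc
             intro: agree_set_cell\<close>)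
  qed
  \<comment> \<open>The overhead \<open>S + 2\<close> of each of the two outer loops is moved into
    the innermost factor, which turns the bound into a product:
    \<open>3 * S + 4 + 2 * (S + 2) = 5 * S + 8\<close>.\<close>
  moreover have "(na + 1) * ((nb + 1) * ((m + 1) * (3 * S + 4) + S + 2) + S + 2)
      \<le> (na + 1) * ((nb + 1) * ((m + 1) * (5 * S + 8)))"
  proof (intro mult_le_mono2)
    have "(nb + 1) * ((m + 1) * (3 * S + 4) + S + 2) + S + 2
        \<le> (nb + 1) * ((m + 1) * (3 * S + 4) + (S + 2)) + (nb + 1) * (S + 2)" by simp
    also have "\<dots> = (nb + 1) * ((m + 1) * (3 * S + 4) + 2 * (S + 2))" by (simp add: algebra_simps)
    also have "\<dots> \<le> (nb + 1) * ((m + 1) * (3 * S + 4) + (m + 1) * (2 * (S + 2)))"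
      by (intro mult_le_mono2 add_left_mono) simp
    also have "\<dots> = (nb + 1) * ((m + 1) * (5 * S + 8))" by (simp add: algebra_simps)
    finally show "(nb + 1) * ((m + 1) * (3 * S + 4) + S + 2) + S + 2
      \<le> (nb + 1) * ((m + 1) * (5 * S + 8))" .
  qed
  ultimately show ?thesis
    by (elim runs_weaken) (auto simp: Inv1_def filled_def)
qed

section \<open>The linear program of a labelling\<close>

definition pair_rows :: "adapt_instance \<Rightarrow> nat" where
  "pair_rows I = n_vert I * n_vert I * n_con I * n_con I"

text \<open>Row numbers encode quadruples in mixed radix: with \<open>n\<close> vertices and
  \<open>m\<close> constraints, \<open>i = ((u * n + v) * m + r) * m + s\<close>, and the digits are
  recovered by division.\<close>

definition row_of :: "(nat \<Rightarrow> nat \<Rightarrow> nat \<Rightarrow> nat \<Rightarrow> 'a) \<Rightarrow> adapt_instance \<Rightarrow> nat \<Rightarrow> 'a" where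
  "row_of f I i = f (i div (n_vert I * n_con I * n_con I)) (i div (n_con I * n_con I) mod n_vert I)
     (i div n_con I mod n_con I) (i mod n_con I)"

text \<open>Column \<open>j\<close> of the combination \<open>p * \<alpha> + q * \<beta>\<close>:
  \<open>x\<close> enters both left-hand sides, \<open>y\<^sub>1\<close> only that of row
  \<open>r\<close>, and \<open>y\<^sub>2\<close> only that of row \<open>s\<close>.\<close>

definition pair_entry :: "adapt_instance \<Rightarrow> rat \<Rightarrow> rat \<Rightarrow> nat \<Rightarrow> nat \<Rightarrow> nat \<Rightarrow> rat" where
  "pair_entry I p q r s j =
     (if j < n_x I then p * A_val I r j + q * A_val I s j
      else if j < n_x I + n_y I then p * B_val I r (j - n_x I)
      else if j < n_x I + 2 * n_y I then q * B_val I s (j - n_x I - n_y I) else 0)"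

definition epigraph_entry :: "adapt_instance \<Rightarrow> nat \<Rightarrow> nat \<Rightarrow> rat" where
  "epigraph_entry I i j =
     (if j < n_x I then 0
      else if j < n_x I + n_y I then if i = 0 then d_coef I (j - n_x I) else 0
      else if j < n_x I + 2 * n_y I then if i = 0 then 0 else d_coef I (j - n_x I - n_y I)
      else - 1)"

text \<open>
  The columns are those of \<open>x\<close>, \<open>y\<^sub>1\<close>, \<open>y\<^sub>2\<close>, and one for an upper bound on the \<open>d \<cdot> y\<^sub>i\<close>, which the
  last two rows express.
\<close>

definition label_lp :: "adapt_instance \<Rightarrow> (nat \<Rightarrow> bool) \<Rightarrow> lin_prog" where
  "label_lp I lab =
     \<lparr> rows = pair_rows I + 2,
       cols = n_x I + 2 * n_y I + 1,
       lhs = (\<lambda>i j. if i < pair_rows I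
         then row_of (\<lambda>u v r s. pair_entry I (row_p I lab u v r s) (row_q I lab u v r s) r s j) I i
         else epigraph_entry I (i - pair_rows I) j),
       rhs = (\<lambda>i. if i < pair_rows I then row_of (row_rhs I lab) I i else 0),
       obj = (\<lambda>j. if j < n_x I then c_coef I j else if j < n_x I + 2 * n_y I then 0 else 1),
       integral = (\<lambda>j. if j < n_x I then int_x I j
         else if j < n_x I + n_y I then int_y I (j - n_x I)
         else if j < n_x I + 2 * n_y I then int_y I (j - n_x I - n_y I) else False) \<rparr>"

text \<open>Polymorphic, since it also selects blocks of rational vectors and of predicates on the
  columns.\<close>

definition y_part :: "adapt_instance \<Rightarrow> (nat \<Rightarrow> 'a) \<Rightarrow> nat \<Rightarrow> nat \<Rightarrow> 'a" where
  "y_part I z i j = z (n_x I + i * n_y I + j)"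

lemma sum_append:
  fixes f :: "nat \<Rightarrow> 'a::comm_monoid_add"
  shows "(\<Sum>j<a + b. f j) = (\<Sum>j<a. f j) + (\<Sum>j<b. f (a + j))"
  by (induction b) (simp_all add: add.assoc)

lemma all_less_add: "(\<forall>i<a + b. P i) \<longleftrightarrow> (\<forall>i<a. P i) \<and> (\<forall>i<b. P (a + i))" for a b :: nat
proof (intro iffI conjI allI impI)
  fix i assume *: "(\<forall>i<a. P i) \<and> (\<forall>i<b. P (a + i))" and "i < a + b"
  show "P i"
  proof (cases "i < a")
    case False
    then have "i = a + (i - a)" "i - a < b" using \<open>i < a + b\<close> by auto
    then show ?thesis using * by metis
  qed (use * in blast)
qed auto

lemma all_cols:
  "(\<forall>j<n_x I + 2 * n_y I + 1. P j) \<longleftrightarrow>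
   (\<forall>j<n_x I. P j) \<and> (\<forall>j<n_y I. y_part I P 0 j) \<and> (\<forall>j<n_y I. y_part I P 1 j)
   \<and> P (n_x I + 2 * n_y I)"
proof -
  have eq: "n_x I + 2 * n_y I + 1 = n_x I + n_y I + n_y I + 1" by simp
  show ?thesis
    unfolding eq all_less_add by (simp add: y_part_def mult_2 add.assoc)
qed

lemma sum_cols:
  fixes f :: "nat \<Rightarrow> 'a::comm_monoid_add"
  shows "(\<Sum>j<n_x I + 2 * n_y I + 1. f j) =
    (\<Sum>j<n_x I. f j) + (\<Sum>j<n_y I. y_part I f 0 j) + (\<Sum>j<n_y I. y_part I f 1 j)
    + f (n_x I + 2 * n_y I)"
  using sum_append[of f "n_x I + n_y I" "n_y I"] sum_append[of f "n_x I" "n_y I"]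
  by (simp add: y_part_def mult_2 add.assoc)

lemma row_of_bounds:
  assumes "i < pair_rows I"
  shows "i div (n_vert I * n_con I * n_con I) < n_vert I"
    "i div (n_con I * n_con I) mod n_vert I < n_vert I"
    "i div n_con I mod n_con I < n_con I" "i mod n_con I < n_con I"
proof -
  have pos: "0 < n_vert I" "0 < n_con I" using assms by (auto simp: pair_rows_def intro: gr0I)
  then show "i div (n_vert I * n_con I * n_con I) < n_vert I"
    using assms by (simp add: less_mult_imp_div_less pair_rows_def mult.assoc)
  show "i div (n_con I * n_con I) mod n_vert I < n_vert I"
    "i div n_con I mod n_con I < n_con I" "i mod n_con I < n_con I"
    using pos by simp_all
qed

text \<open>Every quadruple in range is the digit sequence of a row number in range, so
  \<open>row_of\<close>, taken here at truth values, turns a quantifier over rows into one over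
  quadruples.\<close>

lemma row_of_all:
  "(\<forall>i<pair_rows I. row_of R I i) \<longleftrightarrow>
   (\<forall>u<n_vert I. \<forall>v<n_vert I. \<forall>r<n_con I. \<forall>s<n_con I. R u v r s)"
proof (intro iffI allI impI)
  fix u v r s
  assume R: "\<forall>i<pair_rows I. row_of R I i"
    and b: "u < n_vert I" "v < n_vert I" "r < n_con I" "s < n_con I"
  define n m where "n = n_vert I" and "m = n_con I"
  define i where "i = ((u * n + v) * m + r) * m + s"
  have bound: "a * k + b < c * k" if "a < c" "b < k" for a b c k :: nat
  proof -
    have "a * k + b < (a + 1) * k" using that by simp
    also have "\<dots> \<le> c * k" using that by (intro mult_le_mono1) simp
    finally show ?thesis .
  qed
  have "i < pair_rows I"
    unfolding i_def pair_rows_def n_def m_def by (intro bound) (use b in simp_all)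
  moreover have 1: "i mod m = s" "i div m = (u * n + v) * m + r" using b by (auto simp: i_def m_def)
  moreover have 2: "i div (m * m) = u * n + v" using 1(2) b by (simp add: div_mult2_eq m_def)
  moreover have "i div (n * m * m) = u"
  proof -
    have "n * m * m = m * m * n" by simp
    then have "i div (n * m * m) = (u * n + v) div n" using 2 by (simp only: div_mult2_eq)
    then show ?thesis using b by (simp add: n_def)
  qed
  ultimately show "R u v r s" using R b by (force simp: row_of_def n_def m_def)
qed (use row_of_bounds in \<open>auto simp: row_of_def\<close>)

lemma pair_row_sum:
  "(\<Sum>j<n_x I + 2 * n_y I + 1. real_of_rat (pair_entry I p q r s j) * z j) =
   real_of_rat p * left_side I z (y_part I z 0) r + real_of_rat q * left_side I z (y_part I z 1) s"
  unfolding sum_cols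
  by (simp add: y_part_def pair_entry_def left_side_def of_rat_add of_rat_mult distrib_left
      distrib_right sum.distrib sum_distrib_left mult.assoc)

lemma epigraph_row_sum:
  assumes "i < 2"
  shows "(\<Sum>j<n_x I + 2 * n_y I + 1. real_of_rat (epigraph_entry I i j) * z j) =
    (\<Sum>j<n_y I. real_of_rat (d_coef I j) * y_part I z i j) - z (n_x I + 2 * n_y I)"
  using assms unfolding sum_cols
  by (auto simp: y_part_def epigraph_entry_def less_2_cases_iff)

lemma lp_objective_label_lp:
  "lp_objective (label_lp I lab) z =
    (\<Sum>j<n_x I. real_of_rat (c_coef I j) * z j) + z (n_x I + 2 * n_y I)"
proof -
  have "cols (label_lp I lab) = n_x I + 2 * n_y I + 1" by (simp add: label_lp_def)
  then show ?thesis
    unfolding lp_objective_def by (simp only: sum_cols) (simp add: y_part_def label_lp_def)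
qed

lemma lp_feasible_label_lp:
  "lp_feasible (label_lp I lab) z \<longleftrightarrow> label_feasible I lab z (y_part I z) \<and>
    (\<forall>i<2. (\<Sum>j<n_y I. real_of_rat (d_coef I j) * y_part I z i j) \<le> z (n_x I + 2 * n_y I))"
proof -
  let ?row = "\<lambda>i. (\<Sum>j<n_x I + 2 * n_y I + 1. real_of_rat (lhs (label_lp I lab) i j) * z j)
    \<le> real_of_rat (rhs (label_lp I lab) i)"
  have pair: "?row i \<longleftrightarrow> row_of (\<lambda>u v r s.
      real_of_rat (row_p I lab u v r s) * left_side I z (y_part I z 0) r
      + real_of_rat (row_q I lab u v r s) * left_side I z (y_part I z 1) s
      \<le> real_of_rat (row_rhs I lab u v r s)) I i" if "i < pair_rows I" for i
    using that by (simp only: label_lp_def lin_prog.simps if_True row_of_def pair_row_sum)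
  have epi: "?row (pair_rows I + i) \<longleftrightarrow>
      (\<Sum>j<n_y I. real_of_rat (d_coef I j) * y_part I z i j) \<le> z (n_x I + 2 * n_y I)" if "i < 2" for i
  proof -
    have "lhs (label_lp I lab) (pair_rows I + i) = epigraph_entry I i"
      "rhs (label_lp I lab) (pair_rows I + i) = 0" by (simp_all add: label_lp_def fun_eq_iff)
    then show ?thesis by (simp only: epigraph_row_sum[OF that]) simp
  qed
  have rows: "rows (label_lp I lab) = pair_rows I + 2" and cols: "cols (label_lp I lab) = n_x I + 2 * n_y I + 1"
    by (simp_all add: label_lp_def)
  have int: "(\<forall>j<cols (label_lp I lab). integral (label_lp I lab) j \<longrightarrow> z j \<in> \<int>) \<longleftrightarrow>
      (\<forall>j<n_x I. int_x I j \<longrightarrow> z j \<in> \<int>) \<and> (\<forall>i<2. \<forall>j<n_y I. int_y I j \<longrightarrow> y_part I z i j \<in> \<int>)"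
    unfolding cols all_cols by (auto simp: label_lp_def y_part_def less_2_cases_iff)
  have pairs: "(\<forall>i<pair_rows I. ?row i) \<longleftrightarrow>
      (\<forall>u<n_vert I. \<forall>v<n_vert I. \<forall>r<n_con I. \<forall>s<n_con I.
      real_of_rat (row_p I lab u v r s) * left_side I z (y_part I z 0) r
      + real_of_rat (row_q I lab u v r s) * left_side I z (y_part I z 1) s
      \<le> real_of_rat (row_rhs I lab u v r s))"
    unfolding row_of_all[symmetric] using pair by blast
  have epis: "(\<forall>i<2. ?row (pair_rows I + i)) \<longleftrightarrow>
      (\<forall>i<2. (\<Sum>j<n_y I. real_of_rat (d_coef I j) * y_part I z i j) \<le> z (n_x I + 2 * n_y I))"
    using epi by (metis (no_types, lifting))
  have all_rows: "(\<forall>i<rows (label_lp I lab). ?row i) \<longleftrightarrow>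
      (\<forall>i<pair_rows I. ?row i) \<and> (\<forall>i<2. ?row (pair_rows I + i))"
    unfolding rows by (rule all_less_add)
  show ?thesis
    unfolding lp_feasible_def label_feasible_def int
    unfolding cols all_rows pairs epis by (simp only: conj_ac)
qed

section \<open>Labellings as binary numbers, and the comparison of objective values\<close>

definition mask_label :: "nat \<Rightarrow> nat \<Rightarrow> bool" where
  "mask_label k v \<longleftrightarrow> odd (k div 2 ^ v)"

text \<open>The induction splits off the lowest binary digit, so the remaining labelling is shifted
  by one vertex.\<close>

lemma mask_label_surj: "\<exists>k<2 ^ n. \<forall>v<n. mask_label k v = lab v"
proof (induction n arbitrary: lab)
  case (Suc n)
  obtain k where k: "k < 2 ^ n" "\<forall>v<n. mask_label k v = lab (Suc v)"
    using Suc.IH[of "\<lambda>v. lab (Suc v)"] by blast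
  define l where "l = 2 * k + of_bool (lab 0)"
  have half: "l div 2 = k" by (simp add: l_def)
  have "mask_label l v = lab v" if "v < Suc n" for v
  proof (cases v)
    case 0
    then show ?thesis by (simp add: mask_label_def l_def)
  next
    case (Suc w)
    then have "mask_label l v = mask_label k w" by (simp add: mask_label_def div_mult2_eq half)
    then show ?thesis using k that Suc by simp
  qed
  moreover have "l < 2 ^ Suc n" using k(1) by (auto simp: l_def)
  ultimately show ?case by blast
qed simp

text \<open>A mask reproduces the labelling read off a cover only on the vertices in range, and this
  passes from one to the other.\<close>

lemma label_feasible_cong:
  assumes "\<And>v. v < n_vert I \<Longrightarrow> lab v = lab' v"
  shows "label_feasible I lab x y = label_feasible I lab' x y"
proof -
  have "row_p I lab u v = row_p I lab' u v" "row_q I lab u v = row_q I lab' u v"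
    "row_rhs I lab u v = row_rhs I lab' u v" if "u < n_vert I" "v < n_vert I" for u v
    using assms that by (simp_all add: fun_eq_iff row_p_def row_q_def row_rhs_def conflict_def)
  then show ?thesis unfolding label_feasible_def by simp
qed

lemma adapt_objective_2:
  "adapt_objective I 2 x y = (\<Sum>j<n_x I. real_of_rat (c_coef I j) * x j)
    + max (\<Sum>j<n_y I. real_of_rat (d_coef I j) * y 0 j) (\<Sum>j<n_y I. real_of_rat (d_coef I j) * y 1 j)"
  by (simp add: adapt_objective_def numeral_2_eq_2 lessThan_Suc max.commute)

text \<open>The last variable may exceed both values \<open>d \<cdot> y\<^sub>i\<close>, so the
  objectives are related by an inequality only.\<close>

lemma lp_feasible_imp_adapt_feasible:
  assumes "deterministic_A I" "deterministic_B I" "lp_feasible (label_lp I lab) z"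
  shows "\<exists>Om. adapt_feasible I 2 Om z (y_part I z)"
    and "adapt_objective I 2 z (y_part I z) \<le> lp_objective (label_lp I lab) z"
  using assms label_feasible_imp_adapt_feasible[OF assms(1,2)]
  by (auto simp: lp_feasible_label_lp adapt_objective_2 lp_objective_label_lp)

text \<open>In this direction the last variable is set to the larger of the values
  \<open>d \<cdot> y\<^sub>i\<close>, which makes the objectives equal. With the inequality of the
  opposite direction, minimizing over all masks is the original problem.\<close>

lemma adapt_feasible_imp_lp_feasible:
  assumes "deterministic_A I" "deterministic_B I" "adapt_feasible I 2 Om x y"
  obtains k z where "k < 2 ^ n_vert I" "lp_feasible (label_lp I (mask_label k)) z"
    "lp_objective (label_lp I (mask_label k)) z = adapt_objective I 2 x y"
proof -
  obtain k where k: "k < 2 ^ n_vert I" "\<forall>v<n_vert I. mask_label k v = (vertex_point I v \<notin> Om 0)"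
    using mask_label_surj[of "n_vert I" "\<lambda>v. vertex_point I v \<notin> Om 0"] by blast
  have feas: "label_feasible I (mask_label k) x y"
    using adapt_feasible_imp_label_feasible[OF assms] k(2)
      label_feasible_cong[of I "mask_label k" "\<lambda>v. vertex_point I v \<notin> Om 0"] by blast
  define t where "t = max (\<Sum>j<n_y I. real_of_rat (d_coef I j) * y 0 j)
    (\<Sum>j<n_y I. real_of_rat (d_coef I j) * y 1 j)"
  define z where "z j = (if j < n_x I then x j else if j < n_x I + n_y I then y 0 (j - n_x I)
    else if j < n_x I + 2 * n_y I then y 1 (j - n_x I - n_y I) else t)" for j
  have x: "z j = x j" if "j < n_x I" for j using that by (simp add: z_def)
  have y: "y_part I z i j = y i j" if "j < n_y I" "i < 2" for i j
    using that by (auto simp: y_part_def z_def less_2_cases_iff)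
  have t: "z (n_x I + 2 * n_y I) = t" by (simp add: z_def)
  have "left_side I z (y_part I z i) r = left_side I x (y i) r" if "i < 2" for i r
    using x y that by (simp add: left_side_def)
  then have "label_feasible I (mask_label k) z (y_part I z)"
    using feas x y unfolding label_feasible_def by simp
  moreover have "(\<Sum>j<n_y I. real_of_rat (d_coef I j) * y_part I z i j) \<le> t" if "i < 2" for i
    using that y by (auto simp: less_2_cases_iff t_def)
  ultimately have "lp_feasible (label_lp I (mask_label k)) z" by (simp add: lp_feasible_label_lp t)
  moreover have "lp_objective (label_lp I (mask_label k)) z = adapt_objective I 2 x y"
    unfolding lp_objective_label_lp adapt_objective_2 t by (simp add: x t_def)
  ultimately show ?thesis using that k(1) by blast
qed

section \<open>Polynomial bounds\<close>

text \<open>The bounds are defined over arbitrary commutative semirings: at natural numbers they are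
  the estimates, at \<open>[:0, 1:]\<close> the polynomials whose values these are. This one is for
  the value of an affine map: a constant term of \<open>w\<close> bits, at most \<open>w\<close>
  products of \<open>2 * w\<close> bits, and a carry for each addition.\<close>

definition val_bits :: "'a::comm_semiring_1 \<Rightarrow> 'a" where
  "val_bits w = w + w * (2 * w + 1) + 1"

text \<open>The three groups stem from the coefficients of the programs (two products of numbers
  with \<open>2 * val_bits w + 1\<close> and \<open>val_bits w\<close> bits, added), from counters
  up to \<open>2 ^ n_vert I + pair_rows I\<close>, and from objective values, which are sums over at
  most \<open>3 * w + 1\<close> columns.\<close>

definition bits :: "'a::comm_semiring_1 \<Rightarrow> 'a" where
  "bits w = 6 * val_bits w + 3 + (w ^ 4 + w + 2) + (3 * w + 1) * (2 * w + 1)"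

definition cell_size :: "'a::comm_semiring_1 \<Rightarrow> 'a" where
  "cell_size w = 3 * bits w + 3"

text \<open>Chosen to exceed the number of rows, at most \<open>w ^ 4 + 2\<close>, the number of
  columns, at most \<open>3 * w + 1\<close>, and all input dimensions.\<close>

definition dim_bound :: "'a::comm_semiring_1 \<Rightarrow> 'a" where
  "dim_bound w = w ^ 4 + 3 * w + 4"

definition fill_time :: "'a::comm_semiring_1 \<Rightarrow> 'a" where
  "fill_time w = (dim_bound w + 1) ^ 3 * (5 * cell_size w + 8)"

definition lp_bound :: "'a::comm_semiring_1 \<Rightarrow> 'a" where
  "lp_bound w = 2 * dim_bound w + dim_bound w * dim_bound w * cell_size w
    + 2 * (dim_bound w * cell_size w)"

lemma rat_size_small: "small r (bits w) \<Longrightarrow> rat_size r \<le> cell_size w"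
  using rat_size_le by (simp add: cell_size_def)

section \<open>Lengths of the numbers in the programs\<close>

lemma instance_size_dims:
  assumes "instance_size I \<le> w"
  shows "n_unc I \<le> w" "n_x I \<le> w" "n_y I \<le> w" "n_con I \<le> w" "n_vert I \<le> w"
  using assms by (simp_all add: instance_size_def)

lemma le_sum_lessThan: "i < n \<Longrightarrow> f i \<le> (\<Sum>i<n. f i)" for f :: "nat \<Rightarrow> nat"
  by (rule member_le_sum) auto

lemma le_sum_atMost: "i \<le> n \<Longrightarrow> f i \<le> (\<Sum>i\<le>n. f i)" for f :: "nat \<Rightarrow> nat"
  by (rule member_le_sum) auto

lemma instance_size_coefs:
  assumes "instance_size I \<le> w"
  shows "l \<le> n_unc I \<Longrightarrow> r < n_con I \<Longrightarrow> j < n_x I \<Longrightarrow> rat_size (A_coef I l r j) \<le> w"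
    and "l \<le> n_unc I \<Longrightarrow> r < n_con I \<Longrightarrow> j < n_y I \<Longrightarrow> rat_size (B_coef I l r j) \<le> w"
    and "l \<le> n_unc I \<Longrightarrow> r < n_con I \<Longrightarrow> rat_size (b_coef I l r) \<le> w"
    and "j < n_x I \<Longrightarrow> rat_size (c_coef I j) \<le> w"
    and "j < n_y I \<Longrightarrow> rat_size (d_coef I j) \<le> w"
    and "v < n_vert I \<Longrightarrow> i < n_unc I \<Longrightarrow> rat_size (vert I v i) \<le> w"
proof -
  have A: "(\<Sum>l\<le>n_unc I. \<Sum>r<n_con I. \<Sum>j<n_x I. rat_size (A_coef I l r j)) \<le> w"
    and B: "(\<Sum>l\<le>n_unc I. \<Sum>r<n_con I. \<Sum>j<n_y I. rat_size (B_coef I l r j)) \<le> w"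
    and b: "(\<Sum>l\<le>n_unc I. \<Sum>r<n_con I. rat_size (b_coef I l r)) \<le> w"
    and c: "(\<Sum>j<n_x I. rat_size (c_coef I j)) \<le> w"
    and d: "(\<Sum>j<n_y I. rat_size (d_coef I j)) \<le> w"
    and v: "(\<Sum>v<n_vert I. \<Sum>l<n_unc I. rat_size (vert I v l)) \<le> w"
    using assms by (simp_all add: instance_size_def)
  show "rat_size (A_coef I l r j) \<le> w" if "l \<le> n_unc I" "r < n_con I" "j < n_x I"
    by (rule order_trans[OF le_sum_lessThan[OF that(3)] order_trans[OF le_sum_lessThan[OF that(2)]
          order_trans[OF le_sum_atMost[OF that(1)] A]]])
  show "rat_size (B_coef I l r j) \<le> w" if "l \<le> n_unc I" "r < n_con I" "j < n_y I"
    by (rule order_trans[OF le_sum_lessThan[OF that(3)] order_trans[OF le_sum_lessThan[OF that(2)]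
          order_trans[OF le_sum_atMost[OF that(1)] B]]])
  show "rat_size (b_coef I l r) \<le> w" if "l \<le> n_unc I" "r < n_con I"
    by (rule order_trans[OF le_sum_lessThan[OF that(2)] order_trans[OF le_sum_atMost[OF that(1)] b]])
  show "rat_size (c_coef I j) \<le> w" if "j < n_x I"
    by (rule order_trans[OF le_sum_lessThan[OF that] c])
  show "rat_size (d_coef I j) \<le> w" if "j < n_y I"
    by (rule order_trans[OF le_sum_lessThan[OF that] d])
  show "rat_size (vert I v i) \<le> w" if "v < n_vert I" "i < n_unc I"
    by (rule order_trans[OF le_sum_lessThan[OF that(2)] order_trans[OF le_sum_lessThan[OF that(1)] v]])
qed

lemma small_of_size: "rat_size r \<le> w \<Longrightarrow> small r w"
  using small_mono small_rat_size by blast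

lemma small_affine_upto:
  assumes "\<And>l. l \<le> n \<Longrightarrow> small (a l) w" "\<And>l. l < n \<Longrightarrow> small (v l) w" "m \<le> n" "n \<le> w"
  shows "small (affine_upto a v m) (val_bits w)"
proof -
  have "small (\<Sum>l<m. a (Suc l) * v l) (m * (w + w + 1))"
    using assms by (intro small_sum small_mult) auto
  from small_add[OF assms(1)[of 0] this]
  have "small (affine_upto a v m) (w + m * (w + w + 1) + 1)" by (simp add: affine_upto_def)
  moreover have "w + m * (w + w + 1) + 1 \<le> val_bits w"
    using assms mult_le_mono1[of m w "w + w + 1"] by (simp add: val_bits_def mult_2)
  ultimately show ?thesis using small_mono by blast
qed

text \<open>Entries of \<open>vert\<close> are counted in the instance size only for actual
  vertices, so the values at vertex 0 are bounded only if there is one.\<close>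

lemma small_affine_coefs:
  assumes "instance_size I \<le> w" "m \<le> n_unc I" "r < n_con I"
  shows "v < n_vert I \<Longrightarrow> small (affine_upto (\<lambda>l. b_coef I l r) (vert I v) m) (val_bits w)"
    and "0 < n_vert I \<Longrightarrow> j < n_x I \<Longrightarrow>
      small (affine_upto (\<lambda>l. A_coef I l r j) (vert I 0) m) (val_bits w)"
    and "0 < n_vert I \<Longrightarrow> j < n_y I \<Longrightarrow>
      small (affine_upto (\<lambda>l. B_coef I l r j) (vert I 0) m) (val_bits w)"
  using assms instance_size_coefs[OF assms(1)] instance_size_dims[OF assms(1)]
  by (auto intro!: small_affine_upto[where n = "n_unc I"] intro: small_of_size)

lemma small_vals:
  assumes "instance_size I \<le> w" "r < n_con I"
  shows "v < n_vert I \<Longrightarrow> small (b_val I v r) (val_bits w)"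
    and "0 < n_vert I \<Longrightarrow> j < n_x I \<Longrightarrow> small (A_val I r j) (val_bits w)"
    and "0 < n_vert I \<Longrightarrow> j < n_y I \<Longrightarrow> small (B_val I r j) (val_bits w)"
  using small_affine_coefs[OF assms(1) order_refl assms(2)]
  by (auto simp: b_val_def A_val_def B_val_def)

lemma val_bits_ge: "w \<le> val_bits w" for w :: nat
  by (simp add: val_bits_def)

lemma small_row:
  assumes "instance_size I \<le> w" "u < n_vert I" "v < n_vert I" "r < n_con I" "s < n_con I"
  shows "small (row_p I lab u v r s) (2 * val_bits w + 1)"
    and "small (row_q I lab u v r s) (2 * val_bits w + 1)"
    and "small (row_rhs I lab u v r s) (4 * val_bits w + 1)"
proof -
  note b = small_vals(1)[OF assms(1)]
  have *: "small (b_val I v r - b_val I v' r') (2 * val_bits w + 1)"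
    if "r < n_con I" "r' < n_con I" "v < n_vert I" "v' < n_vert I" for r r' v v'
    using small_diff[OF b b, of r v r' v'] that by (simp add: mult_2)
  show "small (row_p I lab u v r s) (2 * val_bits w + 1)"
    "small (row_q I lab u v r s) (2 * val_bits w + 1)"
    using * assms by (auto simp: row_p_def row_q_def small_0 small_1)
  have "small (b_val I v r * b_val I u s - b_val I u r * b_val I v s) (4 * val_bits w + 1)"
    by (rule small_mono[OF small_diff[OF small_mult[OF b b] small_mult[OF b b]]]) (use assms in auto)
  moreover have "small (b_val I v r) (4 * val_bits w + 1)" if "r < n_con I" "v < n_vert I" for r v
    by (rule small_mono[OF b]) (use that in auto)
  ultimately show "small (row_rhs I lab u v r s) (4 * val_bits w + 1)"
    using assms by (auto simp: row_rhs_def small_0)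
qed

lemma small_pair_entry:
  assumes "instance_size I \<le> w" "0 < n_vert I" "r < n_con I" "s < n_con I"
    and pq: "small p (2 * val_bits w + 1)" "small q (2 * val_bits w + 1)"
  shows "small (pair_entry I p q r s j) (bits w)"
proof -
  have *: "k \<le> 6 * val_bits w + 3 \<Longrightarrow> k \<le> bits w" for k
    by (simp add: bits_def)
  note vals = small_vals(2,3)[OF assms(1) _ assms(2)]
  have A: "small (p * A_val I r j + q * A_val I s j) (bits w)" if "j < n_x I"
    by (rule small_mono[OF small_add[OF small_mult[OF pq(1) vals(1)] small_mult[OF pq(2) vals(1)]] *])
      (use assms that in auto)
  have B: "small (p * B_val I r j) (bits w)" "small (q * B_val I s j) (bits w)" if "j < n_y I" for j
    by (rule small_mono[OF small_mult[OF pq(1) vals(2)] *] small_mono[OF small_mult[OF pq(2) vals(2)] *];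
        use assms that in simp)+
  have "j - n_x I - n_y I < n_y I" if "j < n_x I + 2 * n_y I" "\<not> j < n_x I + n_y I"
    using that by auto
  then show ?thesis using A B by (auto simp: pair_entry_def small_0)
qed

lemma small_label_lp:
  assumes I: "instance_size I \<le> w"
  shows "i < rows (label_lp I lab) \<Longrightarrow> j < cols (label_lp I lab) \<Longrightarrow>
      small (lhs (label_lp I lab) i j) (bits w)"
    and "i < rows (label_lp I lab) \<Longrightarrow> small (rhs (label_lp I lab) i) (bits w)"
    and "j < cols (label_lp I lab) \<Longrightarrow> small (obj (label_lp I lab) j) (bits w)"
proof -
  have w: "w \<le> bits w" using val_bits_ge[of w] by (simp add: bits_def)
  have coef: "small (c_coef I j) (bits w)" if "j < n_x I" for j
    using instance_size_coefs(4)[OF I that] w by (intro small_of_size) simp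
  have coef': "small (d_coef I j) (bits w)" if "j < n_y I" for j
    using instance_size_coefs(5)[OF I that] w by (intro small_of_size) simp
  show "small (obj (label_lp I lab) j) (bits w)" if "j < cols (label_lp I lab)"
    using coef by (simp add: label_lp_def small_0 small_1)
  have vert: "0 < n_vert I" if "i < pair_rows I" for i
    using that by (auto simp: pair_rows_def intro: gr0I)
  show "small (rhs (label_lp I lab) i) (bits w)" if "i < rows (label_lp I lab)"
  proof (cases "i < pair_rows I")
    case True
    have "4 * val_bits w + 1 \<le> bits w" by (simp add: bits_def)
    then show ?thesis
      using True small_mono[OF small_row(3)[OF I row_of_bounds[OF True]]]
      by (simp add: label_lp_def row_of_def)
  qed (simp add: label_lp_def small_0)
  show "small (lhs (label_lp I lab) i j) (bits w)"
    if "i < rows (label_lp I lab)" "j < cols (label_lp I lab)"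
  proof (cases "i < pair_rows I")
    case True
    note b = row_of_bounds[OF True]
    show ?thesis
      using True small_pair_entry[OF I vert[OF True] b(3,4) small_row(1,2)[OF I b]]
      by (simp add: label_lp_def row_of_def)
  next
    case False
    have "j - n_x I - n_y I < n_y I" if "j < n_x I + 2 * n_y I" "\<not> j < n_x I + n_y I"
      using that by auto
    then show ?thesis using False coef' small_uminus[OF small_1]
      by (auto simp: label_lp_def epigraph_entry_def small_0)
  qed
qed

lemma pair_rows_le: "instance_size I \<le> w \<Longrightarrow> pair_rows I \<le> w ^ 4"
  unfolding pair_rows_def power4_eq_xxxx
  by (intro mult_mono) (simp_all add: instance_size_dims)

lemma label_lp_dims:
  assumes "instance_size I \<le> w"
  shows "rows (label_lp I lab) \<le> dim_bound w" "cols (label_lp I lab) \<le> dim_bound w"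
  using pair_rows_le[OF assms] instance_size_dims[OF assms]
  by (simp_all add: label_lp_def dim_bound_def)

text \<open>The arrays from which a program is read may hold anything outside its dimensions, so the
  program solved can be identified with that of a labelling only within them.\<close>

definition same_lp :: "lin_prog \<Rightarrow> lin_prog \<Rightarrow> bool" where
  "same_lp P P' \<longleftrightarrow> rows P = rows P' \<and> cols P = cols P' \<and>
     (\<forall>i<rows P. \<forall>j<cols P. lhs P i j = lhs P' i j) \<and> (\<forall>i<rows P. rhs P i = rhs P' i) \<and>
     (\<forall>j<cols P. obj P j = obj P' j \<and> integral P j = integral P' j)"

lemma same_lp_imp_eq:
  assumes "same_lp P P'"
  shows "lp_feasible P = lp_feasible P'" "lp_objective P = lp_objective P'"
    "lp_size P = lp_size P'" "is_pure_lp P = is_pure_lp P'"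
  using assms
  by (auto simp: same_lp_def lp_feasible_def lp_objective_def lp_size_def is_pure_lp_def fun_eq_iff)

lemma lp_size_label_lp:
  assumes "instance_size I \<le> w"
  shows "lp_size (label_lp I lab) \<le> lp_bound w"
proof -
  let ?P = "label_lp I lab"
  note dims = label_lp_dims[OF assms, of lab]
  have "(\<Sum>i<rows ?P. \<Sum>j<cols ?P. rat_size (lhs ?P i j)) \<le> (\<Sum>i<rows ?P. \<Sum>j<cols ?P. cell_size w)"
    using small_label_lp(1)[OF assms] by (intro sum_mono rat_size_small) auto
  also have "\<dots> = rows ?P * cols ?P * cell_size w" by simp
  also have "\<dots> \<le> dim_bound w * dim_bound w * cell_size w"
    using dims by (intro mult_mono) auto
  finally have 1: "(\<Sum>i<rows ?P. \<Sum>j<cols ?P. rat_size (lhs ?P i j))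
    \<le> dim_bound w * dim_bound w * cell_size w" .
  have "(\<Sum>i<rows ?P. rat_size (rhs ?P i)) \<le> (\<Sum>i<rows ?P. cell_size w)"
    using small_label_lp(2)[OF assms] by (intro sum_mono rat_size_small) auto
  also have "\<dots> \<le> dim_bound w * cell_size w" using dims by simp
  finally have 2: "(\<Sum>i<rows ?P. rat_size (rhs ?P i)) \<le> dim_bound w * cell_size w" .
  have "(\<Sum>j<cols ?P. rat_size (obj ?P j)) \<le> (\<Sum>j<cols ?P. cell_size w)"
    using small_label_lp(3)[OF assms] by (intro sum_mono rat_size_small) auto
  also have "\<dots> \<le> dim_bound w * cell_size w" using dims by simp
  finally have 3: "(\<Sum>j<cols ?P. rat_size (obj ?P j)) \<le> dim_bound w * cell_size w" .
  show ?thesis using 1 2 3 dims unfolding lp_size_def lp_bound_def by linarith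
qed

lemma is_pure_label_lp: "continuous_variables I \<Longrightarrow> is_pure_lp (label_lp I lab)"
  by (auto simp: continuous_variables_def is_pure_lp_def label_lp_def)

lemma bounds_poly [simp]:
  fixes z :: nat
  shows "poly (lp_bound [:0, 1:]) z = lp_bound z" "poly (fill_time [:0, 1:]) z = fill_time z"
    "poly (cell_size [:0, 1:]) z = cell_size z"
proof -
  have v: "poly (val_bits [:0, 1:]) z = val_bits z"
    by (simp add: val_bits_def algebra_simps del: One_nat_def)
  have b: "poly (bits [:0, 1:]) z = bits z"
    by (simp add: bits_def v algebra_simps del: One_nat_def)
  show c: "poly (cell_size [:0, 1:]) z = cell_size z"
    by (simp add: cell_size_def b del: One_nat_def)
  have d: "poly (dim_bound [:0, 1:]) z = dim_bound z"
    by (simp add: dim_bound_def algebra_simps del: One_nat_def)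
  show "poly (lp_bound [:0, 1:]) z = lp_bound z" "poly (fill_time [:0, 1:]) z = fill_time z"
    by (simp_all add: lp_bound_def fill_time_def c d del: One_nat_def)
qed

lemma bounds_mono:
  fixes w w' :: nat
  assumes "w \<le> w'"
  shows "val_bits w \<le> val_bits w'" "bits w \<le> bits w'" "cell_size w \<le> cell_size w'"
    "dim_bound w \<le> dim_bound w'" "fill_time w \<le> fill_time w'" "lp_bound w \<le> lp_bound w'"
proof -
  show v: "val_bits w \<le> val_bits w'"
    using assms unfolding val_bits_def by (intro add_mono mult_mono) auto
  show b: "bits w \<le> bits w'"
    using assms v unfolding bits_def by (intro add_mono mult_mono power_mono) auto
  show c: "cell_size w \<le> cell_size w'"
    using b unfolding cell_size_def by (intro add_mono mult_mono) auto
  show d: "dim_bound w \<le> dim_bound w'"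
    using assms unfolding dim_bound_def by (intro add_mono mult_mono power_mono) auto
  show "fill_time w \<le> fill_time w'"
    using c d unfolding fill_time_def by (intro add_mono mult_mono power_mono) auto
  show "lp_bound w \<le> lp_bound w'"
    using c d unfolding lp_bound_def by (intro add_mono mult_mono) auto
qed

section \<open>Filling the arrays\<close>

lemma small_of_nat_bits: "n \<le> dim_bound w \<Longrightarrow> small (of_nat n) (bits w)"
proof (rule small_of_nat)
  assume "n \<le> dim_bound w"
  also have "\<dots> \<le> bits w" by (simp add: dim_bound_def bits_def val_bits_def)
  also have "\<dots> \<le> 2 ^ bits w" by (simp add: less_imp_le)
  finally show "n \<le> 2 ^ bits w" .
qed

text \<open>Gives the same price to every table whose loops have polynomial length. The table of
  floors is exponentially long and is treated by \<open>runs_fill\<close> directly.\<close>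

lemma runs_fill_bounded:
  fixes f :: "nat \<Rightarrow> nat \<Rightarrow> nat \<Rightarrow> rat" and ix :: "nat \<Rightarrow> nat \<Rightarrow> nat list"
  assumes a: "a \<notin> {''i'', ''j'', ''l''}"
    and na: "\<And>s'. agree (fill_vars a) s s' \<Longrightarrow> eval e1 s' = of_nat na"
    and nb: "\<And>s'. agree (fill_vars a) s s' \<Longrightarrow> eval e2 s' = of_nat nb"
    and nc: "\<And>s' i j. agree (fill_vars a) s s' \<Longrightarrow> i < na \<Longrightarrow> j < nb \<Longrightarrow>
      s' ''i'' [] = of_nat i \<Longrightarrow> s' ''j'' [] = of_nat j \<Longrightarrow> eval e3 s' = of_nat (nc i j)"
    and index: "\<And>s' i j. agree (fill_vars a) s s' \<Longrightarrow> i < na \<Longrightarrow> j < nb \<Longrightarrow>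
      s' ''i'' [] = of_nat i \<Longrightarrow> s' ''j'' [] = of_nat j \<Longrightarrow>
      map (\<lambda>e. nat \<lfloor>eval e s'\<rfloor>) es = ix i j"
    and inj: "\<And>i j i' j'. i < na \<Longrightarrow> i' < na \<Longrightarrow> j < nb \<Longrightarrow> j' < nb \<Longrightarrow> ix i j = ix i' j' \<Longrightarrow>
      i = i' \<and> j = j'"
    and start: "\<And>s' i j. agree (fill_vars a) s s' \<Longrightarrow> i < na \<Longrightarrow> j < nb \<Longrightarrow>
      s' ''i'' [] = of_nat i \<Longrightarrow> s' ''j'' [] = of_nat j \<Longrightarrow> eval d0 s' = f i j 0"
    and step: "\<And>s' i j l. agree (fill_vars a) s s' \<Longrightarrow> i < na \<Longrightarrow> j < nb \<Longrightarrow> l < nc i j \<Longrightarrow>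
      s' ''i'' [] = of_nat i \<Longrightarrow> s' ''j'' [] = of_nat j \<Longrightarrow> s' ''l'' [] = of_nat l \<Longrightarrow>
      s' a (ix i j) = f i j l \<Longrightarrow> eval d1 s' = f i j (Suc l)"
    and size: "\<And>i j l. i < na \<Longrightarrow> j < nb \<Longrightarrow> l \<le> nc i j \<Longrightarrow> small (f i j l) (bits w)"
    and dims: "na \<le> dim_bound w" "nb \<le> dim_bound w"
      "\<And>i j. i < na \<Longrightarrow> j < nb \<Longrightarrow> nc i j \<le> dim_bound w"
    and result: "\<And>s'. agree (fill_vars a) s s' \<Longrightarrow>
      \<forall>i<na. \<forall>j<nb. s' a (ix i j) = f i j (nc i j) \<Longrightarrow> R s'"
  shows "runs solver (fill a e1 e2 e3 es d0 d1) s (fill_time w)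
    (\<lambda>s'. agree (fill_vars a) s s' \<and> R s')"
proof -
  have counters: "rat_size (of_nat k) \<le> cell_size w" if "k \<le> na \<or> k \<le> nb \<or> k \<le> dim_bound w" for k
    using that dims by (intro rat_size_small small_of_nat_bits) auto
  have sizes: "rat_size (f i j l) \<le> cell_size w" if "i < na" "j < nb" "l \<le> nc i j" for i j l
    using size[OF that] by (rule rat_size_small)
  have "(na + 1) * ((nb + 1) * ((dim_bound w + 1) * (5 * cell_size w + 8))) \<le> fill_time w"
    unfolding fill_time_def power3_eq_cube mult.assoc using dims by (intro mult_le_mono) auto
  with runs_fill[OF a na nb nc index inj start step sizes counters dims(3)] show ?thesis
    by (rule runs_weaken) (use result in auto)
qed

text \<open>
  Expressions have no integer division, but array indices are rounded down, so that an array
  \<open>''id''\<close> with the entries \<open>0, 1, 2, \<dots>\<close> computes floors.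
\<close>

definition floor_div :: "expr \<Rightarrow> expr \<Rightarrow> expr" where
  "floor_div a b = Cell ''id'' [Divide a b]"

definition modulo :: "expr \<Rightarrow> expr \<Rightarrow> expr" where
  "modulo a b = Minus a (Times b (floor_div a b))"

text \<open>Both branches are evaluated, which is harmless because \<open>eval\<close> is total: the
  branch not selected yields some rational, and this is multiplied by 0.\<close>

definition ite :: "expr \<Rightarrow> expr \<Rightarrow> expr \<Rightarrow> expr" where
  "ite c a b = Plus (Times c a) (Times (Minus (Num 1) c) b)"

definition lt :: "expr \<Rightarrow> expr \<Rightarrow> expr" where
  "lt a b = Minus (Num 1) (Leq b a)"

definition eq :: "expr \<Rightarrow> expr \<Rightarrow> expr" where
  "eq a b = Times (Leq a b) (Leq b a)"

abbreviation V :: "string \<Rightarrow> expr" where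
  "V a \<equiv> Cell a []"

lemma eval_ite: "eval c s = of_bool C \<Longrightarrow> eval (ite c a b) s = (if C then eval a s else eval b s)"
  by (simp add: ite_def)

lemma eval_lt: "eval (lt a b) s = of_bool (eval a s < eval b s)"
  by (auto simp: lt_def)

lemma eval_eq: "eval (eq a b) s = of_bool (eval a s = eval b s)"
  by (auto simp: eq_def)

text \<open>Rounding an index to a natural number turns rational subtraction into truncated
  subtraction, so offsets within a block may be computed also for columns to its left.\<close>

lemma nat_floor_of_nat_diff: "nat \<lfloor>of_nat a - (of_nat b :: rat)\<rfloor> = a - b"
proof -
  have "of_nat a - (of_nat b :: rat) = of_int (int a - int b)" by simp
  then show ?thesis by (simp only: floor_of_int nat_minus_as_int)
qed

lemma nat_floor_of_nat_diff2: "nat \<lfloor>of_nat a - (of_nat b :: rat) - of_nat c\<rfloor> = a - b - c"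
proof -
  have "of_nat a - (of_nat b :: rat) - of_nat c = of_nat a - of_nat (b + c)" by simp
  then show ?thesis by (simp only: nat_floor_of_nat_diff diff_diff_left)
qed

text \<open>A quotient never exceeds its dividend, so a table longer than every dividend suffices.
  Division by zero gives 0 for rationals and for natural numbers alike.\<close>

lemma eval_floor_div:
  assumes "\<And>k. k < K \<Longrightarrow> s ''id'' [k] = of_nat k" and "eval a s = of_nat m" "eval b s = of_nat n" "m < K"
  shows "eval (floor_div a b) s = of_nat (m div n)"
proof -
  have "m div n < K" using assms(4) div_le_dividend[of m n] by linarith
  then have "s ''id'' [m div n] = of_nat (m div n)" by (rule assms(1))
  moreover have "nat \<lfloor>of_nat m / (of_nat n :: rat)\<rfloor> = m div n"
    by (simp only: floor_divide_of_nat_eq nat_int)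
  ultimately show ?thesis by (simp only: floor_div_def eval.simps list.map assms(2,3))
qed

lemma eval_modulo:
  assumes "\<And>k. k < K \<Longrightarrow> s ''id'' [k] = of_nat k" and "eval a s = of_nat m" "eval b s = of_nat n" "m < K"
  shows "eval (modulo a b) s = of_nat (m mod n)"
proof -
  have "eval (modulo a b) s = of_nat m - of_nat n * of_nat (m div n)"
    using eval_floor_div[OF assms] assms by (simp add: modulo_def)
  also have "\<dots> = of_nat (m mod n)"
    by (metis add_diff_cancel_left' mult_div_mod_eq of_nat_add of_nat_mult)
  finally show ?thesis .
qed

section \<open>Contents of the arrays\<close>

definition inputs :: "string set" where
  "inputs = {''n_unc'', ''n_x'', ''n_y'', ''n_con'', ''n_vert'', ''A'', ''B'', ''b'', ''c'', ''d'',
     ''vert'', ''int_x'', ''int_y''}"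

text \<open>The dividends that occur are masks, row numbers and quotients of these, all of which lie
  below this sum.\<close>

definition id_range :: "adapt_instance \<Rightarrow> nat" where
  "id_range I = 2 ^ n_vert I + pair_rows I"

text \<open>
  What each array of the program must contain. Without vertices \<open>vert I 0\<close> is not part of the input,
  whence the condition on \<open>''Av''\<close> and \<open>''Bv''\<close>. The last case is that of the inputs and of
  \<open>''result''\<close> before the search.
\<close>

definition content :: "adapt_instance \<Rightarrow> string \<Rightarrow> (nat list \<Rightarrow> rat) \<Rightarrow> bool" where
  "content I a f =
     (if a = ''pairs'' then f [] = of_nat (pair_rows I)
      else if a = ''rows'' then f [] = of_nat (pair_rows I + 2)
      else if a = ''cols'' then f [] = of_nat (n_x I + 2 * n_y I + 1)
      else if a = ''pow'' then \<forall>v\<le>n_vert I. f [v] = 2 ^ v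
      else if a = ''id'' then \<forall>k<id_range I. f [k] = of_nat k
      else if a = ''bv'' then \<forall>v<n_vert I. \<forall>r<n_con I. f [v, r] = b_val I v r
      else if a = ''Av'' then
        0 < n_vert I \<longrightarrow> (\<forall>r<n_con I. \<forall>j<n_x I. f [r, j] = A_val I r j)
      else if a = ''Bv'' then
        0 < n_vert I \<longrightarrow> (\<forall>r<n_con I. \<forall>j<n_y I. f [r, j] = B_val I r j)
      else if a = ''obj'' then
        \<forall>j<n_x I + 2 * n_y I + 1. f [j] = obj (label_lp I (\<lambda>_. False)) j
      else if a = ''integral'' then
        \<forall>j<n_x I + 2 * n_y I + 1. f [j] = of_bool (integral (label_lp I (\<lambda>_. False)) j)
      else f = load I a)"

lemma content_computed:
  "content I ''pairs'' f \<longleftrightarrow> f [] = of_nat (pair_rows I)"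
  "content I ''rows'' f \<longleftrightarrow> f [] = of_nat (pair_rows I + 2)"
  "content I ''cols'' f \<longleftrightarrow> f [] = of_nat (n_x I + 2 * n_y I + 1)"
  "content I ''pow'' f \<longleftrightarrow> (\<forall>v\<le>n_vert I. f [v] = 2 ^ v)"
  "content I ''id'' f \<longleftrightarrow> (\<forall>k<id_range I. f [k] = of_nat k)"
  "content I ''bv'' f \<longleftrightarrow> (\<forall>v<n_vert I. \<forall>r<n_con I. f [v, r] = b_val I v r)"
  "content I ''Av'' f \<longleftrightarrow>
    (0 < n_vert I \<longrightarrow> (\<forall>r<n_con I. \<forall>j<n_x I. f [r, j] = A_val I r j))"
  "content I ''Bv'' f \<longleftrightarrow>
    (0 < n_vert I \<longrightarrow> (\<forall>r<n_con I. \<forall>j<n_y I. f [r, j] = B_val I r j))"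
  "content I ''obj'' f \<longleftrightarrow>
    (\<forall>j<n_x I + 2 * n_y I + 1. f [j] = obj (label_lp I (\<lambda>_. False)) j)"
  "content I ''integral'' f \<longleftrightarrow>
    (\<forall>j<n_x I + 2 * n_y I + 1. f [j] = of_bool (integral (label_lp I (\<lambda>_. False)) j))"
  by (simp_all add: content_def)

lemma content_inputs: "a \<in> inputs \<Longrightarrow> content I a f \<longleftrightarrow> f = load I a"
  unfolding inputs_def by (elim insertE emptyE) (simp_all add: content_def)

definition okay :: "adapt_instance \<Rightarrow> string set \<Rightarrow> store \<Rightarrow> bool" where
  "okay I X s \<longleftrightarrow> (\<forall>a\<in>X. content I a (s a))"

lemma okay_agree: "okay I X s \<Longrightarrow> agree Y s s' \<Longrightarrow> X \<inter> Y = {} \<Longrightarrow> okay I X s'"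
  by (auto simp: okay_def agree_def disjoint_iff)

lemma okay_mono: "okay I X s \<Longrightarrow> Y \<subseteq> X \<Longrightarrow> okay I Y s"
  by (auto simp: okay_def)

lemma okayD: "okay I X s \<Longrightarrow> a \<in> X \<Longrightarrow> content I a (s a)"
  by (simp add: okay_def)

lemma okay_load: "okay I inputs (load I)"
  by (simp add: okay_def content_inputs)

lemma load_apply:
  "load I ''n_unc'' = scalar (of_nat (n_unc I))" "load I ''n_x'' = scalar (of_nat (n_x I))"
  "load I ''n_y'' = scalar (of_nat (n_y I))" "load I ''n_con'' = scalar (of_nat (n_con I))"
  "load I ''n_vert'' = scalar (of_nat (n_vert I))" "load I ''A'' = array3 (A_coef I)"
  "load I ''B'' = array3 (B_coef I)" "load I ''b'' = array2 (b_coef I)"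
  "load I ''c'' = array1 (c_coef I)" "load I ''d'' = array1 (d_coef I)"
  "load I ''vert'' = array2 (vert I)" "load I ''int_x'' = array1 (\<lambda>j. of_bool (int_x I j))"
  "load I ''int_y'' = array1 (\<lambda>j. of_bool (int_y I j))"
  by (simp_all add: load_def)

lemma okay_inputs:
  assumes "okay I inputs s"
  shows "s ''n_unc'' [] = of_nat (n_unc I)" "s ''n_x'' [] = of_nat (n_x I)"
    "s ''n_y'' [] = of_nat (n_y I)" "s ''n_con'' [] = of_nat (n_con I)"
    "s ''n_vert'' [] = of_nat (n_vert I)" "s ''A'' [l, r, j] = A_coef I l r j"
    "s ''B'' [l, r, j] = B_coef I l r j" "s ''b'' [l, r] = b_coef I l r"
    "s ''c'' [j] = c_coef I j" "s ''d'' [j] = d_coef I j" "s ''vert'' [v, l] = vert I v l"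
    "s ''int_x'' [j] = of_bool (int_x I j)" "s ''int_y'' [j] = of_bool (int_y I j)"
proof -
  have eq: "s a = load I a" if "a \<in> inputs" for a
    using okayD[OF assms that] by (simp only: content_inputs[OF that])
  have eqs: "s ''n_unc'' = load I ''n_unc''" "s ''n_x'' = load I ''n_x''"
    "s ''n_y'' = load I ''n_y''" "s ''n_con'' = load I ''n_con''" "s ''n_vert'' = load I ''n_vert''"
    "s ''A'' = load I ''A''" "s ''B'' = load I ''B''" "s ''b'' = load I ''b''"
    "s ''c'' = load I ''c''" "s ''d'' = load I ''d''" "s ''vert'' = load I ''vert''"
    "s ''int_x'' = load I ''int_x''" "s ''int_y'' = load I ''int_y''"
    by (rule eq; simp add: inputs_def)+
  show "s ''n_unc'' [] = of_nat (n_unc I)" "s ''n_x'' [] = of_nat (n_x I)"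
    "s ''n_y'' [] = of_nat (n_y I)" "s ''n_con'' [] = of_nat (n_con I)"
    "s ''n_vert'' [] = of_nat (n_vert I)" "s ''A'' [l, r, j] = A_coef I l r j"
    "s ''B'' [l, r, j] = B_coef I l r j" "s ''b'' [l, r] = b_coef I l r"
    "s ''c'' [j] = c_coef I j" "s ''d'' [j] = d_coef I j" "s ''vert'' [v, l] = vert I v l"
    "s ''int_x'' [j] = of_bool (int_x I j)" "s ''int_y'' [j] = of_bool (int_y I j)"
    by (simp_all add: eqs load_apply)
qed

text \<open>Lets the set of correct arrays grow by one per command, provided that the command spares
  those already computed.\<close>

lemma runs_okay:
  assumes "runs solver c s T (\<lambda>s'. agree Y s s' \<and> content I a (s' a))" "okay I X s" "X \<inter> Y = {}"
  shows "runs solver c s T (okay I (insert a X))"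
  using assms(1) by (rule runs_weaken) (use okay_agree[OF assms(2) _ assms(3)] in \<open>auto simp: okay_def\<close>)

lemma runs_okay_Assign:
  assumes "content I a (set_cell a [] (eval e s) s a)" "okay I X s" "a \<notin> X" "small (eval e s) (bits w)"
  shows "runs solver (Assign a [] e) s (1 + cell_size w) (okay I (insert a X))"
proof -
  have "okay I (insert a X) (set_cell a [] (eval e s) s)"
  proof -
    have "okay I X (set_cell a [] (eval e s) s)"
      by (rule okay_agree[OF assms(2) agree_set_cell[OF agree_refl singletonI]]) (use assms(3) in simp)
    then show ?thesis using assms(1) by (simp only: okay_def ball_simps simp_thms)
  qed
  then have "runs solver (Assign a [] e) s (1 + rat_size (eval e s)) (okay I (insert a X))"
    by (intro runs_Assign) simp
  then show ?thesis
    by (rule runs_weaken) (use rat_size_small[OF assms(4)] in auto)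
qed

lemma inputs_agree:
  assumes "okay I inputs s" "agree (fill_vars a) s s'" "a \<notin> inputs"
  shows "okay I inputs s'"
  using assms(1,2) by (rule okay_agree) (use assms(3) in \<open>auto simp: inputs_def fill_vars_def\<close>)

lemma val_bits_le_bits: "small r (val_bits w) \<Longrightarrow> small r (bits w)"
  by (erule small_mono) (simp add: bits_def)

lemma instance_dims_le:
  assumes "instance_size I \<le> w"
  shows "n_unc I \<le> dim_bound w" "n_x I \<le> dim_bound w" "n_y I \<le> dim_bound w"
    "n_con I \<le> dim_bound w" "Suc (n_vert I) \<le> dim_bound w" "n_vert I \<le> dim_bound w"
    "n_x I + 2 * n_y I + 1 \<le> dim_bound w" "pair_rows I + 2 \<le> dim_bound w"
  using instance_size_dims[OF assms] pair_rows_le[OF assms] by (simp_all add: dim_bound_def)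

section \<open>Tables computed once, before the search\<close>

definition fill_pow :: com where
  "fill_pow = fill ''pow'' (Num 1) (Plus (V ''n_vert'') (Num 1)) (V ''j'') [V ''j'']
     (Num 1) (Times (Num 2) (Cell ''pow'' [V ''j'']))"

text \<open>Powers are obtained by repeated doubling, so the innermost loop has length
  \<open>j\<close> in column \<open>j\<close>. The exponent \<open>n_vert I\<close> is included
  because its power is the number of masks.\<close>

lemma runs_fill_pow:
  assumes "okay I inputs s" "instance_size I \<le> w"
  shows "runs solver fill_pow s (fill_time w)
    (\<lambda>s'. agree (fill_vars ''pow'') s s' \<and> content I ''pow'' (s' ''pow''))"
  unfolding fill_pow_def
proof (rule runs_fill_bounded[where na = 1 and nb = "Suc (n_vert I)" and nc = "\<lambda>i j. j"
      and ix = "\<lambda>i j. [j]" and f = "\<lambda>i j l. 2 ^ l"])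
  fix s' assume "agree (fill_vars ''pow'') s s'"
  then have "okay I inputs s'" using inputs_agree[OF assms(1)] by (simp add: inputs_def)
  then show "eval (Plus (V ''n_vert'') (Num 1)) s' = of_nat (Suc (n_vert I))"
    by (simp add: okay_inputs)
next
  fix i j l :: nat assume "j < Suc (n_vert I)" "l \<le> j"
  then have "l \<le> bits w" using instance_size_dims[OF assms(2)] by (simp add: bits_def)
  then have "small (of_nat (2 ^ l)) (bits w)" by (intro small_of_nat power_increasing) auto
  then show "small (2 ^ l) (bits w)" by simp
next
  fix s' :: store
  assume "\<forall>i<1::nat. \<forall>j<Suc (n_vert I). s' ''pow'' [j] = 2 ^ j"
  then show "content I ''pow'' (s' ''pow'')" by (auto simp: content_computed less_Suc_eq_le)
qed (use instance_dims_le[OF assms(2)] in \<open>auto simp: numeral_eq_Suc\<close>)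

definition fill_id :: com where
  "fill_id = fill ''id'' (Num 1) (Plus (Cell ''pow'' [V ''n_vert'']) (V ''pairs'')) (Num 0) [V ''j'']
     (V ''j'') (Num 0)"

text \<open>The only table of exponential length, charged to the factor \<open>2 ^ n_vert I\<close>
  of the budget; its entries still have polynomially many bits.\<close>

lemma runs_fill_id:
  assumes "okay I (inputs \<union> {''pow'', ''pairs''}) s" "instance_size I \<le> w"
  shows "runs solver fill_id s (2 ^ n_vert I * fill_time w)
    (\<lambda>s'. agree (fill_vars ''id'') s s' \<and> content I ''id'' (s' ''id''))"
proof -
  have "runs solver fill_id s ((1 + 1) * ((id_range I + 1) * ((0 + 1) * (5 * cell_size w + 8))))
    (\<lambda>s'. agree (fill_vars ''id'') s s' \<and> (\<forall>i<1::nat. \<forall>j<id_range I. s' ''id'' [j] = of_nat j))"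
    unfolding fill_id_def
  proof (rule runs_fill[where ix = "\<lambda>i j. [j]" and f = "\<lambda>i j l. of_nat j" and na = 1
        and nb = "id_range I" and nc = "\<lambda>i j. 0" and m = 0])
    fix s' assume *: "agree (fill_vars ''id'') s s'"
    then have s': "okay I (inputs \<union> {''pow'', ''pairs''}) s'"
      using okay_agree[OF assms(1) *] by (simp add: inputs_def fill_vars_def)
    then have "okay I inputs s'" by (rule okay_mono) auto
    then show "eval (Plus (Cell ''pow'' [V ''n_vert'']) (V ''pairs'')) s' = of_nat (id_range I)"
      using okayD[OF s', of "''pow''"] okayD[OF s', of "''pairs''"]
      by (simp add: okay_inputs content_computed id_range_def)
  next
    have size: "rat_size (of_nat k) \<le> cell_size w" if "k \<le> id_range I" for k
    proof (rule rat_size_small, rule small_of_nat)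
      \<comment> \<open>A sum \<open>2 ^ a + b\<close> is at most \<open>2 ^ a * (b + 1)\<close>,
        hence at most \<open>2 ^ (a + b)\<close>: the number of bits is polynomial.\<close>
      have "id_range I \<le> 2 ^ n_vert I * (pair_rows I + 1)" by (simp add: id_range_def)
      also have "\<dots> \<le> 2 ^ n_vert I * 2 ^ pair_rows I"
        by (intro mult_le_mono2) (simp add: Suc_le_eq)
      also have "\<dots> = 2 ^ (n_vert I + pair_rows I)" by (simp add: power_add)
      also have "\<dots> \<le> 2 ^ bits w"
        using instance_size_dims[OF assms(2)] pair_rows_le[OF assms(2)]
        by (intro power_increasing) (auto simp: bits_def)
      finally show "k \<le> 2 ^ bits w" using that by simp
    qed
    then show "rat_size (of_nat j) \<le> cell_size w" if "j < id_range I" for j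
      using that by simp
    show "rat_size (of_nat k) \<le> cell_size w" if "k \<le> 1 \<or> k \<le> id_range I \<or> k \<le> 0" for k
    proof (rule size)
      have "1 \<le> id_range I" by (simp add: id_range_def Suc_le_eq)
      then show "k \<le> id_range I" using that by linarith
    qed
  qed auto
  then show ?thesis
  proof (rule runs_weaken)
    have "(1 + 1) * (id_range I + 1) \<le> 2 ^ n_vert I * (2 * (pair_rows I + 2))"
      using mult_le_mono1[of 1 "2 ^ n_vert I" "pair_rows I + 1"] by (simp add: id_range_def distrib_left)
    also have "\<dots> \<le> 2 ^ n_vert I * ((dim_bound w + 1) * (dim_bound w + 1) * (dim_bound w + 1))"
    proof (intro mult_le_mono2)
      have "2 * (pair_rows I + 2) \<le> (dim_bound w + 1) * (dim_bound w + 1) * 1"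
        using instance_dims_le(8)[OF assms(2)] unfolding mult_1_right
        by (intro mult_le_mono) (auto simp: dim_bound_def)
      also have "\<dots> \<le> (dim_bound w + 1) * (dim_bound w + 1) * (dim_bound w + 1)"
        by (intro mult_le_mono2) simp
      finally show "2 * (pair_rows I + 2) \<le> \<dots>" .
    qed
    finally show "(1 + 1) * ((id_range I + 1) * ((0 + 1) * (5 * cell_size w + 8)))
        \<le> 2 ^ n_vert I * fill_time w"
      unfolding fill_time_def power3_eq_cube
      by (metis (no_types, lifting) add_0 mult.assoc mult_1 mult_le_mono1)
  qed (auto simp: content_computed)
qed

definition fill_bv :: com where
  "fill_bv = fill ''bv'' (V ''n_vert'') (V ''n_con'') (V ''n_unc'') [V ''i'', V ''j'']
     (Cell ''b'' [Num 0, V ''j''])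
     (Plus (Cell ''bv'' [V ''i'', V ''j''])
       (Times (Cell ''b'' [Plus (V ''l'') (Num 1), V ''j'']) (Cell ''vert'' [V ''i'', V ''l''])))"

lemma affine_upto_0: "affine_upto a w 0 = a 0"
  by (simp add: affine_upto_def)

lemma affine_upto_Suc: "affine_upto a w (Suc m) = affine_upto a w m + a (Suc m) * w m"
  by (simp add: affine_upto_def add.assoc)

lemma runs_fill_bv:
  assumes "okay I inputs s" "instance_size I \<le> w"
  shows "runs solver fill_bv s (fill_time w)
    (\<lambda>s'. agree (fill_vars ''bv'') s s' \<and> content I ''bv'' (s' ''bv''))"
  unfolding fill_bv_def
proof (rule runs_fill_bounded[where na = "n_vert I" and nb = "n_con I" and nc = "\<lambda>i j. n_unc I"
      and ix = "\<lambda>i j. [i, j]" and f = "\<lambda>v r. affine_upto (\<lambda>l. b_coef I l r) (vert I v)"])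
  show "small (affine_upto (\<lambda>l. b_coef I l j) (vert I i) l) (bits w)"
    if "i < n_vert I" "j < n_con I" "l \<le> n_unc I" for i j l
    using small_affine_coefs(1)[OF assms(2)] that val_bits_le_bits by blast
qed (use instance_dims_le[OF assms(2)] in
    \<open>simp_all add: content_computed okay_inputs[OF inputs_agree[OF assms(1)]] inputs_def b_val_def
      affine_upto_Suc nat_add_distrib affine_upto_0\<close>)

text \<open>Multiplying the number of rows by a truth value leaves the table empty if there is no
  vertex; the numbers \<open>vert I 0 l\<close> could then be arbitrarily long.\<close>

definition fill_Av :: com where
  "fill_Av = fill ''Av'' (Times (V ''n_con'') (Leq (Num 1) (V ''n_vert''))) (V ''n_x'') (V ''n_unc'')
     [V ''i'', V ''j''] (Cell ''A'' [Num 0, V ''i'', V ''j''])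
     (Plus (Cell ''Av'' [V ''i'', V ''j''])
       (Times (Cell ''A'' [Plus (V ''l'') (Num 1), V ''i'', V ''j'']) (Cell ''vert'' [Num 0, V ''l''])))"

lemma runs_fill_Av:
  assumes "okay I inputs s" "instance_size I \<le> w"
  shows "runs solver fill_Av s (fill_time w)
    (\<lambda>s'. agree (fill_vars ''Av'') s s' \<and> content I ''Av'' (s' ''Av''))"
  unfolding fill_Av_def
proof (rule runs_fill_bounded[where na = "if 0 < n_vert I then n_con I else 0" and nb = "n_x I"
      and nc = "\<lambda>i j. n_unc I" and ix = "\<lambda>i j. [i, j]"
      and f = "\<lambda>r j. affine_upto (\<lambda>l. A_coef I l r j) (vert I 0)"])
  show "small (affine_upto (\<lambda>l. A_coef I l i j) (vert I 0) l) (bits w)"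
    if "i < (if 0 < n_vert I then n_con I else 0)" "j < n_x I" "l \<le> n_unc I" for i j l
    using small_affine_coefs(2)[OF assms(2)] that val_bits_le_bits by (auto split: if_splits)
qed (use instance_dims_le[OF assms(2)] in
    \<open>simp_all add: content_computed okay_inputs[OF inputs_agree[OF assms(1)]] inputs_def A_val_def
      affine_upto_Suc nat_add_distrib affine_upto_0 split: if_splits\<close>)

definition fill_Bv :: com where
  "fill_Bv = fill ''Bv'' (Times (V ''n_con'') (Leq (Num 1) (V ''n_vert''))) (V ''n_y'') (V ''n_unc'')
     [V ''i'', V ''j''] (Cell ''B'' [Num 0, V ''i'', V ''j''])
     (Plus (Cell ''Bv'' [V ''i'', V ''j''])
       (Times (Cell ''B'' [Plus (V ''l'') (Num 1), V ''i'', V ''j'']) (Cell ''vert'' [Num 0, V ''l''])))"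

lemma runs_fill_Bv:
  assumes "okay I inputs s" "instance_size I \<le> w"
  shows "runs solver fill_Bv s (fill_time w)
    (\<lambda>s'. agree (fill_vars ''Bv'') s s' \<and> content I ''Bv'' (s' ''Bv''))"
  unfolding fill_Bv_def
proof (rule runs_fill_bounded[where na = "if 0 < n_vert I then n_con I else 0" and nb = "n_y I"
      and nc = "\<lambda>i j. n_unc I" and ix = "\<lambda>i j. [i, j]"
      and f = "\<lambda>r j. affine_upto (\<lambda>l. B_coef I l r j) (vert I 0)"])
  show "small (affine_upto (\<lambda>l. B_coef I l i j) (vert I 0) l) (bits w)"
    if "i < (if 0 < n_vert I then n_con I else 0)" "j < n_y I" "l \<le> n_unc I" for i j l
    using small_affine_coefs(3)[OF assms(2)] that val_bits_le_bits by (auto split: if_splits)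
qed (use instance_dims_le[OF assms(2)] in
    \<open>simp_all add: content_computed okay_inputs[OF inputs_agree[OF assms(1)]] inputs_def B_val_def
      affine_upto_Suc nat_add_distrib affine_upto_0 split: if_splits\<close>)

definition end_y1 :: expr where
  "end_y1 = Plus (V ''n_x'') (V ''n_y'')"

definition end_y2 :: expr where
  "end_y2 = Plus (V ''n_x'') (Times (Num 2) (V ''n_y''))"

definition col_y1 :: expr where
  "col_y1 = Minus (V ''j'') (V ''n_x'')"

definition col_y2 :: expr where
  "col_y2 = Minus (Minus (V ''j'') (V ''n_x'')) (V ''n_y'')"

lemma eval_ends:
  assumes "okay I inputs s"
  shows "eval end_y1 s = of_nat (n_x I + n_y I)" "eval end_y2 s = of_nat (n_x I + 2 * n_y I)"
  using assms by (simp_all add: end_y1_def end_y2_def okay_inputs)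

lemma nat_floor_col:
  assumes "okay I inputs s" "s ''j'' [] = of_nat j"
  shows "nat \<lfloor>eval col_y1 s\<rfloor> = j - n_x I" "nat \<lfloor>eval col_y2 s\<rfloor> = j - n_x I - n_y I"
  using assms by (simp_all add: col_y1_def col_y2_def okay_inputs nat_floor_of_nat_diff nat_floor_of_nat_diff2)

definition by_column :: "expr \<Rightarrow> expr \<Rightarrow> expr \<Rightarrow> expr \<Rightarrow> expr" where
  "by_column x y1 y2 t =
     ite (lt (V ''j'') (V ''n_x'')) x (ite (lt (V ''j'') end_y1) y1 (ite (lt (V ''j'') end_y2) y2 t))"

lemma eval_by_column:
  assumes "okay I inputs s" "s ''j'' [] = of_nat j"
  shows "eval (by_column x y1 y2 t) s =
    (if j < n_x I then eval x s else if j < n_x I + n_y I then eval y1 s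
     else if j < n_x I + 2 * n_y I then eval y2 s else eval t s)"
proof -
  have 1: "eval (lt (V ''j'') (V ''n_x'')) s = of_bool (j < n_x I)"
    using assms by (simp add: eval_lt okay_inputs)
  have 2: "eval (lt (V ''j'') end_y1) s = of_bool (j < n_x I + n_y I)"
    unfolding eval_lt eval_ends[OF assms(1)] using assms(2) by (simp del: of_nat_add)
  have 3: "eval (lt (V ''j'') end_y2) s = of_bool (j < n_x I + 2 * n_y I)"
    unfolding eval_lt eval_ends[OF assms(1)] using assms(2)
    by (simp del: of_nat_add of_nat_mult of_nat_numeral)
  show ?thesis
    unfolding by_column_def eval_ite[OF 1] eval_ite[OF 2] eval_ite[OF 3] ..
qed

text \<open>The objective and the integrality flags are the same for all labellings, so they are
  filled once and described with a dummy labelling.\<close>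

definition fill_obj :: com where
  "fill_obj = fill ''obj'' (Num 1) (V ''cols'') (Num 0) [V ''j'']
     (by_column (Cell ''c'' [V ''j'']) (Num 0) (Num 0) (Num 1)) (Num 0)"

lemma runs_fill_obj:
  assumes "okay I (insert ''cols'' inputs) s" "instance_size I \<le> w"
  shows "runs solver fill_obj s (fill_time w)
    (\<lambda>s'. agree (fill_vars ''obj'') s s' \<and> content I ''obj'' (s' ''obj''))"
  unfolding fill_obj_def
proof (rule runs_fill_bounded[where na = 1 and nb = "n_x I + 2 * n_y I + 1" and nc = "\<lambda>i j. 0"
      and ix = "\<lambda>i j. [j]" and f = "\<lambda>i j l. obj (label_lp I (\<lambda>_. False)) j"])
  have cols: "okay I (insert ''cols'' inputs) s'" if "agree (fill_vars ''obj'') s s'" for s'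
    using okay_agree[OF assms(1) that] by (simp add: inputs_def fill_vars_def)
  then show "eval (V ''cols'') s' = of_nat (n_x I + 2 * n_y I + 1)"
    if "agree (fill_vars ''obj'') s s'" for s'
    using okayD[OF cols[OF that], of "''cols''"] by (simp add: content_computed)
  show "eval (by_column (Cell ''c'' [V ''j'']) (Num 0) (Num 0) (Num 1)) s'
      = obj (label_lp I (\<lambda>_. False)) j"
    if s': "agree (fill_vars ''obj'') s s'" and j: "s' ''j'' [] = of_nat j" for s' j
  proof -
    have "okay I inputs s'" using cols[OF s'] by (rule okay_mono) auto
    then show ?thesis using j by (simp add: eval_by_column okay_inputs label_lp_def)
  qed
  show "small (obj (label_lp I (\<lambda>_. False)) j) (bits w)" if "j < n_x I + 2 * n_y I + 1" for j
    using small_label_lp(3)[OF assms(2)] that by (simp add: label_lp_def)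
qed (use instance_dims_le[OF assms(2)] in \<open>simp_all add: content_computed\<close>)

definition fill_integral :: com where
  "fill_integral = fill ''integral'' (Num 1) (V ''cols'') (Num 0) [V ''j'']
     (by_column (Cell ''int_x'' [V ''j'']) (Cell ''int_y'' [col_y1]) (Cell ''int_y'' [col_y2]) (Num 0))
     (Num 0)"

lemma runs_fill_integral:
  assumes "okay I (insert ''cols'' inputs) s" "instance_size I \<le> w"
  shows "runs solver fill_integral s (fill_time w)
    (\<lambda>s'. agree (fill_vars ''integral'') s s' \<and> content I ''integral'' (s' ''integral''))"
  unfolding fill_integral_def
proof (rule runs_fill_bounded[where na = 1 and nb = "n_x I + 2 * n_y I + 1" and nc = "\<lambda>i j. 0"
      and ix = "\<lambda>i j. [j]" and f = "\<lambda>i j l. of_bool (integral (label_lp I (\<lambda>_. False)) j)"])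
  have cols: "okay I (insert ''cols'' inputs) s'" if "agree (fill_vars ''integral'') s s'" for s'
    using okay_agree[OF assms(1) that] by (simp add: inputs_def fill_vars_def)
  then show "eval (V ''cols'') s' = of_nat (n_x I + 2 * n_y I + 1)"
    if "agree (fill_vars ''integral'') s s'" for s'
    using okayD[OF cols[OF that], of "''cols''"] by (simp add: content_computed)
  show "eval (by_column (Cell ''int_x'' [V ''j'']) (Cell ''int_y'' [col_y1])
      (Cell ''int_y'' [col_y2]) (Num 0)) s' = of_bool (integral (label_lp I (\<lambda>_. False)) j)"
    if s': "agree (fill_vars ''integral'') s s'" and j: "s' ''j'' [] = of_nat j" for s' j
  proof -
    have "okay I inputs s'" using cols[OF s'] by (rule okay_mono) auto
    then show ?thesis using j
      by (simp add: eval_by_column okay_inputs label_lp_def nat_floor_col)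
  qed
  show "small (of_bool (integral (label_lp I (\<lambda>_. False)) j)) (bits w)" for j
    by (simp add: small_0 small_1)
qed (use instance_dims_le[OF assms(2)] in \<open>simp_all add: content_computed\<close>)

section \<open>Expressions for the rows of a program\<close>

definition row_u :: expr where
  "row_u = floor_div (V ''i'') (Times (Times (V ''n_vert'') (V ''n_con'')) (V ''n_con''))"

definition row_v :: expr where
  "row_v = modulo (floor_div (V ''i'') (Times (V ''n_con'') (V ''n_con''))) (V ''n_vert'')"

definition row_r :: expr where
  "row_r = modulo (floor_div (V ''i'') (V ''n_con'')) (V ''n_con'')"

definition row_s :: expr where
  "row_s = modulo (V ''i'') (V ''n_con'')"

text \<open>A binary digit of the mask, as the rational 0 or 1; with this convention products are
  conjunctions and subtraction from 1 is negation.\<close>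

definition label_exp :: "expr \<Rightarrow> expr" where
  "label_exp v = modulo (floor_div (V ''mask'') (Cell ''pow'' [v])) (Num 2)"

definition bv :: "expr \<Rightarrow> expr \<Rightarrow> expr" where
  "bv v r = Cell ''bv'' [v, r]"

definition conflict_exp :: expr where
  "conflict_exp = Times (Times (label_exp row_u) (Minus (Num 1) (label_exp row_v)))
     (Times (lt (bv row_u row_r) (bv row_v row_r)) (lt (bv row_v row_s) (bv row_u row_s)))"

definition row_p_exp :: expr where
  "row_p_exp = ite (eq row_u row_v) (Minus (Num 1) (label_exp row_u))
     (ite conflict_exp (Minus (bv row_u row_s) (bv row_v row_s)) (Num 0))"

definition row_q_exp :: expr where
  "row_q_exp = ite (eq row_u row_v) (label_exp row_u)
     (ite conflict_exp (Minus (bv row_v row_r) (bv row_u row_r)) (Num 0))"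

definition row_rhs_exp :: expr where
  "row_rhs_exp = ite (eq row_u row_v) (ite (label_exp row_u) (bv row_u row_s) (bv row_u row_r))
     (ite conflict_exp
       (Minus (Times (bv row_v row_r) (bv row_u row_s)) (Times (bv row_u row_r) (bv row_v row_s)))
       (Num 0))"

definition lhs_exp :: expr where
  "lhs_exp = ite (lt (V ''i'') (V ''pairs''))
     (by_column
       (Plus (Times row_p_exp (Cell ''Av'' [row_r, V ''j'']))
         (Times row_q_exp (Cell ''Av'' [row_s, V ''j''])))
       (Times row_p_exp (Cell ''Bv'' [row_r, col_y1]))
       (Times row_q_exp (Cell ''Bv'' [row_s, col_y2]))
       (Num 0))
     (by_column (Num 0)
       (ite (eq (V ''i'') (V ''pairs'')) (Cell ''d'' [col_y1]) (Num 0))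
       (ite (eq (V ''i'') (V ''pairs'')) (Num 0) (Cell ''d'' [col_y2]))
       (Num (- 1)))"

definition prepared :: "string set" where
  "prepared = {''pairs'', ''rows'', ''cols'', ''pow'', ''id'', ''bv'', ''Av'', ''Bv'', ''obj'', ''integral''}
     \<union> inputs"

context
  fixes I s i k
  assumes okay: "okay I prepared s" and i: "s ''i'' [] = of_nat i" "i < pair_rows I"
    and k: "s ''mask'' [] = of_nat k" "k < 2 ^ n_vert I"
begin

private lemma okay_in: "okay I inputs s"
  using okay by (rule okay_mono) (simp only: prepared_def Un_upper2)

private lemma ids: "m < id_range I \<Longrightarrow> s ''id'' [m] = of_nat m"
  using okayD[OF okay, of "''id''"] by (simp add: prepared_def content_computed)

private lemma bounds:
  "i < id_range I" "k < id_range I" "i div m < id_range I" "k div m < id_range I"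
proof -
  show *: "i < id_range I" "k < id_range I" using i k by (simp_all add: id_range_def)
  show "i div m < id_range I" "k div m < id_range I"
    using *[THEN le_less_trans[OF div_le_dividend]] by auto
qed

private lemma eval_rows:
  "eval row_u s = of_nat (i div (n_vert I * n_con I * n_con I))"
  "eval row_v s = of_nat (i div (n_con I * n_con I) mod n_vert I)"
  "eval row_r s = of_nat (i div n_con I mod n_con I)"
  "eval row_s s = of_nat (i mod n_con I)"
  unfolding row_u_def row_v_def row_r_def row_s_def
  by (intro eval_modulo[where K = "id_range I" and s = s, OF ids] eval_floor_div[where K = "id_range I" and s = s, OF ids]; simp add: okay_inputs[OF okay_in] i bounds)+

private lemma eval_label_exp:
  assumes "eval e s = of_nat v" "v < n_vert I"
  shows "eval (label_exp e) s = of_bool (mask_label k v)"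
proof -
  have "s ''pow'' [v] = 2 ^ v"
    using okayD[OF okay, of "''pow''"] assms(2) by (simp add: prepared_def content_computed)
  then have "eval (floor_div (V ''mask'') (Cell ''pow'' [e])) s = of_nat (k div 2 ^ v)"
    using assms k bounds by (intro eval_floor_div[where K = "id_range I" and s = s, OF ids]) simp_all
  then have "eval (label_exp e) s = of_nat (k div 2 ^ v mod 2)"
    unfolding label_exp_def using bounds by (intro eval_modulo[where K = "id_range I" and s = s, OF ids]) simp_all
  then show ?thesis by (simp add: mask_label_def odd_iff_mod_2_eq_one of_bool_def)
qed

private lemma eval_bv:
  assumes "eval e s = of_nat v" "v < n_vert I" "eval e' s = of_nat r" "r < n_con I"
  shows "eval (bv e e') s = b_val I v r"
  using okayD[OF okay, of "''bv''"] assms by (simp add: prepared_def content_computed bv_def)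

private lemmas eval_label = eval_label_exp[OF eval_rows(1) row_of_bounds(1)[OF i(2)]]
  eval_label_exp[OF eval_rows(2) row_of_bounds(2)[OF i(2)]]

private lemmas eval_bvs =
  eval_bv[OF eval_rows(1) row_of_bounds(1)[OF i(2)] eval_rows(3) row_of_bounds(3)[OF i(2)]]
  eval_bv[OF eval_rows(1) row_of_bounds(1)[OF i(2)] eval_rows(4) row_of_bounds(4)[OF i(2)]]
  eval_bv[OF eval_rows(2) row_of_bounds(2)[OF i(2)] eval_rows(3) row_of_bounds(3)[OF i(2)]]
  eval_bv[OF eval_rows(2) row_of_bounds(2)[OF i(2)] eval_rows(4) row_of_bounds(4)[OF i(2)]]

private lemma eval_conflict: "eval conflict_exp s = of_bool (row_of (conflict I (mask_label k)) I i)"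
  by (simp add: conflict_exp_def eval_label eval_lt eval_bvs row_of_def conflict_def)

private lemma eval_same: "eval (eq row_u row_v) s = of_bool (row_of (\<lambda>u v r s. u = v) I i)"
  by (simp add: eval_eq eval_rows row_of_def)

lemma eval_row_p: "eval row_p_exp s = row_of (row_p I (mask_label k)) I i"
  unfolding row_p_exp_def eval_ite[OF eval_same] eval_ite[OF eval_conflict]
  by (simp add: eval_label eval_bvs row_of_def row_p_def)

lemma eval_row_q: "eval row_q_exp s = row_of (row_q I (mask_label k)) I i"
  unfolding row_q_exp_def eval_ite[OF eval_same] eval_ite[OF eval_conflict]
  by (simp add: eval_label eval_bvs row_of_def row_q_def)

lemma eval_row_rhs: "eval row_rhs_exp s = row_of (row_rhs I (mask_label k)) I i"
  unfolding row_rhs_exp_def eval_ite[OF eval_same] eval_ite[OF eval_conflict] eval_ite[OF eval_label(1)]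
  by (simp add: eval_bvs row_of_def row_rhs_def)

lemma eval_pair_columns:
  assumes j: "s ''j'' [] = of_nat j"
  shows "eval (by_column
       (Plus (Times row_p_exp (Cell ''Av'' [row_r, V ''j'']))
         (Times row_q_exp (Cell ''Av'' [row_s, V ''j''])))
       (Times row_p_exp (Cell ''Bv'' [row_r, col_y1]))
       (Times row_q_exp (Cell ''Bv'' [row_s, col_y2]))
       (Num 0)) s =
    row_of (\<lambda>u v r s. pair_entry I (row_p I (mask_label k) u v r s) (row_q I (mask_label k) u v r s) r s j) I i"
proof -
  \<comment> \<open>The existence of a row for a pair implies that there is a vertex, so the tables
    of matrix values are filled.\<close>
  have "0 < n_vert I" using i(2) by (auto simp: pair_rows_def intro: gr0I)
  then have vals: "s ''Av'' [r, j] = A_val I r j" if "r < n_con I" "j < n_x I" for r j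
    using okayD[OF okay, of "''Av''"] that by (simp add: prepared_def content_computed)
  have valsB: "s ''Bv'' [r, j] = B_val I r j" if "r < n_con I" "j < n_y I" for r j
    using okayD[OF okay, of "''Bv''"] that \<open>0 < n_vert I\<close>
    by (simp add: prepared_def content_computed)
  note bounds = row_of_bounds[OF i(2)]
  have "j - n_x I - n_y I < n_y I" if "j < n_x I + 2 * n_y I" "\<not> j < n_x I + n_y I"
    using that by auto
  moreover have "nat \<lfloor>eval row_r s\<rfloor> = i div n_con I mod n_con I" "nat \<lfloor>eval row_s s\<rfloor> = i mod n_con I"
    unfolding eval_rows by (simp_all only: floor_of_nat nat_int)
  ultimately show ?thesis
    unfolding eval_by_column[OF okay_in j]
    by (simp add: eval_row_p eval_row_q nat_floor_col[OF okay_in j] j vals valsB bounds row_of_def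
        pair_entry_def)
qed

end

lemma okay_scalar:
  assumes "okay I prepared s"
  shows "s ''pairs'' [] = of_nat (pair_rows I)" "s ''rows'' [] = of_nat (pair_rows I + 2)"
    "s ''cols'' [] = of_nat (n_x I + 2 * n_y I + 1)" "s ''pow'' [n_vert I] = 2 ^ n_vert I"
    "okay I inputs s"
proof -
  have "content I ''pairs'' (s ''pairs'')" "content I ''rows'' (s ''rows'')"
    "content I ''cols'' (s ''cols'')" "content I ''pow'' (s ''pow'')"
    by (rule okayD[OF assms]; simp add: prepared_def)+
  then show "s ''pairs'' [] = of_nat (pair_rows I)" "s ''rows'' [] = of_nat (pair_rows I + 2)"
    "s ''cols'' [] = of_nat (n_x I + 2 * n_y I + 1)" "s ''pow'' [n_vert I] = 2 ^ n_vert I"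
    by (simp_all add: content_computed)
  show "okay I inputs s" using assms by (rule okay_mono) (simp only: prepared_def Un_upper2)
qed

lemma eval_lhs_exp:
  assumes okay: "okay I prepared s" and i: "s ''i'' [] = of_nat i" "i < pair_rows I + 2"
    and j: "s ''j'' [] = of_nat j" "j < n_x I + 2 * n_y I + 1"
    and k: "s ''mask'' [] = of_nat k" "k < 2 ^ n_vert I"
  shows "eval lhs_exp s = lhs (label_lp I (mask_label k)) i j"
proof -
  note scalars = okay_scalar[OF okay]
  have lt: "eval (lt (V ''i'') (V ''pairs'')) s = of_bool (i < pair_rows I)"
    by (simp add: eval_lt i scalars)
  show ?thesis
  proof (cases "i < pair_rows I")
    case True
    then show ?thesis
      unfolding lhs_exp_def eval_ite[OF lt] eval_pair_columns[OF okay i(1) True k j(1)]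
      by (simp add: label_lp_def)
  next
    case False
    have eq: "eval (eq (V ''i'') (V ''pairs'')) s = of_bool (i = pair_rows I)"
      by (simp add: eval_eq i scalars)
    have "i - pair_rows I = 0 \<longleftrightarrow> i = pair_rows I" using False by auto
    then show ?thesis
      using False
      unfolding lhs_exp_def eval_ite[OF lt] eval_by_column[OF scalars(5) j(1)] eval_ite[OF eq]
      by (simp add: label_lp_def epigraph_entry_def okay_inputs[OF scalars(5)]
          nat_floor_col[OF scalars(5) j(1)])
  qed
qed

lemma prepared_agree:
  assumes "okay I prepared s" "agree X s s'" "prepared \<inter> X = {}"
  shows "okay I prepared s'"
  using assms by (rule okay_agree)

lemma prepared_disjoint:
  "prepared \<inter> fill_vars ''lhs'' = {}" "prepared \<inter> fill_vars ''rhs'' = {}"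
  "prepared \<inter> fill_vars ''val'' = {}" "prepared \<inter> fill_vars ''x'' = {}"
  "prepared \<inter> fill_vars ''y'' = {}"
  by (simp_all add: prepared_def inputs_def fill_vars_def)

section \<open>Tables rewritten for each labelling\<close>

definition fill_lhs :: com where
  "fill_lhs = fill ''lhs'' (V ''rows'') (V ''cols'') (Num 0) [V ''i'', V ''j''] lhs_exp (Num 0)"

lemma runs_fill_lhs:
  assumes okay: "okay I prepared s" and w: "instance_size I \<le> w"
    and k: "s ''mask'' [] = of_nat k" "k < 2 ^ n_vert I"
  shows "runs solver fill_lhs s (fill_time w)
    (\<lambda>s'. agree (fill_vars ''lhs'') s s' \<and> (\<forall>i<pair_rows I + 2. \<forall>j<n_x I + 2 * n_y I + 1.
       s' ''lhs'' [i, j] = lhs (label_lp I (mask_label k)) i j))"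
  unfolding fill_lhs_def
proof (rule runs_fill_bounded[where na = "pair_rows I + 2" and nb = "n_x I + 2 * n_y I + 1"
      and nc = "\<lambda>i j. 0" and ix = "\<lambda>i j. [i, j]" and f = "\<lambda>i j l. lhs (label_lp I (mask_label k)) i j"])
  fix s' assume s': "agree (fill_vars ''lhs'') s s'"
  note okay' = prepared_agree[OF okay s' prepared_disjoint(1)]
  show "eval (V ''rows'') s' = of_nat (pair_rows I + 2)"
    "eval (V ''cols'') s' = of_nat (n_x I + 2 * n_y I + 1)"
    using okay_scalar[OF okay'] by simp_all
  have "s' ''mask'' [] = of_nat k" using s' k by (simp add: agree_def fill_vars_def)
  then show "eval lhs_exp s' = lhs (label_lp I (mask_label k)) i j"
    if "i < pair_rows I + 2" "j < n_x I + 2 * n_y I + 1" "s' ''i'' [] = of_nat i" "s' ''j'' [] = of_nat j"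
    for i j
    using eval_lhs_exp[OF okay' that(3,1,4,2)] k by simp
next
  show "small (lhs (label_lp I (mask_label k)) i j) (bits w)"
    if "i < pair_rows I + 2" "j < n_x I + 2 * n_y I + 1" for i j
    using small_label_lp(1)[OF w] that by (simp add: label_lp_def)
qed (use instance_dims_le[OF w] in simp_all)

definition fill_rhs :: com where
  "fill_rhs = fill ''rhs'' (V ''rows'') (Num 1) (Num 0) [V ''i'']
     (ite (lt (V ''i'') (V ''pairs'')) row_rhs_exp (Num 0)) (Num 0)"

lemma runs_fill_rhs:
  assumes okay: "okay I prepared s" and w: "instance_size I \<le> w"
    and k: "s ''mask'' [] = of_nat k" "k < 2 ^ n_vert I"
  shows "runs solver fill_rhs s (fill_time w)
    (\<lambda>s'. agree (fill_vars ''rhs'') s s' \<and> (\<forall>i<pair_rows I + 2.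
       s' ''rhs'' [i] = rhs (label_lp I (mask_label k)) i))"
  unfolding fill_rhs_def
proof (rule runs_fill_bounded[where na = "pair_rows I + 2" and nb = 1 and nc = "\<lambda>i j. 0"
      and ix = "\<lambda>i j. [i]" and f = "\<lambda>i j l. rhs (label_lp I (mask_label k)) i"])
  fix s' assume s': "agree (fill_vars ''rhs'') s s'"
  note okay' = prepared_agree[OF okay s' prepared_disjoint(2)]
  show "eval (V ''rows'') s' = of_nat (pair_rows I + 2)"
    using okay_scalar[OF okay'] by simp_all
  have mask: "s' ''mask'' [] = of_nat k" using s' k by (simp add: agree_def fill_vars_def)
  show "eval (ite (lt (V ''i'') (V ''pairs'')) row_rhs_exp (Num 0)) s'
      = rhs (label_lp I (mask_label k)) i"
    if "i < pair_rows I + 2" "s' ''i'' [] = of_nat i" for i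
  proof -
    have "eval (lt (V ''i'') (V ''pairs'')) s' = of_bool (i < pair_rows I)"
      using that by (simp add: eval_lt okay_scalar[OF okay'])
    then show ?thesis
      using eval_row_rhs[OF okay' that(2) _ mask k(2)] by (simp add: eval_ite label_lp_def)
  qed
next
  show "small (rhs (label_lp I (mask_label k)) i) (bits w)" if "i < pair_rows I + 2" for i
    using small_label_lp(2)[OF w] that by (simp add: label_lp_def)
qed (use instance_dims_le[OF w] in simp_all)

definition prelude :: com where
  "prelude =
     Seq (Assign ''pairs'' [] (Times (Times (Times (V ''n_vert'') (V ''n_vert'')) (V ''n_con'')) (V ''n_con'')))
     (Seq (Assign ''rows'' [] (Plus (V ''pairs'') (Num 2)))
     (Seq (Assign ''cols'' [] (Plus end_y2 (Num 1)))
     (Seq fill_pow (Seq fill_id (Seq fill_bv (Seq fill_Av (Seq fill_Bv (Seq fill_obj fill_integral))))))))"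

lemma runs_prelude:
  assumes w: "instance_size I \<le> w"
  shows "runs solver prelude (load I)
    (2 ^ n_vert I * (3 * (1 + cell_size w) + 7 * fill_time w))
    (okay I (insert ''result'' prepared))"
proof -
  let ?X0 = "insert ''result'' inputs"
  let ?X1 = "insert ''pairs'' ?X0" let ?X2 = "insert ''rows'' ?X1" let ?X3 = "insert ''cols'' ?X2"
  let ?X4 = "insert ''pow'' ?X3" let ?X5 = "insert ''id'' ?X4" let ?X6 = "insert ''bv'' ?X5"
  let ?X7 = "insert ''Av'' ?X6" let ?X8 = "insert ''Bv'' ?X7" let ?X9 = "insert ''obj'' ?X8"
  note defs = inputs_def fill_vars_def
  have mono: "okay I inputs s" if "okay I X s" "inputs \<subseteq> X" for X s
    using that by (rule okay_mono)
  \<comment> \<open>The cell starts with the value 0, which stands for infeasibility: the correct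
    verdict on an empty set of labellings.\<close>
  have "content I ''result'' (load I ''result'')" by (simp add: content_def)
  then have "okay I ?X0 (load I)" using okay_load by (simp add: okay_def)
  then have 1: "runs solver (Assign ''pairs'' [] (Times (Times (Times (V ''n_vert'') (V ''n_vert''))
      (V ''n_con'')) (V ''n_con''))) (load I) (1 + cell_size w) (okay I ?X1)"
  proof (rule runs_okay_Assign[rotated])
    have e: "eval (Times (Times (Times (V ''n_vert'') (V ''n_vert'')) (V ''n_con'')) (V ''n_con''))
        (load I) = of_nat (pair_rows I)"
      by (simp add: okay_inputs[OF okay_load] pair_rows_def)
    show "content I ''pairs'' (set_cell ''pairs'' [] (eval (Times (Times (Times (V ''n_vert'')
        (V ''n_vert'')) (V ''n_con'')) (V ''n_con'')) (load I)) (load I) ''pairs'')"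
      unfolding e by (simp add: content_computed set_cell_apply)
    show "small (eval (Times (Times (Times (V ''n_vert'') (V ''n_vert'')) (V ''n_con'')) (V ''n_con''))
        (load I)) (bits w)"
      unfolding e using instance_dims_le(8)[OF w] by (intro small_of_nat_bits) simp
  qed (simp add: inputs_def)
  have 2: "runs solver (Assign ''rows'' [] (Plus (V ''pairs'') (Num 2))) s (1 + cell_size w) (okay I ?X2)"
    if "okay I ?X1 s" for s
    using that
  proof (rule runs_okay_Assign[rotated])
    have e: "eval (Plus (V ''pairs'') (Num 2)) s = of_nat (pair_rows I + 2)"
      using okayD[OF that, of "''pairs''"] by (simp add: content_computed)
    show "content I ''rows'' (set_cell ''rows'' [] (eval (Plus (V ''pairs'') (Num 2)) s) s ''rows'')"
      unfolding e by (simp add: content_computed set_cell_apply)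
    show "small (eval (Plus (V ''pairs'') (Num 2)) s) (bits w)"
      unfolding e using instance_dims_le(8)[OF w] by (intro small_of_nat_bits)
  qed (simp add: inputs_def)
  have 3: "runs solver (Assign ''cols'' [] (Plus end_y2 (Num 1))) s (1 + cell_size w) (okay I ?X3)"
    if "okay I ?X2 s" for s
    using that
  proof (rule runs_okay_Assign[rotated])
    have "okay I inputs s" using that by (rule mono) blast
    then have e: "eval (Plus end_y2 (Num 1)) s = of_nat (n_x I + 2 * n_y I + 1)"
      by (simp add: eval_ends)
    show "content I ''cols'' (set_cell ''cols'' [] (eval (Plus end_y2 (Num 1)) s) s ''cols'')"
      unfolding e by (simp add: content_computed set_cell_apply)
    show "small (eval (Plus end_y2 (Num 1)) s) (bits w)"
      unfolding e using instance_dims_le(7)[OF w] by (intro small_of_nat_bits)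
  qed (simp add: inputs_def)
  have 4: "runs solver fill_pow s (fill_time w) (okay I ?X4)" if "okay I ?X3 s" for s
    using that by (intro runs_okay[OF runs_fill_pow[OF mono w]]) (blast, simp_all add: defs)
  have 5: "runs solver fill_id s (2 ^ n_vert I * fill_time w) (okay I ?X5)" if "okay I ?X4 s" for s
    using that by (intro runs_okay[OF runs_fill_id[OF okay_mono[OF that] w]]) (blast, simp_all add: defs)
  have 6: "runs solver fill_bv s (fill_time w) (okay I ?X6)" if "okay I ?X5 s" for s
    using that by (intro runs_okay[OF runs_fill_bv[OF mono w]]) (blast, simp_all add: defs)
  have 7: "runs solver fill_Av s (fill_time w) (okay I ?X7)" if "okay I ?X6 s" for s
    using that by (intro runs_okay[OF runs_fill_Av[OF mono w]]) (blast, simp_all add: defs)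
  have 8: "runs solver fill_Bv s (fill_time w) (okay I ?X8)" if "okay I ?X7 s" for s
    using that by (intro runs_okay[OF runs_fill_Bv[OF mono w]]) (blast, simp_all add: defs)
  have 9: "runs solver fill_obj s (fill_time w) (okay I ?X9)" if "okay I ?X8 s" for s
    using that by (intro runs_okay[OF runs_fill_obj[OF okay_mono[OF that] w]]) (blast, simp_all add: defs)
  have 10: "runs solver fill_integral s (fill_time w) (okay I (insert ''integral'' ?X9))"
    if "okay I ?X9 s" for s
    using that by (intro runs_okay[OF runs_fill_integral[OF okay_mono[OF that] w]]) (blast, simp_all add: defs)
  let ?T = "(1 + cell_size w) + ((1 + cell_size w) + ((1 + cell_size w) + (fill_time w +
      (2 ^ n_vert I * fill_time w + (fill_time w + (fill_time w + (fill_time w + (fill_time w + fill_time w))))))))"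
  have "runs solver prelude (load I) ?T (okay I (insert ''integral'' ?X9))"
    unfolding prelude_def
    by (rule runs_Seq[OF 1 runs_Seq[OF 2 runs_Seq[OF 3 runs_Seq[OF 4 runs_Seq[OF 5
      runs_Seq[OF 6 runs_Seq[OF 7 runs_Seq[OF 8 runs_Seq[OF 9 10]]]]]]]]])
  then show ?thesis
  proof (rule runs_weaken)
    have "?T = 3 * (1 + cell_size w) + 6 * fill_time w + 2 ^ n_vert I * fill_time w" by simp
    also have "\<dots> \<le> 2 ^ n_vert I * (3 * (1 + cell_size w) + 6 * fill_time w) + 2 ^ n_vert I * fill_time w"
      by (intro add_right_mono) simp
    also have "\<dots> = 2 ^ n_vert I * (3 * (1 + cell_size w) + 7 * fill_time w)"
      by (simp add: algebra_simps)
    finally show "?T \<le> \<dots>" .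
  next
    fix s assume "okay I (insert ''integral'' ?X9) s"
    then show "okay I (insert ''result'' prepared) s"
      by (rule okay_mono) (auto simp: prepared_def)
  qed
qed

section \<open>Searching the labellings\<close>

abbreviation label_program :: "adapt_instance \<Rightarrow> nat \<Rightarrow> lin_prog" where
  "label_program I k \<equiv> label_lp I (mask_label k)"

text \<open>Invariant of the search, \<open>K\<close> being the set of masks already examined: the
  combined verdict on their programs. Once one of them is found unbounded, nothing is recorded about
  \<open>x\<close>, \<open>y\<close> and \<open>best\<close>.\<close>

definition outcome :: "adapt_instance \<Rightarrow> nat set \<Rightarrow> store \<Rightarrow> bool" where
  "outcome I K s \<longleftrightarrow>
     s ''result'' [] = 0 \<and> (\<forall>k\<in>K. \<forall>z. \<not> lp_feasible (label_program I k) z) \<or>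
     s ''result'' [] = 1 \<and>
       (\<exists>k\<in>K. \<forall>M. \<exists>z. lp_feasible (label_program I k) z \<and> lp_objective (label_program I k) z < M) \<or>
     s ''result'' [] = 2 \<and> (\<exists>z.
       (\<forall>j<n_x I. s ''x'' [j] = z j) \<and> (\<forall>i<2. \<forall>j<n_y I. s ''y'' [i, j] = y_part I z i j) \<and>
       (\<exists>k\<in>K. lp_feasible (label_program I k) (\<lambda>j. real_of_rat (z j)) \<and>
         lp_objective (label_program I k) (\<lambda>j. real_of_rat (z j)) = real_of_rat (s ''best'' [])) \<and>
       (\<forall>k\<in>K. \<forall>z'. lp_feasible (label_program I k) z' \<longrightarrow>
         real_of_rat (s ''best'' []) \<le> lp_objective (label_program I k) z'))"

lemma outcome_agree:
  assumes "outcome I K s" "agree X s s'" "X \<inter> {''result'', ''best'', ''x'', ''y''} = {}"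
  shows "outcome I K s'"
proof -
  have eqs: "s' ''result'' = s ''result''" "s' ''best'' = s ''best''" "s' ''x'' = s ''x''" "s' ''y'' = s ''y''"
    using assms(2,3) unfolding agree_def by blast+
  show ?thesis using assms(1) unfolding outcome_def eqs .
qed

lemma outcome_infeasible:
  assumes "outcome I {..<k} s" "\<And>z. \<not> lp_feasible (label_program I k) z"
  shows "outcome I {..<Suc k} s"
  using assms unfolding outcome_def lessThan_Suc by auto

lemma outcome_unbounded:
  assumes "s ''result'' [] = 1"
    "\<And>M. \<exists>z. lp_feasible (label_program I k) z \<and> lp_objective (label_program I k) z < M"
  shows "outcome I {..<Suc k} s"
  using assms unfolding outcome_def lessThan_Suc by blast

text \<open>Also covers the case that unboundedness has been recorded, which no later answer
  revokes.\<close>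

lemma outcome_not_better:
  assumes "outcome I {..<k} s"
    and "\<not> (s ''result'' [] = 0 \<or> s ''result'' [] = 2 \<and> v < s ''best'' [])"
    and "\<And>z'. lp_feasible (label_program I k) z' \<Longrightarrow> real_of_rat v \<le> lp_objective (label_program I k) z'"
  shows "outcome I {..<Suc k} s"
proof (cases "s ''result'' [] = 2")
  case True
  then have "real_of_rat (s ''best'' []) \<le> real_of_rat v" using assms(2) by (simp add: of_rat_less_eq)
  then have "real_of_rat (s ''best'' []) \<le> lp_objective (label_program I k) z'"
    if "lp_feasible (label_program I k) z'" for z'
    using assms(3)[OF that] by linarith
  then show ?thesis using assms(1) True unfolding outcome_def lessThan_Suc by auto
next
  case False
  then show ?thesis using assms(1,2) unfolding outcome_def lessThan_Suc by auto
qed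

lemma outcome_better:
  assumes "outcome I {..<k} s"
    and better: "s ''result'' [] = 0 \<or> s ''result'' [] = 2 \<and> v < s ''best'' []"
    and opt: "\<And>z'. lp_feasible (label_program I k) z' \<Longrightarrow> real_of_rat v \<le> lp_objective (label_program I k) z'"
    and z: "lp_feasible (label_program I k) (\<lambda>j. real_of_rat (z j))"
      "lp_objective (label_program I k) (\<lambda>j. real_of_rat (z j)) = real_of_rat v"
    and s': "s' ''result'' [] = 2" "s' ''best'' [] = v" "\<forall>j<n_x I. s' ''x'' [j] = z j"
      "\<forall>i<2. \<forall>j<n_y I. s' ''y'' [i, j] = y_part I z i j"
  shows "outcome I {..<Suc k} s'"
proof -
  have "real_of_rat v \<le> lp_objective (label_program I k') z'"
    if "k' < k" "lp_feasible (label_program I k') z'" for k' z'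
  proof -
    \<comment> \<open>A feasible program among those examined rules out the initial verdict, so the
      new value must have improved on \<open>best\<close>.\<close>
    have "s ''result'' [] \<noteq> 0" using assms(1) that unfolding outcome_def by auto
    then have "s ''result'' [] = 2" "v < s ''best'' []" using better by auto
    then have "real_of_rat (s ''best'' []) \<le> lp_objective (label_program I k') z'"
      using assms(1) that unfolding outcome_def by auto
    moreover have "real_of_rat v < real_of_rat (s ''best'' [])"
      using \<open>v < s ''best'' []\<close> by (simp add: of_rat_less)
    ultimately show ?thesis by linarith
  qed
  then have "\<forall>k'\<in>{..<Suc k}. \<forall>z'. lp_feasible (label_program I k') z' \<longrightarrow>
      real_of_rat v \<le> lp_objective (label_program I k') z'"
    using opt by (auto simp: less_Suc_eq)
  then show ?thesis unfolding outcome_def using z s' by auto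
qed

text \<open>Every feasible point of a labelled program gives a feasible solution of no larger value,
  and every feasible solution occurs with its own value in one of the programs. The verdict and the
  optimal value therefore carry over.\<close>

lemma adapt_solved_outcome:
  assumes det: "deterministic_A I" "deterministic_B I" and out: "outcome I {..<2 ^ n_vert I} s"
  shows "adapt_solved I 2 s"
proof -
  consider (0) "s ''result'' [] = 0"
    "\<forall>k\<in>{..<2 ^ n_vert I}. \<forall>z. \<not> lp_feasible (label_program I k) z"
  | (1) k where "s ''result'' [] = 1"
    "\<forall>M. \<exists>z. lp_feasible (label_program I k) z \<and> lp_objective (label_program I k) z < M"
  | (2) z k where "s ''result'' [] = 2" "\<forall>j<n_x I. s ''x'' [j] = z j"
      "\<forall>i<2. \<forall>j<n_y I. s ''y'' [i, j] = y_part I z i j"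
      "lp_feasible (label_program I k) (\<lambda>j. real_of_rat (z j))"
      "lp_objective (label_program I k) (\<lambda>j. real_of_rat (z j)) = real_of_rat (s ''best'' [])"
      "\<forall>k\<in>{..<2 ^ n_vert I}. \<forall>z'. lp_feasible (label_program I k) z' \<longrightarrow>
         real_of_rat (s ''best'' []) \<le> lp_objective (label_program I k) z'"
    using out unfolding outcome_def by blast
  then show ?thesis
  proof cases
    case 0
    have "adapt_infeasible I 2"
      unfolding adapt_infeasible_def using 0(2) adapt_feasible_imp_lp_feasible[OF det]
      by (metis lessThan_iff)
    then show ?thesis using 0 by (simp add: adapt_solved_def)
  next
    case 1
    have "\<exists>Om x y. adapt_feasible I 2 Om x y \<and> adapt_objective I 2 x y < M" for M
    proof -
      obtain z where "lp_feasible (label_program I k) z" "lp_objective (label_program I k) z < M"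
        using 1 by blast
      then show ?thesis using lp_feasible_imp_adapt_feasible[OF det] by (meson le_less_trans)
    qed
    then show ?thesis using 1 by (simp add: adapt_solved_def adapt_unbounded_def)
  next
    case 2
    let ?z = "\<lambda>j. real_of_rat (z j)" and ?x = "\<lambda>j. real_of_rat (s ''x'' [j])"
      and ?y = "\<lambda>i j. real_of_rat (s ''y'' [i, j])"
    have x: "?x j = ?z j" if "j < n_x I" for j using 2 that by simp
    have y: "?y i j = y_part I ?z i j" if "i < 2" "j < n_y I" for i j
      using 2 that by (simp add: y_part_def)
    obtain Om where "adapt_feasible I 2 Om ?z (y_part I ?z)"
      using lp_feasible_imp_adapt_feasible(1)[OF det 2(4)] by blast
    then have "adapt_feasible I 2 Om ?x ?y"
      unfolding adapt_feasible_def using x y by simp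
    moreover have "adapt_objective I 2 ?x ?y = adapt_objective I 2 ?z (y_part I ?z)"
      unfolding adapt_objective_2 using x y by simp
    moreover have "adapt_objective I 2 ?z (y_part I ?z) \<le> real_of_rat (s ''best'' [])"
      using lp_feasible_imp_adapt_feasible(2)[OF det 2(4)] 2(5) by simp
    moreover have "real_of_rat (s ''best'' []) \<le> adapt_objective I 2 x' y'"
      if "adapt_feasible I 2 Om' x' y'" for Om' x' y'
      using adapt_feasible_imp_lp_feasible[OF det that] 2(6) by (metis lessThan_iff)
    ultimately have "adapt_optimal I 2 ?x ?y"
      unfolding adapt_optimal_def by (auto intro: order_trans)
    then show ?thesis using 2 by (simp add: adapt_solved_def)
  qed
qed

section \<open>Processing an answer of the solver\<close>

definition fill_val :: com where
  "fill_val = fill ''val'' (Num 1) (Num 1) (V ''cols'') [Num 0] (Num 0)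
     (Plus (Cell ''val'' [Num 0]) (Times (Cell ''obj'' [V ''l'']) (Cell ''sol'' [V ''l''])))"

text \<open>Here \<open>w\<close> also has to bound the entries of the answer, which are multiplied
  and added. The labelling is arbitrary because all labellings share one objective.\<close>

lemma runs_fill_val:
  assumes okay: "okay I prepared s" and w: "instance_size I \<le> w"
    and sol: "\<And>j. j < n_x I + 2 * n_y I + 1 \<Longrightarrow> s ''sol'' [j] = z j"
    and z: "\<And>j. j < n_x I + 2 * n_y I + 1 \<Longrightarrow> rat_size (z j) \<le> w"
  shows "runs solver fill_val s (fill_time w)
    (\<lambda>s'. agree (fill_vars ''val'') s s' \<and>
      real_of_rat (s' ''val'' [0]) = lp_objective (label_lp I lab) (\<lambda>j. real_of_rat (z j)) \<and>
      small (s' ''val'' [0]) (bits w))"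
  unfolding fill_val_def
proof (rule runs_fill_bounded[where na = 1 and nb = 1 and nc = "\<lambda>i j. n_x I + 2 * n_y I + 1"
      and ix = "\<lambda>i j. [0]" and f = "\<lambda>i j l. \<Sum>m<l. obj (label_lp I lab) m * z m"])
  have obj: "small (obj (label_lp I lab) j) w" for j
    using instance_size_coefs(4)[OF w] by (auto simp: label_lp_def small_0 small_1 intro: small_of_size)
  show small: "small (\<Sum>m<l. obj (label_lp I lab) m * z m) (bits w)" if "l \<le> n_x I + 2 * n_y I + 1" for l
  proof -
    have "small (\<Sum>m<l. obj (label_lp I lab) m * z m) (l * (w + w + 1))"
      using that z by (intro small_sum small_mult obj small_of_size) simp
    moreover have "l * (w + w + 1) \<le> (3 * w + 1) * (w + w + 1)"
      using that instance_size_dims[OF w] by (intro mult_le_mono1) simp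
    moreover have "(3 * w + 1) * (w + w + 1) \<le> bits w"
      unfolding bits_def mult_2 by (rule le_add2)
    ultimately have "small (\<Sum>m<l. obj (label_lp I lab) m * z m) (l * (w + w + 1))"
      "l * (w + w + 1) \<le> bits w" by simp_all
    then show ?thesis by (rule small_mono)
  qed
  show "real_of_rat (s' ''val'' [0]) = lp_objective (label_lp I lab) (\<lambda>j. real_of_rat (z j)) \<and>
      small (s' ''val'' [0]) (bits w)"
    if "\<forall>i<1::nat. \<forall>j<1::nat. s' ''val'' [0] = (\<Sum>m<n_x I + 2 * n_y I + 1. obj (label_lp I lab) m * z m)"
    for s' :: store
  proof -
    have v: "s' ''val'' [0] = (\<Sum>m<n_x I + 2 * n_y I + 1. obj (label_lp I lab) m * z m)"
      using that by blast
    have "cols (label_lp I lab) = n_x I + 2 * n_y I + 1" by (simp add: label_lp_def)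
    then show ?thesis
      unfolding v using small[OF order_refl]
      by (simp only: lp_objective_def of_rat_sum of_rat_mult)
  qed
  fix s' assume s': "agree (fill_vars ''val'') s s'"
  note okay' = prepared_agree[OF okay s' prepared_disjoint(3)]
  show "eval (V ''cols'') s' = of_nat (n_x I + 2 * n_y I + 1)" using okay_scalar[OF okay'] by simp
  show "eval (Plus (Cell ''val'' [Num 0]) (Times (Cell ''obj'' [V ''l'']) (Cell ''sol'' [V ''l'']))) s'
      = (\<Sum>m<Suc l. obj (label_lp I lab) m * z m)"
    if "l < n_x I + 2 * n_y I + 1" "s' ''l'' [] = of_nat l"
      "s' ''val'' [0] = (\<Sum>m<l. obj (label_lp I lab) m * z m)" for l
  proof -
    have "s' ''obj'' [l] = obj (label_lp I (\<lambda>_. False)) l"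
      using okayD[OF okay', of "''obj''"] that by (simp add: prepared_def content_computed)
    also have "\<dots> = obj (label_lp I lab) l" by (simp add: label_lp_def)
    finally have "s' ''obj'' [l] = obj (label_lp I lab) l" .
    moreover have "s' ''sol'' [l] = z l"
      using s' sol[OF that(1)] by (simp add: agree_def fill_vars_def)
    ultimately show ?thesis using that by simp
  qed
qed (use instance_dims_le[OF w] in simp_all)

definition fill_x :: com where
  "fill_x = fill ''x'' (Num 1) (V ''n_x'') (Num 0) [V ''j''] (Cell ''sol'' [V ''j'']) (Num 0)"

definition fill_y :: com where
  "fill_y = fill ''y'' (Num 2) (V ''n_y'') (Num 0) [V ''i'', V ''j'']
     (Cell ''sol'' [Plus (Plus (V ''n_x'') (Times (V ''i'') (V ''n_y''))) (V ''j'')]) (Num 0)"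

lemma runs_fill_x:
  assumes okay: "okay I inputs s" and w: "instance_size I \<le> w"
    and sol: "\<And>j. j < n_x I + 2 * n_y I + 1 \<Longrightarrow> s ''sol'' [j] = z j"
    and z: "\<And>j. j < n_x I + 2 * n_y I + 1 \<Longrightarrow> small (z j) (bits w)"
  shows "runs solver fill_x s (fill_time w)
    (\<lambda>s'. agree (fill_vars ''x'') s s' \<and> (\<forall>j<n_x I. s' ''x'' [j] = z j))"
  unfolding fill_x_def
proof (rule runs_fill_bounded[where na = 1 and nb = "n_x I" and nc = "\<lambda>i j. 0"
      and ix = "\<lambda>i j. [j]" and f = "\<lambda>i j l. z j"])
  fix s' assume s': "agree (fill_vars ''x'') s s'"
  show "eval (V ''n_x'') s' = of_nat (n_x I)"
    using okay_inputs[OF inputs_agree[OF okay s']] by (simp add: inputs_def)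
  show "eval (Cell ''sol'' [V ''j'']) s' = z j" if "j < n_x I" "s' ''j'' [] = of_nat j" for j
    using s' sol[of j] that by (simp add: agree_def fill_vars_def)
qed (use instance_dims_le[OF w] z in simp_all)

lemma runs_fill_y:
  assumes okay: "okay I inputs s" and w: "instance_size I \<le> w"
    and sol: "\<And>j. j < n_x I + 2 * n_y I + 1 \<Longrightarrow> s ''sol'' [j] = z j"
    and z: "\<And>j. j < n_x I + 2 * n_y I + 1 \<Longrightarrow> small (z j) (bits w)"
  shows "runs solver fill_y s (fill_time w)
    (\<lambda>s'. agree (fill_vars ''y'') s s' \<and> (\<forall>i<2. \<forall>j<n_y I. s' ''y'' [i, j] = y_part I z i j))"
  unfolding fill_y_def
proof (rule runs_fill_bounded[where na = 2 and nb = "n_y I" and nc = "\<lambda>i j. 0"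
      and ix = "\<lambda>i j. [i, j]" and f = "\<lambda>i j l. y_part I z i j"])
  have bound: "n_x I + i * n_y I + j < n_x I + 2 * n_y I + 1" if "i < 2" "j < n_y I" for i j
    using that by (auto simp: less_2_cases_iff)
  fix s' assume s': "agree (fill_vars ''y'') s s'"
  note inp = okay_inputs[OF inputs_agree[OF okay s']]
  show "eval (V ''n_y'') s' = of_nat (n_y I)" using inp by (simp add: inputs_def)
  show "eval (Cell ''sol'' [Plus (Plus (V ''n_x'') (Times (V ''i'') (V ''n_y''))) (V ''j'')]) s'
      = y_part I z i j"
    if ij: "i < 2" "j < n_y I" "s' ''i'' [] = of_nat i" "s' ''j'' [] = of_nat j" for i j
  proof -
    have "eval (Plus (Plus (V ''n_x'') (Times (V ''i'') (V ''n_y''))) (V ''j'')) s'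
        = of_nat (n_x I + i * n_y I + j)"
      using ij inp by (simp add: inputs_def)
    then have "eval (Cell ''sol'' [Plus (Plus (V ''n_x'') (Times (V ''i'') (V ''n_y''))) (V ''j'')]) s'
        = s' ''sol'' [n_x I + i * n_y I + j]"
      by (simp only: eval.simps(2) list.map floor_of_nat nat_int)
    then show ?thesis
      using s' sol[OF bound[OF ij(1,2)]] by (simp add: agree_def fill_vars_def y_part_def)
  qed
next
  show "small (y_part I z i j) (bits w)" if "i < 2" "j < n_y I" for i j
    using that z by (auto simp: less_2_cases_iff y_part_def)
qed (use instance_dims_le[OF w] in \<open>simp_all add: dim_bound_def\<close>)

definition store_solution :: com where
  "store_solution = Seq (Assign ''best'' [] (Cell ''val'' [Num 0]))
     (Seq (Assign ''result'' [] (Num 2)) (Seq fill_x fill_y))"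

definition update_vars :: "string set" where
  "update_vars = {''val'', ''best'', ''result'', ''x'', ''y'', ''i'', ''j'', ''l''}"

lemma runs_Assign_scalar:
  assumes "eval e s = r" "small r (bits w)"
  shows "runs solver (Assign a [] e) s (1 + cell_size w) (\<lambda>s'. agree {a} s s' \<and> s' a [] = r)"
proof -
  have "runs solver (Assign a [] e) s (1 + rat_size (eval e s)) (\<lambda>s'. agree {a} s s' \<and> s' a [] = r)"
    using assms(1) by (intro runs_Assign) (auto simp: agree_def set_cell_apply)
  then show ?thesis
    by (rule runs_weaken) (use rat_size_small[OF assms(2)] assms(1) in auto)
qed

lemma runs_store_solution:
  assumes okay: "okay I prepared s" and w: "instance_size I \<le> w"
    and sol: "\<And>j. j < n_x I + 2 * n_y I + 1 \<Longrightarrow> s ''sol'' [j] = z j"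
    and z: "\<And>j. j < n_x I + 2 * n_y I + 1 \<Longrightarrow> small (z j) (bits w)"
    and v: "s ''val'' [0] = v" "small v (bits w)"
  shows "runs solver store_solution s (2 + 2 * cell_size w + 2 * fill_time w)
    (\<lambda>s'. agree update_vars s s' \<and> s' ''result'' [] = 2 \<and> s' ''best'' [] = v \<and>
      (\<forall>j<n_x I. s' ''x'' [j] = z j) \<and> (\<forall>i<2. \<forall>j<n_y I. s' ''y'' [i, j] = y_part I z i j))"
proof -
  have inp: "okay I inputs s'" if "agree update_vars s s'" for s'
    by (rule okay_agree[OF okay_scalar(5)[OF okay] that]) (simp add: inputs_def update_vars_def)
  have sol': "s' ''sol'' [j] = z j" if "agree update_vars s s'" "j < n_x I + 2 * n_y I + 1" for s' j
    using that sol by (simp add: agree_def update_vars_def)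
  have vars: "{''best''} \<subseteq> update_vars" "{''result''} \<subseteq> update_vars"
    "fill_vars ''x'' \<subseteq> update_vars" "fill_vars ''y'' \<subseteq> update_vars"
    by (simp_all add: update_vars_def fill_vars_def)
  note step = agree_trans[OF _ agree_mono]
  define R1 where "R1 s' \<longleftrightarrow> agree update_vars s s' \<and> s' ''best'' [] = v" for s'
  define R2 where "R2 s' \<longleftrightarrow> R1 s' \<and> s' ''result'' [] = 2" for s'
  define R3 where "R3 s' \<longleftrightarrow> R2 s' \<and> (\<forall>j<n_x I. s' ''x'' [j] = z j)" for s'
  have 1: "runs solver (Assign ''best'' [] (Cell ''val'' [Num 0])) s (1 + cell_size w) R1"
  proof (rule runs_weaken[OF runs_Assign_scalar[where r = v and w = w]])
    fix s' assume "agree {''best''} s s' \<and> s' ''best'' [] = v"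
    then show "R1 s'" using agree_mono[OF _ vars(1), of s s'] by (simp add: R1_def)
  qed (use v in simp_all)
  have 2: "runs solver (Assign ''result'' [] (Num 2)) s1 (1 + cell_size w) R2" if "R1 s1" for s1
  proof (rule runs_weaken[OF runs_Assign_scalar[where r = 2 and w = w]])
    show "small 2 (bits w)" using small_of_nat_bits[of 2 w] by (simp add: dim_bound_def)
    fix s' assume "agree {''result''} s1 s' \<and> s' ''result'' [] = 2"
    moreover from this have "s' ''best'' = s1 ''best''" by (simp add: agree_def)
    ultimately show "R2 s'" using that step[OF _ _ vars(2), of s s1 s'] by (simp add: R2_def R1_def)
  qed simp_all
  have 3: "runs solver fill_x s1 (fill_time w) R3" if "R2 s1" for s1
  proof -
    have a: "agree update_vars s s1" using that by (simp add: R2_def R1_def)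
    show ?thesis
    proof (rule runs_weaken[OF runs_fill_x[where z = z, OF inp[OF a] w sol'[OF a] z]])
      fix s' assume "agree (fill_vars ''x'') s1 s' \<and> (\<forall>j<n_x I. s' ''x'' [j] = z j)"
      moreover from this have "s' ''best'' = s1 ''best''" "s' ''result'' = s1 ''result''"
        by (simp_all add: agree_def fill_vars_def)
      ultimately show "R3 s'" using that step[OF a _ vars(3), of s'] by (simp add: R3_def R2_def R1_def)
    qed auto
  qed
  have 4: "runs solver fill_y s1 (fill_time w) (\<lambda>s'. agree update_vars s s' \<and> s' ''result'' [] = 2 \<and>
      s' ''best'' [] = v \<and> (\<forall>j<n_x I. s' ''x'' [j] = z j) \<and>
      (\<forall>i<2. \<forall>j<n_y I. s' ''y'' [i, j] = y_part I z i j))" if "R3 s1" for s1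
  proof -
    have a: "agree update_vars s s1" using that by (simp add: R3_def R2_def R1_def)
    show ?thesis
    proof (rule runs_weaken[OF runs_fill_y[where z = z, OF inp[OF a] w sol'[OF a] z]])
      fix s' assume s': "agree (fill_vars ''y'') s1 s' \<and>
        (\<forall>i<2. \<forall>j<n_y I. s' ''y'' [i, j] = y_part I z i j)"
      then have "s' ''best'' = s1 ''best''" "s' ''result'' = s1 ''result''" "s' ''x'' = s1 ''x''"
        by (simp_all add: agree_def fill_vars_def)
      then show "agree update_vars s s' \<and> s' ''result'' [] = 2 \<and> s' ''best'' [] = v \<and>
          (\<forall>j<n_x I. s' ''x'' [j] = z j) \<and> (\<forall>i<2. \<forall>j<n_y I. s' ''y'' [i, j] = y_part I z i j)"
        using that s' step[OF a _ vars(4), of s'] by (simp add: R3_def R2_def R1_def)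
    qed auto
  qed
  show ?thesis
    unfolding store_solution_def
    by (rule runs_weaken[OF runs_Seq[OF 1 runs_Seq[OF 2 runs_Seq[OF 3 4]]]]) auto
qed

definition better_exp :: expr where
  "better_exp = Plus (eq (V ''result'') (Num 0))
     (Times (eq (V ''result'') (Num 2)) (lt (Cell ''val'' [Num 0]) (V ''best'')))"

lemma eval_better_exp:
  "eval better_exp s \<noteq> 0 \<longleftrightarrow>
    s ''result'' [] = 0 \<or> s ''result'' [] = 2 \<and> s ''val'' [0] < s ''best'' []"
  by (simp add: better_exp_def eval_eq eval_lt)

definition update :: com where
  "update = Cond (eq (V ''status'') (Num 1)) (Assign ''result'' [] (Num 1))
     (Cond (eq (V ''status'') (Num 2)) (Seq fill_val (Cond better_exp store_solution Skip)) Skip)"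

definition update_time :: "'a::comm_semiring_1 \<Rightarrow> 'a" where
  "update_time w = 6 + 2 * cell_size w + 3 * fill_time w"

lemma rat_size_answer: "j < cols P \<Longrightarrow> rat_size (z j) \<le> answer_size P (Optimal z)"
  using le_sum_lessThan[of j "cols P" "\<lambda>j. rat_size (z j)"] by simp

text \<open>Depending on the answer, the verdict is kept, set to unbounded, or replaced if the new
  value is better. While the verdict is infeasibility, any optimum counts as better.\<close>

lemma runs_update:
  assumes okay: "okay I prepared s" and w: "instance_size I + answer_size P a \<le> w"
    and P: "same_lp P (label_program I k)" and valid: "valid_answer P a"
    and out: "outcome I {..<k} s"
  shows "runs solver update (write_answer P a s) (update_time w)
    (\<lambda>s'. agree update_vars (write_answer P a s) s' \<and> outcome I {..<Suc k} s')"
proof -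
  let ?s = "write_answer P a s"
  have agree: "agree {''status'', ''sol''} s ?s" by (cases a) (auto simp: agree_def)
  have okay': "okay I prepared ?s"
    using okay agree by (rule okay_agree) (simp add: prepared_def inputs_def)
  have out': "outcome I {..<k} ?s" using out agree by (rule outcome_agree) simp
  have I: "instance_size I \<le> w" using w by simp
  note P_eq = same_lp_imp_eq[OF P]
  have Skip: "runs solver Skip s' 1 (\<lambda>s'. agree update_vars ?s s' \<and> outcome I {..<Suc k} s')"
    if "agree update_vars ?s s'" "outcome I {..<Suc k} s'" for s'
    using that by (intro runs_Skip) simp
  show ?thesis
  proof (cases a)
    case Infeasible
    then have "?s ''status'' [] = 0" by simp
    then have status: "eval (eq (V ''status'') (Num 1)) ?s = 0" "eval (eq (V ''status'') (Num 2)) ?s = 0"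
      by (simp_all add: eval_eq)
    have "outcome I {..<Suc k} ?s"
      using out' by (rule outcome_infeasible) (use valid Infeasible P_eq in auto)
    then have "runs solver update ?s (1 + (1 + 1))
        (\<lambda>s'. agree update_vars ?s s' \<and> outcome I {..<Suc k} s')"
      unfolding update_def by (intro runs_Cond Skip agree_refl) (simp_all add: status)
    then show ?thesis by (rule runs_weaken) (simp_all add: update_time_def)
  next
    case Unbounded
    then have "?s ''status'' [] = 1" by simp
    then have status: "eval (eq (V ''status'') (Num 1)) ?s \<noteq> 0" by (simp add: eval_eq)
    have "runs solver (Assign ''result'' [] (Num 1)) ?s (1 + cell_size w)
        (\<lambda>s'. agree update_vars ?s s' \<and> outcome I {..<Suc k} s')"
    proof (rule runs_weaken[OF runs_Assign_scalar[where r = 1 and w = w]])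
      fix s' assume "agree {''result''} ?s s' \<and> s' ''result'' [] = 1"
      then show "agree update_vars ?s s' \<and> outcome I {..<Suc k} s'"
        using agree_mono[of "{''result''}" ?s s' update_vars] valid Unbounded
        by (auto simp: update_vars_def P_eq intro: outcome_unbounded)
    qed (auto simp: small_1)
    then have "runs solver update ?s (1 + (1 + cell_size w))
        (\<lambda>s'. agree update_vars ?s s' \<and> outcome I {..<Suc k} s')"
      unfolding update_def by (intro runs_Cond) (use status in simp_all)
    then show ?thesis by (rule runs_weaken) (simp_all add: update_time_def)
  next
    case (Optimal z)
    then have "?s ''status'' [] = 2" by simp
    then have status: "eval (eq (V ''status'') (Num 1)) ?s = 0" "eval (eq (V ''status'') (Num 2)) ?s \<noteq> 0"
      by (simp_all add: eval_eq)
    have cols: "cols P = n_x I + 2 * n_y I + 1" using P by (simp add: same_lp_def label_lp_def)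
    have sol: "?s ''sol'' [j] = z j" if "j < n_x I + 2 * n_y I + 1" for j
      using that Optimal cols by simp
    have z: "rat_size (z j) \<le> w" if "j < n_x I + 2 * n_y I + 1" for j
      using rat_size_answer[of j P z] that w Optimal cols by simp
    have "w \<le> bits w" by (simp add: bits_def)
    then have z': "small (z j) (bits w)" if "j < n_x I + 2 * n_y I + 1" for j
      using z[OF that] by (intro small_of_size) simp
    let ?obj = "lp_objective (label_program I k) (\<lambda>j. real_of_rat (z j))"
    have opt: "lp_feasible (label_program I k) (\<lambda>j. real_of_rat (z j))"
      "\<And>z'. lp_feasible (label_program I k) z' \<Longrightarrow> ?obj \<le> lp_objective (label_program I k) z'"
      using valid Optimal P_eq by auto
    define R where "R s' \<longleftrightarrow> agree (fill_vars ''val'') ?s s' \<and> real_of_rat (s' ''val'' [0]) = ?obj \<and>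
        small (s' ''val'' [0]) (bits w)" for s'
    have val: "runs solver fill_val ?s (fill_time w) R"
      by (rule runs_weaken[OF runs_fill_val[where z = z, OF okay' I sol z]]) (auto simp: R_def)
    have rest: "runs solver (Cond better_exp store_solution Skip) s1
        (1 + (2 + 2 * cell_size w + 2 * fill_time w))
        (\<lambda>s'. agree update_vars ?s s' \<and> outcome I {..<Suc k} s')" if "R s1" for s1
    proof (rule runs_Cond)
      have a: "agree (fill_vars ''val'') ?s s1" and v: "real_of_rat (s1 ''val'' [0]) = ?obj"
        "small (s1 ''val'' [0]) (bits w)" using that by (simp_all add: R_def)
      have a': "agree update_vars ?s s1"
        using a by (rule agree_mono) (simp add: fill_vars_def update_vars_def)
      note okay1 = prepared_agree[OF okay' a prepared_disjoint(3)]
      have out1: "outcome I {..<k} s1" using out' a by (rule outcome_agree) (simp add: fill_vars_def)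
      have sol1: "s1 ''sol'' [j] = z j" if "j < n_x I + 2 * n_y I + 1" for j
        using sol[OF that] a by (simp add: agree_def fill_vars_def)
      have opt1: "real_of_rat (s1 ''val'' [0]) \<le> lp_objective (label_program I k) z'"
        if "lp_feasible (label_program I k) z'" for z'
        using opt(2)[OF that] v(1) by simp
      show "runs solver store_solution s1 (2 + 2 * cell_size w + 2 * fill_time w)
          (\<lambda>s'. agree update_vars ?s s' \<and> outcome I {..<Suc k} s')"
        if better: "eval better_exp s1 \<noteq> 0"
      proof (rule runs_weaken[OF runs_store_solution[where z = z, OF okay1 I sol1 z' refl v(2)]])
        fix s' assume s': "agree update_vars s1 s' \<and> s' ''result'' [] = 2 \<and>
          s' ''best'' [] = s1 ''val'' [0] \<and> (\<forall>j<n_x I. s' ''x'' [j] = z j) \<and>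
          (\<forall>i<2. \<forall>j<n_y I. s' ''y'' [i, j] = y_part I z i j)"
        then have "outcome I {..<Suc k} s'"
          using outcome_better[OF out1 better[unfolded eval_better_exp] opt1 opt(1) v(1)[symmetric]]
          by blast
        then show "agree update_vars ?s s' \<and> outcome I {..<Suc k} s'"
          using s' agree_trans[OF a'] by blast
      qed auto
      show "runs solver Skip s1 (2 + 2 * cell_size w + 2 * fill_time w)
          (\<lambda>s'. agree update_vars ?s s' \<and> outcome I {..<Suc k} s')"
        if "eval better_exp s1 = 0"
      proof (rule runs_weaken[OF Skip[OF a']])
        show "outcome I {..<Suc k} s1"
          using out1 _ opt1 by (rule outcome_not_better) (use that eval_better_exp in blast)
      qed auto
    qed
    have "runs solver update ?s (1 + (1 + (fill_time w + (1 + (2 + 2 * cell_size w + 2 * fill_time w)))))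
        (\<lambda>s'. agree update_vars ?s s' \<and> outcome I {..<Suc k} s')"
      unfolding update_def
      by (intro runs_Cond runs_Seq[OF val rest]) (use status in simp_all)
    then show ?thesis by (rule runs_weaken) (simp_all add: update_time_def)
  qed
qed

definition body :: com where
  "body = Seq fill_lhs (Seq fill_rhs (Seq Solve update))"

definition body_time :: "'a::comm_semiring_1 \<Rightarrow> 'a" where
  "body_time w = 2 * fill_time w + 1 + update_time w"

definition body_vars :: "string set" where
  "body_vars = {''lhs'', ''rhs'', ''status'', ''sol''} \<union> update_vars"

lemma exec_body:
  assumes okay: "okay I prepared s" and k: "s ''mask'' [] = of_nat k" "k < 2 ^ n_vert I"
    and out: "outcome I {..<k} s" and solver: "lp_solver solver"
  obtains t P s' where "exec solver body s t [P] s'" "same_lp P (label_program I k)"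
    "t \<le> body_time (instance_size I + answer_size P (solver P))" "agree body_vars s s'"
    "outcome I {..<Suc k} s'"
proof -
  let ?w = "instance_size I"
  obtain t1 s1 where 1: "exec solver fill_lhs s t1 [] s1" "t1 \<le> fill_time ?w"
    "agree (fill_vars ''lhs'') s s1" "\<forall>i<pair_rows I + 2. \<forall>j<n_x I + 2 * n_y I + 1.
       s1 ''lhs'' [i, j] = lhs (label_program I k) i j"
    using runs_fill_lhs[OF okay order_refl k] unfolding runs_def by blast
  note okay1 = prepared_agree[OF okay 1(3) prepared_disjoint(1)]
  have k1: "s1 ''mask'' [] = of_nat k" using 1(3) k by (simp add: agree_def fill_vars_def)
  obtain t2 s2 where 2: "exec solver fill_rhs s1 t2 [] s2" "t2 \<le> fill_time ?w"
    "agree (fill_vars ''rhs'') s1 s2" "\<forall>i<pair_rows I + 2. s2 ''rhs'' [i] = rhs (label_program I k) i"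
    using runs_fill_rhs[OF okay1 order_refl k1 k(2)] unfolding runs_def by blast
  note okay2 = prepared_agree[OF okay1 2(3) prepared_disjoint(2)]
  define P where "P = read_lp s2"
  have lhs: "s2 ''lhs'' = s1 ''lhs''" using 2(3) by (simp add: agree_def fill_vars_def)
  have P: "same_lp P (label_program I k)"
  proof -
    have "rows P = pair_rows I + 2" "cols P = n_x I + 2 * n_y I + 1"
      unfolding P_def read_lp_def using okay_scalar(2,3)[OF okay2]
      by (simp_all only: lin_prog.simps floor_of_nat nat_int)
    moreover have "content I ''obj'' (s2 ''obj'')" "content I ''integral'' (s2 ''integral'')"
      by (rule okayD[OF okay2]; simp add: prepared_def)+
    ultimately show ?thesis
      unfolding same_lp_def using 1(4) 2(4)
      by (simp add: P_def read_lp_def lhs content_computed) (simp add: label_lp_def)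
  qed
  have out2: "outcome I {..<k} s2"
    using outcome_agree[OF outcome_agree[OF out 1(3)] 2(3)] by (simp add: fill_vars_def)
  have "valid_answer P (solver P)" using solver by (simp add: lp_solver_def)
  from runs_update[OF okay2 order_refl P this out2]
  obtain t3 s3 where 3: "exec solver update (write_answer P (solver P) s2) t3 [] s3"
    "t3 \<le> update_time (?w + answer_size P (solver P))"
    "agree update_vars (write_answer P (solver P) s2) s3" "outcome I {..<Suc k} s3"
    unfolding runs_def by blast
  have "exec solver Solve s2 1 [P] (write_answer P (solver P) s2)"
    unfolding P_def by (rule exec_Solve)
  from exec_Seq[OF 1(1) exec_Seq[OF 2(1) exec_Seq[OF this 3(1)]]]
  have "exec solver body s (t1 + (t2 + (1 + t3))) [P] s3" by (simp add: body_def)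
  moreover have "t1 + (t2 + (1 + t3)) \<le> body_time (?w + answer_size P (solver P))"
    using 1(2) 2(2) 3(2) bounds_mono(5)[of ?w "?w + answer_size P (solver P)"]
    by (simp add: body_time_def)
  moreover have "agree body_vars s s3"
  proof -
    have "agree {''status'', ''sol''} s2 (write_answer P (solver P) s2)"
      by (cases "solver P") (auto simp: agree_def)
    then have "agree body_vars s2 (write_answer P (solver P) s2)"
      by (rule agree_mono) (simp add: body_vars_def)
    moreover have "agree body_vars s s1" using 1(3)
      by (rule agree_mono) (simp add: body_vars_def fill_vars_def update_vars_def)
    moreover have "agree body_vars s1 s2" using 2(3)
      by (rule agree_mono) (simp add: body_vars_def fill_vars_def update_vars_def)
    moreover have "agree body_vars (write_answer P (solver P) s2) s3" using 3(3)
      by (rule agree_mono) (auto simp: body_vars_def)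
    ultimately show ?thesis by (blast intro: agree_trans)
  qed
  ultimately show ?thesis using that P 3(4) by blast
qed

definition loop_time :: "'a::comm_semiring_1 \<Rightarrow> 'a" where
  "loop_time w = body_time w + 2 + cell_size w"

definition main_loop :: com where
  "main_loop = For ''mask'' (Cell ''pow'' [V ''n_vert'']) body"

lemma exec_main_loop:
  assumes okay: "okay I prepared s" and result: "s ''result'' [] = 0" and solver: "lp_solver solver"
  obtains t Q s' where "exec solver main_loop s t Q s'" "outcome I {..<2 ^ n_vert I} s'"
    "length Q = 2 ^ n_vert I" "\<forall>P\<in>set Q. \<exists>k. same_lp P (label_program I k)"
    "\<And>N. (\<forall>P\<in>set Q. answer_size P (solver P) \<le> N) \<Longrightarrow>
      t \<le> (2 ^ n_vert I + 1) * loop_time (instance_size I + N) + 1"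
proof -
  \<comment> \<open>The time bound is quantified over \<open>N\<close> inside the invariant: whether
    \<open>N\<close> bounds the answers can be said only of the calls already made, and each round
    adds one.\<close>
  define Inv where "Inv k t Q s \<longleftrightarrow> okay I prepared s \<and> s ''mask'' [] = of_nat k \<and>
      outcome I {..<k} s \<and> length Q = k \<and> (\<forall>P\<in>set Q. \<exists>k. same_lp P (label_program I k)) \<and>
      (\<forall>N. (\<forall>P\<in>set Q. answer_size P (solver P) \<le> N) \<longrightarrow> t \<le> (k + 1) * loop_time (instance_size I + N))"
    for k t Q and s :: store
  have mask: "okay I prepared (set_cell ''mask'' [] r s)" if "okay I prepared s" for r s
    using that agree_set_cell[OF agree_refl singletonI]
    by (rule okay_agree) (simp add: prepared_def inputs_def)
  have mask_outcome: "outcome I K (set_cell ''mask'' [] r s)" if "outcome I K s" for r s K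
    using that agree_set_cell[OF agree_refl singletonI] by (rule outcome_agree) simp
  have counter: "rat_size (of_nat k) \<le> cell_size (instance_size I + N)" if "k \<le> 2 ^ n_vert I" for k N
  proof (rule rat_size_small, rule small_of_nat, rule order_trans[OF that])
    have "n_vert I \<le> bits (instance_size I + N)"
      using instance_size_dims(5)[OF order_refl, of I] by (simp add: bits_def)
    then show "2 ^ n_vert I \<le> (2 :: nat) ^ bits (instance_size I + N)" by (intro power_increasing) auto
  qed
  have "\<exists>t Q s'. exec solver main_loop s (t + 1) Q s' \<and> Inv (2 ^ n_vert I) t Q s'"
    unfolding main_loop_def
  proof (rule exec_For)
    fix k t Q s assume "k \<le> 2 ^ n_vert I" "Inv k t Q s"
    then have "okay I prepared s" by (simp add: Inv_def)
    note this = okay_scalar[OF this]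
    then show "eval (Cell ''pow'' [V ''n_vert'']) s = of_nat (2 ^ n_vert I)"
      by (simp add: okay_inputs)
    show "s ''mask'' [] = of_nat k" using \<open>Inv k t Q s\<close> by (simp add: Inv_def)
  next
    have "outcome I {..<0} s" using result by (simp add: outcome_def)
    moreover have "1 + rat_size 0 \<le> loop_time (instance_size I + N)" for N
      using counter[of 0 N] by (simp add: loop_time_def)
    ultimately show "Inv 0 (1 + rat_size 0) [] (set_cell ''mask'' [] 0 s)"
      using mask[OF okay] mask_outcome by (simp add: Inv_def set_cell_apply)
  next
    fix k t Q s assume k: "k < 2 ^ n_vert I" and inv: "Inv k t Q s"
    then have "okay I prepared s" "s ''mask'' [] = of_nat k" "outcome I {..<k} s"
      by (simp_all add: Inv_def)
    from exec_body[OF this(1,2) k this(3) solver]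
    obtain t' P s' where body: "exec solver body s t' [P] s'" "same_lp P (label_program I k)"
      "t' \<le> body_time (instance_size I + answer_size P (solver P))" "agree body_vars s s'"
      "outcome I {..<Suc k} s'" by blast
    have okay': "okay I prepared s'"
      using \<open>okay I prepared s\<close> body(4)
      by (rule okay_agree) (simp add: prepared_def inputs_def body_vars_def update_vars_def)
    have mask': "s' ''mask'' [] = of_nat k"
      using \<open>s ''mask'' [] = of_nat k\<close> body(4) by (simp add: agree_def body_vars_def update_vars_def)
    have time: "t + t' + 2 + rat_size (of_nat (Suc k)) \<le> (Suc k + 1) * loop_time (instance_size I + N)"
      if N: "\<forall>P\<in>set (Q @ [P]). answer_size P (solver P) \<le> N" for N
    proof -
      have "t \<le> (k + 1) * loop_time (instance_size I + N)" using inv N by (simp add: Inv_def)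
      moreover have "body_time (instance_size I + answer_size P (solver P)) \<le> body_time (instance_size I + N)"
        using N bounds_mono[of "instance_size I + answer_size P (solver P)" "instance_size I + N"]
        by (simp add: body_time_def update_time_def)
      moreover have "rat_size (of_nat (Suc k)) \<le> cell_size (instance_size I + N)"
        using counter[of "Suc k" N] k by simp
      ultimately have "t + t' + 2 + rat_size (of_nat (Suc k))
          \<le> (k + 1) * loop_time (instance_size I + N) + loop_time (instance_size I + N)"
        using body(3) unfolding loop_time_def by linarith
      then show ?thesis by (simp add: algebra_simps)
    qed
    have "Inv (Suc k) (t + t' + 2 + rat_size (of_nat (Suc k))) (Q @ [P])
        (set_cell ''mask'' [] (of_nat (Suc k)) s')"
      unfolding Inv_def
    proof (intro conjI allI impI)
      show "\<forall>P\<in>set (Q @ [P]). \<exists>k. same_lp P (label_program I k)"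
        using inv body(2) by (auto simp: Inv_def)
    qed (use mask[OF okay'] mask_outcome[OF body(5)] inv time in \<open>simp_all add: Inv_def set_cell_apply\<close>)
    then show "\<exists>t' Q' s'. exec solver body s t' Q' s' \<and> s' ''mask'' [] = of_nat k \<and>
        Inv (Suc k) (t + t' + 2 + rat_size (of_nat (Suc k))) (Q @ Q')
          (set_cell ''mask'' [] (of_nat (Suc k)) s')"
      using body(1) mask' by blast
  qed
  then obtain t Q s' where "exec solver main_loop s (t + 1) Q s'" "Inv (2 ^ n_vert I) t Q s'" by blast
  then show ?thesis using that[of "t + 1" Q s'] by (auto simp: Inv_def)
qed

text \<open>The cost of preparation and search after a factor \<open>2 ^ n\<close> has been taken
  out; \<open>2 * loop_time w + 1\<close> absorbs the excess in
  \<open>(2 ^ n + 1) * loop_time w + 1\<close>.\<close>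

definition total_time :: "'a::comm_semiring_1 \<Rightarrow> 'a" where
  "total_time w = 3 * (1 + cell_size w) + 7 * fill_time w + 2 * loop_time w + 1"

theorem theorem1p1:
  fixes k :: nat
  assumes "k = 2"
  shows
    "\<exists>(prog :: com) (p :: nat poly).
       \<forall>I solver.
         well_formed I \<longrightarrow> deterministic_A I \<longrightarrow> deterministic_B I \<longrightarrow> lp_solver solver \<longrightarrow>
         (\<exists>t Q s.
            exec solver prog (load I) t Q s \<and>
            adapt_solved I k s \<and>
            length Q \<le> 3 ^ card (vertices (Omega I)) \<and>
            (\<forall>P\<in>set Q. lp_size P \<le> poly p (instance_size I)) \<and>
            (continuous_variables I \<longrightarrow> (\<forall>P\<in>set Q. is_pure_lp P)) \<and>
            (\<forall>N. (\<forall>P\<in>set Q. answer_size P (solver P) \<le> N) \<longrightarrow>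
               t \<le> 3 ^ card (vertices (Omega I)) * poly p (instance_size I + N)))"
\<comment> \<open>A single polynomial has to bound both the sizes of the programs and, up to the
  exponential factor, the time; hence the sum of the two bounds.\<close>
proof (rule exI[of _ "Seq prelude main_loop"], rule exI[of _ "lp_bound [:0, 1:] + total_time [:0, 1:]"],
    intro allI impI)
  fix I solver
  assume wf: "well_formed I" and det: "deterministic_A I" "deterministic_B I"
    and solver: "lp_solver solver"
  define n where "n = n_vert I"
  \<comment> \<open>Well-formedness identifies the number of listed points with the number of
    vertices, so that the \<open>2 ^ n_vert I\<close> calls can be compared with the required
    bound.\<close>
  have card: "card (vertices (Omega I)) = n"
    using bij_betw_same_card[of "vertex_point I" "{..<n_vert I}" "vertices (Omega I)"] wf
    by (simp add: well_formed_def n_def)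
  have pow: "2 ^ n \<le> (3 :: nat) ^ n" by (rule power_mono) auto
  have p: "poly (lp_bound [:0, 1:] + total_time [:0, 1:]) z = lp_bound z + total_time z" for z :: nat
    by (simp add: total_time_def loop_time_def body_time_def update_time_def del: One_nat_def)
  obtain t1 s1 where 1: "exec solver prelude (load I) t1 [] s1"
    "t1 \<le> 2 ^ n * (3 * (1 + cell_size (instance_size I)) + 7 * fill_time (instance_size I))"
    "okay I (insert ''result'' prepared) s1"
    using runs_prelude[OF order_refl, of solver I] unfolding runs_def n_def by blast
  have okay: "okay I prepared s1" using 1(3) by (rule okay_mono) blast
  have "s1 ''result'' [] = 0"
    using okayD[OF 1(3), of "''result''"] by (simp add: content_def load_def)
  from exec_main_loop[OF okay this solver]
  obtain t Q s where 2: "exec solver main_loop s1 t Q s" "outcome I {..<2 ^ n} s" "length Q = 2 ^ n"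
    "\<forall>P\<in>set Q. \<exists>k. same_lp P (label_program I k)"
    "\<And>N. (\<forall>P\<in>set Q. answer_size P (solver P) \<le> N) \<Longrightarrow>
      t \<le> (2 ^ n + 1) * loop_time (instance_size I + N) + 1"
    unfolding n_def by blast
  have "exec solver (Seq prelude main_loop) (load I) (t1 + t) Q s"
    using exec_Seq[OF 1(1) 2(1)] by simp
  moreover have "adapt_solved I k s"
    unfolding assms using adapt_solved_outcome[OF det] 2(2) by (simp add: n_def)
  moreover have "lp_size P \<le> lp_bound (instance_size I) + total_time (instance_size I)"
    if P: "P \<in> set Q" for P
  proof -
    obtain k' where "same_lp P (label_program I k')" using bspec[OF 2(4) P] ..
    then show ?thesis
      using lp_size_label_lp[OF order_refl, of I "mask_label k'"] by (simp only: same_lp_imp_eq(3) trans_le_add1)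
  qed
  moreover have "is_pure_lp P" if cont: "continuous_variables I" and P: "P \<in> set Q" for P
  proof -
    obtain k' where "same_lp P (label_program I k')" using bspec[OF 2(4) P] ..
    then show ?thesis using is_pure_label_lp[OF cont] by (simp only: same_lp_imp_eq(4))
  qed
  moreover have "t1 + t \<le> 3 ^ n * (lp_bound (instance_size I + N) + total_time (instance_size I + N))"
    if N: "\<forall>P\<in>set Q. answer_size P (solver P) \<le> N" for N
  proof -
    let ?w = "instance_size I + N"
    have "t1 \<le> 2 ^ n * (3 * (1 + cell_size ?w) + 7 * fill_time ?w)"
    proof (rule order_trans[OF 1(2)], rule mult_le_mono2)
      show "3 * (1 + cell_size (instance_size I)) + 7 * fill_time (instance_size I)
          \<le> 3 * (1 + cell_size ?w) + 7 * fill_time ?w"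
        using bounds_mono[of "instance_size I" ?w] by simp
    qed
    moreover have "(2 ^ n + 1) * loop_time ?w + 1 \<le> 2 ^ n * (2 * loop_time ?w + 1)"
    proof -
      have "loop_time ?w + 1 \<le> 2 ^ n * (loop_time ?w + 1)"
        using mult_le_mono1[of 1 "2 ^ n" "loop_time ?w + 1"] by simp
      then show ?thesis by (simp add: algebra_simps)
    qed
    ultimately have "t1 + t \<le> 2 ^ n * (3 * (1 + cell_size ?w) + 7 * fill_time ?w)
        + 2 ^ n * (2 * loop_time ?w + 1)"
      using 2(5)[OF N] by linarith
    also have "\<dots> = 2 ^ n * total_time ?w"
      by (simp only: total_time_def distrib_left add.assoc)
    also have "\<dots> \<le> 3 ^ n * (lp_bound ?w + total_time ?w)"
      using pow by (intro mult_le_mono) auto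
    finally show ?thesis .
  qed
  ultimately show "\<exists>t Q s.
      exec solver (Seq prelude main_loop) (load I) t Q s \<and> adapt_solved I k s \<and>
      length Q \<le> 3 ^ card (vertices (Omega I)) \<and>
      (\<forall>P\<in>set Q. lp_size P \<le> poly (lp_bound [:0, 1:] + total_time [:0, 1:]) (instance_size I)) \<and>
      (continuous_variables I \<longrightarrow> (\<forall>P\<in>set Q. is_pure_lp P)) \<and>
      (\<forall>N. (\<forall>P\<in>set Q. answer_size P (solver P) \<le> N) \<longrightarrow>
         t \<le> 3 ^ card (vertices (Omega I))
           * poly (lp_bound [:0, 1:] + total_time [:0, 1:]) (instance_size I + N))"
    unfolding card p using pow 2(3)
    by (intro exI[of _ "t1 + t"] exI[of _ Q] exI[of _ s] conjI allI impI ballI) simp_all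
qed

end
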